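(* Let $\delta\in(0,\alpha)$. For any $\eta>0$ and $\mu>0$, with probability one, there is a positive integer $N$ such that for all integers $n\ge N$, $$\sup_{x\in[\delta n,\alpha n]}x^{\frac14-\eta}|X(x,n)-u(x,n)|\le\mu,$$ $$\sup_{x\in[\delta n,\alpha n]}x^{\frac34-\eta}|\partial_xX(x,n)-\partial_xu(x,n)|\le\mu.$$
   Context: Fix $\alpha\in(0,1)$ and let $\sigma=\sqrt{\alpha(1-\alpha)}$. Let $W$ be a standard two-dimensional Brownian motion on $[0,\infty)$. Discrete Conga line (coupled to $W$): $X_1(n)=W(n)$ for integers $n\ge 0$; inductively, for $j\ge1$, $X_{j+1}(0)=0$ and $X_{j+1}(n)=(1-\alpha)X_{j+1}(n-1)+\alpha X_j(n-1)$ for $n\ge 1$. For integer $n\ge1$, $X(\cdot,n)$ denotes the linear interpolation of $\{X_k(n):k\in[1,n]\cap\mathbb{Z}\}$, i.e. $X(k,n)=X_k(n)$ at integers $k$ and $X(\cdot,n)$ is affine between consecutive integers. $\partial_xX$ is its derivative in $x$ at non-integer points, with the convention $\partial_xX(k,n)=X_{k+1}(n)-X_k(n)$ at integers $k$. Continuous Conga line: for $x>0$, $t>0$, $$u(x,t)=\int_0^t W(t-z)\,\frac{1}{\sqrt{2\pi}}\,\frac{x+\alpha z}{2\sigma z^{3/2}}\exp\left(-\frac{(x-\alpha z)^2}{2\sigma^2 z}\right)dz ,$$ and $\partial_xu$ is its partial derivative in $x$. $|\cdot|$ is the Euclidean norm. *)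

theory Defs
  imports "HOL-Probability.Probability"
begin

definition linear_brownian_motion :: "'a measure \<Rightarrow> (real \<Rightarrow> 'a \<Rightarrow> real) \<Rightarrow> bool" where
  "linear_brownian_motion M B \<longleftrightarrow>
     prob_space M \<and>
     (\<forall>t\<ge>0. B t \<in> borel_measurable M) \<and>
     (AE \<omega> in M. B 0 \<omega> = 0) \<and>
     (\<forall>m (t :: nat \<Rightarrow> real). 0 \<le> t 0 \<longrightarrow> (\<forall>i<m. t i \<le> t (Suc i)) \<longrightarrow>
        prob_space.indep_vars M (\<lambda>_. borel) (\<lambda>i \<omega>. B (t (Suc i)) \<omega> - B (t i) \<omega>) {..<m}) \<and>
     (\<forall>s t. 0 \<le> s \<longrightarrow> s < t \<longrightarrow>
        distributed M lborel (\<lambda>\<omega>. B t \<omega> - B s \<omega>)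
          (\<lambda>x. ennreal (normal_density 0 (sqrt (t - s)) x))) \<and>
     (AE \<omega> in M. continuous_on {0..} (\<lambda>t. B t \<omega>))"

text \<open>The coordinates are linear Brownian motions which are independent as processes, i.e. as
  random elements of the product space indexed by \<open>{0..}\<close>.\<close>

definition standard_brownian_motion ::
    "'a measure \<Rightarrow> (real \<Rightarrow> 'a \<Rightarrow> real ^ 'd) \<Rightarrow> bool" where
  "standard_brownian_motion M W \<longleftrightarrow>
     prob_space M \<and>
     (\<forall>i. linear_brownian_motion M (\<lambda>t \<omega>. W t \<omega> $ i)) \<and>
     prob_space.indep_vars M (\<lambda>_. PiM {0..} (\<lambda>_. borel))
       (\<lambda>i \<omega>. \<lambda>t\<in>{0..}. W t \<omega> $ i) UNIV"

text \<open>\<open>conga \<alpha> w j n\<close> is the value $X_j(n)$ of the discrete Conga line driven by the path \<open>w\<close>.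
  The line starts at index \<open>1\<close>; the value at index \<open>0\<close> is a dummy.\<close>

fun conga :: "real \<Rightarrow> (real \<Rightarrow> 'v::real_vector) \<Rightarrow> nat \<Rightarrow> nat \<Rightarrow> 'v" where
  "conga \<alpha> w 0 n = 0"
| "conga \<alpha> w (Suc 0) n = w (real n)"
| "conga \<alpha> w (Suc (Suc j)) 0 = 0"
| "conga \<alpha> w (Suc (Suc j)) (Suc n) =
     (1 - \<alpha>) *\<^sub>R conga \<alpha> w (Suc (Suc j)) n + \<alpha> *\<^sub>R conga \<alpha> w (Suc j) n"

text \<open>Only meaningful for \<open>x \<ge> 1\<close>, because of the dummy value at index \<open>0\<close>.\<close>

definition conga_interp :: "real \<Rightarrow> (real \<Rightarrow> 'v::real_vector) \<Rightarrow> real \<Rightarrow> nat \<Rightarrow> 'v" where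
  "conga_interp \<alpha> w x n =
     (let k = nat \<lfloor>x\<rfloor>
      in conga \<alpha> w k n + (x - real k) *\<^sub>R (conga \<alpha> w (Suc k) n - conga \<alpha> w k n))"

definition conga_interp_dx ::
    "real \<Rightarrow> (real \<Rightarrow> 'v::real_normed_vector) \<Rightarrow> real \<Rightarrow> nat \<Rightarrow> 'v" where
  "conga_interp_dx \<alpha> w x n =
     (if x \<in> \<int> then conga \<alpha> w (Suc (nat \<lfloor>x\<rfloor>)) n - conga \<alpha> w (nat \<lfloor>x\<rfloor>) n
      else vector_derivative (\<lambda>y. conga_interp \<alpha> w y n) (at x))"

definition conga_sigma :: "real \<Rightarrow> real" where
  "conga_sigma \<alpha> = sqrt (\<alpha> * (1 - \<alpha>))"

text \<open>The integrand takes the value \<open>0\<close> at \<open>z = 0\<close> (division by zero); for \<open>x > 0\<close> and a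
  continuous path this is its continuous extension.\<close>

definition conga_cont ::
    "real \<Rightarrow> (real \<Rightarrow> 'v::euclidean_space) \<Rightarrow> real \<Rightarrow> real \<Rightarrow> 'v" where
  "conga_cont \<alpha> w x t =
     integral {0..t} (\<lambda>z.
       (1 / sqrt (2 * pi) * ((x + \<alpha> * z) / (2 * conga_sigma \<alpha> * z powr (3/2))) *
         exp (- ((x - \<alpha> * z)\<^sup>2 / (2 * (conga_sigma \<alpha>)\<^sup>2 * z)))) *\<^sub>R w (t - z))"

definition conga_cont_dx ::
    "real \<Rightarrow> (real \<Rightarrow> 'v::euclidean_space) \<Rightarrow> real \<Rightarrow> real \<Rightarrow> 'v" where
  "conga_cont_dx \<alpha> w x t = vector_derivative (\<lambda>y. conga_cont \<alpha> w y t) (at x)"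

end

theory Submission
  imports Defs "HOL-Real_Asymp.Real_Asymp"
begin

text \<open>The \<open>(k + 1)\<close>-st member of the discrete line is an average \<open>\<Sum>m\<le>n. p k m * W (n - m)\<close> of the leader's path,
where \<open>p k\<close> is the law of the \<open>k\<close>-th success time in Bernoulli trials with success probability \<open>\<alpha>\<close>
(\<open>conga_eq_neg_binomial_average\<close>).  The continuous line is the integral of the same path against the
density in \<open>z\<close> of \<open>normal_cdf ((\<alpha> * z - x) / (\<sigma> * sqrt z))\<close>, the normal approximation to the same law.
The theorem is thus a pathwise consequence of a local limit theorem, once the path is known to be as
regular as a Brownian path.

Let \<open>x\<close> be of order \<open>n\<close> and \<open>L = n powr (1/2 + \<epsilon>)\<close>.  Both kernels live in the window
\<open>\<bar>\<alpha> * m - x\<bar> \<le> L\<close>, up to errors smaller than any power of \<open>n\<close>.  There they have size \<open>n powr (-1/2)\<close> and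
differ by about \<open>n powr (-1)\<close>, while the path moves by about \<open>n powr (1/4)\<close> in the window.  Since the
window has about \<open>n powr (1/2)\<close> points and the total masses agree, the difference of the averages is about
\<open>n powr (1/2 - 1 + 1/4) = n powr (-1/4)\<close>.  The derivatives in \<open>x\<close> of the kernels differ by about
\<open>n powr (-3/2)\<close>, which gives \<open>n powr (-3/4)\<close>.  All powers of \<open>n powr \<epsilon>\<close> lost on the way are absorbed by
\<open>\<eta>\<close>.  The local limit theorem (\<open>ln_neg_binomial_conga_kernel\<close>) comes from Stirling's formula and allows
shifts of order one in both arguments, so it covers all real \<open>x\<close>, the interpolation and its slopes at once.

One point is delicate: inside a unit cell of time the Brownian path moves by order one, so replacing the
integral by a sum produces an error of order one if the cells are estimated one by one.  But the errors of
different cells are independent and centred.  Their partial sums have the size of a random walk, and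
summation by parts against the slowly varying kernel makes their contribution as small as the
rest (\<open>kernel_comparison\<close>).

Probability enters only through \<open>AE_tame_path\<close>: increments of the path and partial sums of cell errors have
sub-Gaussian exponential moments, and Borel--Cantelli turns these into bounds valid for all integer
times up to \<open>n\<close> and all large \<open>n\<close>.  Everything else is deterministic and uniform in \<open>x\<close>
(\<open>conga_error_bounds\<close>).\<close>

section \<open>Exponential moments of Brownian functionals\<close>

text \<open>Completing the square turns the tilted centred density into a shifted normal density, whose mass is one.\<close>

lemma nn_integral_exp_normal:
  assumes "s > 0"
  shows "(\<integral>\<^sup>+x. ennreal (normal_density 0 s x) * ennreal (exp (l * x)) \<partial>lborel) = ennreal (exp (l\<^sup>2 * s\<^sup>2 / 2))"
proof -
  have eq: "normal_density 0 s x * exp (l * x) = exp (l\<^sup>2 * s\<^sup>2 / 2) * normal_density (l * s\<^sup>2) s x" for x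
  proof -
    have "- x\<^sup>2 / (2 * s\<^sup>2) + l * x = l\<^sup>2 * s\<^sup>2 / 2 + - (x - l * s\<^sup>2)\<^sup>2 / (2 * s\<^sup>2)"
      using assms by (simp add: field_simps power2_eq_square)
    then have "exp (- x\<^sup>2 / (2 * s\<^sup>2)) * exp (l * x) = exp (l\<^sup>2 * s\<^sup>2 / 2) * exp (- (x - l * s\<^sup>2)\<^sup>2 / (2 * s\<^sup>2))"
      by (simp only: exp_add [symmetric])
    then show ?thesis by (simp add: normal_density_def)
  qed
  have one: "(\<integral>\<^sup>+x. ennreal (normal_density m s x) \<partial>lborel) = 1" for m
    using nn_integral_eq_integral[OF integrable_normal_density[OF assms, of m]]
      integral_normal_density[OF assms, of m] by simp
  have "(\<integral>\<^sup>+x. ennreal (normal_density 0 s x) * ennreal (exp (l * x)) \<partial>lborel)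
      = (\<integral>\<^sup>+x. ennreal (exp (l\<^sup>2 * s\<^sup>2 / 2)) * ennreal (normal_density (l * s\<^sup>2) s x) \<partial>lborel)"
    by (simp add: ennreal_mult[symmetric] eq)
  also have "\<dots> = ennreal (exp (l\<^sup>2 * s\<^sup>2 / 2))"
    by (simp add: nn_integral_cmult one)
  finally show ?thesis .
qed

text \<open>Weighted sums of Brownian increments with weights in \<open>[-1, 1]\<close> are sub-Gaussian with variance proxy the elapsed
time: independence factorises the moment generating function, and shrinking a weight only decreases a
factor. Plain increments and discretised time integrals of the path are both of this form, so this one
estimate feeds everything below.\<close>

lemma mgf_weighted_increments:
  fixes B :: "real \<Rightarrow> 'a \<Rightarrow> real" and c :: "nat \<Rightarrow> real" and t :: "nat \<Rightarrow> real"
  assumes B: "linear_brownian_motion M B"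
    and t: "0 \<le> t 0" "\<And>i. i < m \<Longrightarrow> t i \<le> t (Suc i)" and c: "\<And>i. i < m \<Longrightarrow> \<bar>c i\<bar> \<le> 1"
  shows "(\<integral>\<^sup>+\<omega>. ennreal (exp (l * (\<Sum>i<m. c i * (B (t (Suc i)) \<omega> - B (t i) \<omega>)))) \<partial>M)
    \<le> ennreal (exp (l\<^sup>2 * (t m - t 0) / 2))"
proof -
  interpret prob_space M using B by (simp add: linear_brownian_motion_def)
  define D where "D i \<omega> = B (t (Suc i)) \<omega> - B (t i) \<omega>" for i \<omega>
  have ind: "indep_vars (\<lambda>_. borel) D {..<m}"
    using B t unfolding linear_brownian_motion_def D_def[abs_def] by blast
  have t0: "0 \<le> t i" if "i \<le> m" for i
    using that t by (induction i) (auto intro: order_trans)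
  have one: "(\<integral>\<^sup>+\<omega>. ennreal (exp (l * c i * D i \<omega>)) \<partial>M) \<le> ennreal (exp (l\<^sup>2 * (t (Suc i) - t i) / 2))"
    if i: "i < m" for i
  proof (cases "t i = t (Suc i)")
    case True
    then show ?thesis by (simp add: D_def emeasure_space_1)
  next
    case False
    then have lt: "t i < t (Suc i)" using t(2)[OF i] by simp
    have d: "distributed M lborel (D i) (\<lambda>x. ennreal (normal_density 0 (sqrt (t (Suc i) - t i)) x))"
      using B lt t0[of i] i unfolding linear_brownian_motion_def D_def[abs_def] by auto
    have "(\<integral>\<^sup>+\<omega>. ennreal (exp (l * c i * D i \<omega>)) \<partial>M)
      = (\<integral>\<^sup>+x. ennreal (normal_density 0 (sqrt (t (Suc i) - t i)) x) * ennreal (exp ((l * c i) * x)) \<partial>lborel)"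
      using distributed_nn_integral[OF d, of "\<lambda>x. ennreal (exp ((l * c i) * x))"] by simp
    also have "\<dots> = ennreal (exp ((l * c i)\<^sup>2 * (t (Suc i) - t i) / 2))"
      using lt by (subst nn_integral_exp_normal) auto
    also have "\<dots> \<le> ennreal (exp (l\<^sup>2 * (t (Suc i) - t i) / 2))"
    proof -
      have "(c i)\<^sup>2 \<le> 1" using c[OF i] abs_le_square_iff[of "c i" 1] by simp
      then have "l\<^sup>2 * (c i)\<^sup>2 * (t (Suc i) - t i) \<le> l\<^sup>2 * 1 * (t (Suc i) - t i)"
        using lt by (intro mult_right_mono mult_left_mono) auto
      then show ?thesis by (intro ennreal_leI) (simp add: power_mult_distrib)
    qed
    finally show ?thesis .
  qed
  have "(\<integral>\<^sup>+\<omega>. ennreal (exp (l * (\<Sum>i<m. c i * D i \<omega>))) \<partial>M) 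
      = (\<integral>\<^sup>+\<omega>. (\<Prod>i<m. ennreal (exp (l * c i * D i \<omega>))) \<partial>M)"
    by (simp add: sum_distrib_left exp_sum prod_ennreal mult.assoc)
  also have "\<dots> = (\<Prod>i<m. \<integral>\<^sup>+\<omega>. ennreal (exp (l * c i * D i \<omega>)) \<partial>M)"
    by (intro indep_vars_nn_integral indep_vars_compose2[OF ind]) auto
  also have "\<dots> \<le> (\<Prod>i<m. ennreal (exp (l\<^sup>2 * (t (Suc i) - t i) / 2)))"
    using one by (intro prod_mono_ennreal) auto
  also have "\<dots> = ennreal (exp (\<Sum>i<m. l\<^sup>2 * (t (Suc i) - t i) / 2))"
    by (simp add: exp_sum prod_ennreal)
  also have "(\<Sum>i<m. l\<^sup>2 * (t (Suc i) - t i) / 2) = l\<^sup>2 * (t m - t 0) / 2"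
    by (simp add: sum_divide_distrib[symmetric] sum_distrib_left[symmetric] sum_lessThan_telescope)
  finally show ?thesis by (simp add: D_def)
qed

lemma riemann_sum_tendsto:
  fixes f :: "real \<Rightarrow> real"
  assumes f: "continuous_on {a..a+1} f"
  shows "(\<lambda>K. (\<Sum>r<Suc K. f (a + real r / real (Suc K))) / real (Suc K)) \<longlonglongrightarrow> integral {a..a+1} f"
proof (rule LIMSEQ_I)
  fix e :: real assume e: "e > 0"
  have "uniformly_continuous_on {a..a+1} f"
    using f by (rule compact_uniformly_continuous) auto
  then obtain d where d: "d > 0" and fd: "\<And>x y. x \<in> {a..a+1} \<Longrightarrow> y \<in> {a..a+1} \<Longrightarrow> dist y x < d \<Longrightarrow> dist (f y) (f x) < e / 2"
    unfolding uniformly_continuous_on_def using half_gt_zero[OF e] by metis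
  obtain N where N: "1 / d < real N" using reals_Archimedean2 by blast
  show "\<exists>no. \<forall>K\<ge>no. norm ((\<Sum>r<Suc K. f (a + real r / real (Suc K))) / real (Suc K) - integral {a..a+1} f) < e"
  proof (intro exI allI impI)
    fix K assume "K \<ge> N"
    define k where "k = real (Suc K)"
    have k: "k > 0" "1 / k < d" 
      using N \<open>K \<ge> N\<close> d unfolding k_def
      by (auto simp: field_simps) (smt (verit) mult_left_mono of_nat_mono)
    define p where "p r = a + real r / k" for r
    have p_mono: "p r \<le> p (Suc r)" for r using k by (simp add: p_def divide_simps)
    have psub: "p r \<in> {a..a+1}" if "r \<le> Suc K" for r
    proof -
      have "real r / k \<le> 1" using that k by (simp add: k_def divide_le_eq)
      then show ?thesis using k by (simp add: p_def)
    qed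
    have sub: "{p r..p (Suc r)} \<subseteq> {a..a+1}" if "r < Suc K" for r
      using psub[of r] psub[of "Suc r"] that by auto
    have fint: "f integrable_on {p r..p (Suc r)}" if "r < Suc K" for r
      using continuous_on_subset[OF f sub[OF that]] by (rule integrable_continuous_real)
    have comb: "r \<le> Suc K \<Longrightarrow> integral {p 0..p r} f = (\<Sum>i<r. integral {p i..p (Suc i)} f)" for r
    proof (induction r)
      case 0 then show ?case by simp
    next
      case (Suc r)
      have "integral {p 0..p r} f + integral {p r..p (Suc r)} f = integral {p 0..p (Suc r)} f"
      proof (rule Henstock_Kurzweil_Integration.integral_combine)
        show "p 0 \<le> p r" using k by (simp add: p_def)
        show "f integrable_on {p 0..p (Suc r)}"
          using psub[of "Suc r"] Suc.prems k
          by (intro integrable_continuous_real continuous_on_subset[OF f]) (auto simp: p_def)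
      qed (rule p_mono)
      with Suc show ?case by simp
    qed
    have p0: "p 0 = a" "p (Suc K) = a + 1" using k by (auto simp: p_def k_def)
    have "(\<Sum>r<Suc K. f (a + real r / real (Suc K))) / real (Suc K) - integral {a..a+1} f
       = (\<Sum>r<Suc K. f (p r) / k - integral {p r..p (Suc r)} f)"
      using comb[of "Suc K"] unfolding p0 
      by (simp add: sum_subtractf sum_divide_distrib p_def k_def del: sum.lessThan_Suc)
    also have "\<bar>\<dots>\<bar> \<le> (\<Sum>r<Suc K. e / 2 / k)"
    proof (rule order_trans[OF sum_abs sum_mono])
      fix r assume r: "r \<in> {..<Suc K}"
      have len: "p (Suc r) - p r = 1 / k" using k by (simp add: p_def field_simps)
      have "integral {p r..p (Suc r)} (\<lambda>s. f (p r) - f s) = f (p r) / k - integral {p r..p (Suc r)} f"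
        using fint[of r] r p_mono[of r] len by (subst integral_diff) auto
      moreover have "norm (integral {p r..p (Suc r)} (\<lambda>s. f (p r) - f s)) \<le> e / 2 * (p (Suc r) - p r)"
      proof (rule integral_bound)
        show "continuous_on {p r..p (Suc r)} (\<lambda>s. f (p r) - f s)"
          using r by (intro continuous_intros continuous_on_subset[OF f sub]) auto
        fix s assume s: "s \<in> {p r..p (Suc r)}"
        then have "dist (p r) s < d" using len k by (auto simp: dist_real_def)
        then show "norm (f (p r) - f s) \<le> e / 2"
          using fd[of s "p r"] s sub[of r] r psub[of r] by (auto simp: dist_real_def)
      qed (rule p_mono)
      ultimately show "\<bar>f (p r) / k - integral {p r..p (Suc r)} f\<bar> \<le> e / 2 / k"
        by (simp add: len)
    qed
    also have "\<dots> = e / 2" using k(1) unfolding k_def by (simp del: of_nat_Suc)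
    finally show "norm ((\<Sum>r<Suc K. f (a + real r / real (Suc K))) / real (Suc K) - integral {a..a+1} f) < e"
      using e by simp
  qed
qed

section \<open>Almost sure bounds from exponential moments\<close>

text \<open>The function need not be measurable: only a measurable majorant of its exponential is required.  This
matters because time integrals of the path are obtained as limits that exist almost surely, on a space
that need not be complete.\<close>

definition exp_moment_le :: "'a measure \<Rightarrow> ('a \<Rightarrow> real) \<Rightarrow> real \<Rightarrow> bool" where
  "exp_moment_le M F C \<longleftrightarrow> (\<exists>g\<in>borel_measurable M. (\<integral>\<^sup>+\<omega>. g \<omega> \<partial>M) \<le> ennreal C \<and>
     (AE \<omega> in M. ennreal (exp (F \<omega>)) \<le> g \<omega>))"

lemma exp_moment_leI:
  assumes "F \<in> borel_measurable M" "(\<integral>\<^sup>+\<omega>. ennreal (exp (F \<omega>)) \<partial>M) \<le> ennreal C"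
  shows "exp_moment_le M F C"
  unfolding exp_moment_le_def using assms by (intro bexI[of _ "\<lambda>\<omega>. ennreal (exp (F \<omega>))"]) auto

text \<open>Fatou's lemma: the limit inferior of the majorants is again a measurable majorant.\<close>

lemma exp_moment_le_limit:
  assumes f: "\<And>K. exp_moment_le M (f K) C" and lim: "AE \<omega> in M. (\<lambda>K. f K \<omega>) \<longlonglongrightarrow> F \<omega>"
  shows "exp_moment_le M F C"
proof -
  obtain g where g [measurable]: "\<And>K. g K \<in> borel_measurable M"
    and gC: "\<And>K. (\<integral>\<^sup>+\<omega>. g K \<omega> \<partial>M) \<le> ennreal C"
    and fg: "\<And>K. AE \<omega> in M. ennreal (exp (f K \<omega>)) \<le> g K \<omega>"
    using f unfolding exp_moment_le_def by metis
  have fg': "AE \<omega> in M. \<forall>K. ennreal (exp (f K \<omega>)) \<le> g K \<omega>"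
    using fg by (simp add: AE_all_countable)
  have "(\<integral>\<^sup>+\<omega>. liminf (\<lambda>K. g K \<omega>) \<partial>M) \<le> liminf (\<lambda>K. \<integral>\<^sup>+\<omega>. g K \<omega> \<partial>M)"
    by (rule nn_integral_liminf) simp
  also have "\<dots> \<le> liminf (\<lambda>K::nat. ennreal C)"
    by (intro Liminf_mono) (simp add: gC)
  also have "\<dots> = ennreal C" by (simp add: Liminf_const)
  finally have "(\<integral>\<^sup>+\<omega>. liminf (\<lambda>K. g K \<omega>) \<partial>M) \<le> ennreal C" .
  moreover have "AE \<omega> in M. ennreal (exp (F \<omega>)) \<le> liminf (\<lambda>K. g K \<omega>)"
    using fg' lim
  proof eventually_elim
    case (elim \<omega>)
    have "(\<lambda>K. ennreal (exp (f K \<omega>))) \<longlonglongrightarrow> ennreal (exp (F \<omega>))"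
      using elim(2) by (intro tendsto_intros) auto
    then have "ennreal (exp (F \<omega>)) = liminf (\<lambda>K. ennreal (exp (f K \<omega>)))"
      by (rule lim_imp_Liminf[OF sequentially_bot, symmetric])
    also have "\<dots> \<le> liminf (\<lambda>K. g K \<omega>)"
      using elim(1) by (intro Liminf_mono) simp
    finally show ?case .
  qed
  ultimately show ?thesis unfolding exp_moment_le_def by (intro bexI[of _ "\<lambda>\<omega>. liminf (\<lambda>K. g K \<omega>)"]) auto
qed

text \<open>Jensen's inequality for the exponential.\<close>

lemma exp_moment_le_avg:
  assumes F: "\<And>i. i < Suc K \<Longrightarrow> exp_moment_le M (F i) C" and C: "C \<ge> 0"
  shows "exp_moment_le M (\<lambda>\<omega>. (\<Sum>i<Suc K. F i \<omega>) / real (Suc K)) C"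
proof -
  obtain g where g [measurable]: "\<And>i. i < Suc K \<Longrightarrow> g i \<in> borel_measurable M"
    and gC: "\<And>i. i < Suc K \<Longrightarrow> (\<integral>\<^sup>+\<omega>. g i \<omega> \<partial>M) \<le> ennreal C"
    and Fg: "\<And>i. i < Suc K \<Longrightarrow> AE \<omega> in M. ennreal (exp (F i \<omega>)) \<le> g i \<omega>"
    using F unfolding exp_moment_le_def by metis
  have Fg': "AE \<omega> in M. \<forall>i\<in>{..<Suc K}. ennreal (exp (F i \<omega>)) \<le> g i \<omega>"
    using Fg by (intro AE_finite_allI) auto
  define h where "h \<omega> = ennreal (1 / real (Suc K)) * (\<Sum>i<Suc K. g i \<omega>)" for \<omega>
  have h [measurable]: "h \<in> borel_measurable M"
    unfolding h_def[abs_def] using g by (intro borel_measurable_times_ennreal borel_measurable_sum) auto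
  have "(\<integral>\<^sup>+\<omega>. h \<omega> \<partial>M) = ennreal (1 / real (Suc K)) * (\<Sum>i<Suc K. \<integral>\<^sup>+\<omega>. g i \<omega> \<partial>M)"
  proof -
    have "(\<integral>\<^sup>+\<omega>. (\<Sum>i<Suc K. g i \<omega>) \<partial>M) = (\<Sum>i<Suc K. \<integral>\<^sup>+\<omega>. g i \<omega> \<partial>M)"
      using g by (intro nn_integral_sum) auto
    then show ?thesis
      unfolding h_def using g by (subst nn_integral_cmult) (auto intro!: borel_measurable_sum simp del: sum.lessThan_Suc)
  qed
  also have "\<dots> \<le> ennreal (1 / real (Suc K)) * (\<Sum>i<Suc K. ennreal C)"
    by (intro mult_left_mono sum_mono gC) auto
  also have "\<dots> = ennreal (1 / real (Suc K)) * ennreal (\<Sum>i<Suc K. C)"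
    using C by (subst sum_ennreal) auto
  also have "\<dots> = ennreal C"
    using C by (subst ennreal_mult[symmetric]) auto
  finally have "(\<integral>\<^sup>+\<omega>. h \<omega> \<partial>M) \<le> ennreal C" .
  moreover have "AE \<omega> in M. ennreal (exp ((\<Sum>i<Suc K. F i \<omega>) / real (Suc K))) \<le> h \<omega>"
    using Fg'
  proof eventually_elim
    case (elim \<omega>)
    have cv: "convex_on UNIV (exp :: real \<Rightarrow> real)" using convex_on_exp[of 1] by simp
    have "exp (\<Sum>i<Suc K. (1 / real (Suc K)) *\<^sub>R F i \<omega>) \<le> (\<Sum>i<Suc K. (1 / real (Suc K)) * exp (F i \<omega>))"
      by (rule convex_on_sum[OF _ _ cv]) auto
    then have "exp ((\<Sum>i<Suc K. F i \<omega>) / real (Suc K)) \<le> (1 / real (Suc K)) * (\<Sum>i<Suc K. exp (F i \<omega>))"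
      by (simp add: sum_divide_distrib sum_distrib_left del: sum.lessThan_Suc)
    then have "ennreal (exp ((\<Sum>i<Suc K. F i \<omega>) / real (Suc K))) \<le> ennreal (1 / real (Suc K)) * ennreal (\<Sum>i<Suc K. exp (F i \<omega>))"
      by (subst ennreal_mult[symmetric]) (auto intro!: ennreal_leI sum_nonneg simp del: sum.lessThan_Suc)
    also have "ennreal (\<Sum>i<Suc K. exp (F i \<omega>)) = (\<Sum>i<Suc K. ennreal (exp (F i \<omega>)))"
      by (subst sum_ennreal) auto
    also have "ennreal (1 / real (Suc K)) * \<dots> \<le> h \<omega>"
      unfolding h_def using elim by (intro mult_left_mono sum_mono) auto
    finally show ?case .
  qed
  ultimately show ?thesis unfolding exp_moment_le_def using h by blast
qed

lemma exp_moment_le_abs: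
  assumes "exp_moment_le M F C" "exp_moment_le M (\<lambda>\<omega>. - F \<omega>) C" "C \<ge> 0"
  shows "exp_moment_le M (\<lambda>\<omega>. \<bar>F \<omega>\<bar>) (2 * C)"
proof -
  obtain g h where [measurable]: "g \<in> borel_measurable M" "h \<in> borel_measurable M"
    and gh: "(\<integral>\<^sup>+\<omega>. g \<omega> \<partial>M) \<le> ennreal C" "(\<integral>\<^sup>+\<omega>. h \<omega> \<partial>M) \<le> ennreal C"
    "AE \<omega> in M. ennreal (exp (F \<omega>)) \<le> g \<omega>" "AE \<omega> in M. ennreal (exp (- F \<omega>)) \<le> h \<omega>"
    using assms unfolding exp_moment_le_def by blast
  have "(\<integral>\<^sup>+\<omega>. g \<omega> + h \<omega> \<partial>M) \<le> ennreal C + ennreal C"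
    using gh by (subst nn_integral_add) (auto intro: add_mono)
  also have "\<dots> = ennreal (2 * C)" using assms by (simp flip: ennreal_plus)
  finally have "(\<integral>\<^sup>+\<omega>. g \<omega> + h \<omega> \<partial>M) \<le> ennreal (2 * C)" .
  moreover have "AE \<omega> in M. ennreal (exp \<bar>F \<omega>\<bar>) \<le> g \<omega> + h \<omega>"
    using gh(3,4)
  proof eventually_elim
    case (elim \<omega>)
    show ?case
    proof (cases "F \<omega> \<ge> 0")
      case True then show ?thesis using elim(1) by (simp add: add_increasing2)
    next
      case False then show ?thesis using elim(2) by (simp add: add_increasing)
    qed
  qed
  ultimately show ?thesis unfolding exp_moment_le_def by (intro bexI[of _ "\<lambda>\<omega>. g \<omega> + h \<omega>"]) auto
qed

text \<open>Borel--Cantelli: Markov's inequality bounds each exceptional event by a constant times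
\<open>exp (- n powr e)\<close>, and only quadratically many of them occur at level \<open>n\<close>.  The power \<open>n powr e\<close> replaces
the optimal logarithmic factor, which is affordable because the theorem allows a loss \<open>\<eta>\<close> in the exponent.\<close>

lemma AE_eventually_le_powr:
  fixes F :: "nat \<Rightarrow> 'i \<Rightarrow> 'a \<Rightarrow> real" and I :: "nat \<Rightarrow> 'i set"
  assumes "prob_space M" and F: "\<And>n i. i \<in> I n \<Longrightarrow> exp_moment_le M (F n i) C"
    and I: "\<And>n. finite (I n)" "\<And>n. card (I n) \<le> (n + 1)\<^sup>2" and e: "e > 0" and C: "C \<ge> 0"
  shows "AE \<omega> in M. eventually (\<lambda>n. \<forall>i\<in>I n. F n i \<omega> < real n powr e) sequentially"
proof -
  interpret prob_space M by fact
  define P where "P n i h \<longleftrightarrow> h \<in> borel_measurable M \<and> (\<integral>\<^sup>+\<omega>. h \<omega> \<partial>M) \<le> ennreal C \<and>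
    (AE \<omega> in M. ennreal (exp (F n i \<omega>)) \<le> h \<omega>)" for n i h
  define g where "g n i = (SOME h. P n i h)" for n i
  have P: "P n i (g n i)" if "i \<in> I n" for n i
    unfolding g_def using F[OF that] by (intro someI_ex[of "P n i"]) (auto simp: exp_moment_le_def P_def)
  have g [measurable]: "\<And>n i. i \<in> I n \<Longrightarrow> g n i \<in> borel_measurable M"
    and gC: "\<And>n i. i \<in> I n \<Longrightarrow> (\<integral>\<^sup>+\<omega>. g n i \<omega> \<partial>M) \<le> ennreal C"
    and Fg: "\<And>n i. i \<in> I n \<Longrightarrow> AE \<omega> in M. ennreal (exp (F n i \<omega>)) \<le> g n i \<omega>"
    using P unfolding P_def by auto
  have Fg': "AE \<omega> in M. \<forall>n. \<forall>i\<in>I n. ennreal (exp (F n i \<omega>)) \<le> g n i \<omega>"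
  proof -
    have "AE \<omega> in M. \<forall>i\<in>I n. ennreal (exp (F n i \<omega>)) \<le> g n i \<omega>" for n
      using Fg by (intro AE_finite_allI I(1))
    then show ?thesis by (intro AE_all_countable[THEN iffD2] allI)
  qed
  define y where "y n = real n powr e" for n
  define A where "A n = (\<Union>i\<in>I n. {\<omega>\<in>space M. ennreal (exp (y n)) \<le> g n i \<omega>})" for n
  have A1: "{\<omega>\<in>space M. ennreal (exp (y n)) \<le> g n i \<omega>} \<in> sets M" if "i \<in> I n" for n i
    using g[OF that] by measurable
  have A [measurable]: "A n \<in> sets M" for n
    unfolding A_def using I(1) A1 by (intro sets.finite_UN) auto
  have one: "measure M {\<omega>\<in>space M. ennreal (exp (y n)) \<le> g n i \<omega>} \<le> C * exp (- y n)" if i: "i \<in> I n" for n i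
  proof -
    have "emeasure M {\<omega>\<in>space M. ennreal (exp (y n)) \<le> g n i \<omega>}
       \<le> emeasure M ({\<omega>\<in>space M. 1 \<le> ennreal (exp (- y n)) * g n i \<omega>})"
    proof (rule emeasure_mono)
      have "1 \<le> ennreal (exp (- y n)) * g n i \<omega>" if "ennreal (exp (y n)) \<le> g n i \<omega>" for \<omega>
      proof -
        have "1 = ennreal (exp (- y n)) * ennreal (exp (y n))"
          by (simp add: ennreal_mult[symmetric] exp_add[symmetric])
        also have "\<dots> \<le> ennreal (exp (- y n)) * g n i \<omega>" by (intro mult_left_mono that) auto
        finally show ?thesis .
      qed
      then show "{\<omega>\<in>space M. ennreal (exp (y n)) \<le> g n i \<omega>} \<subseteq> {\<omega>\<in>space M. 1 \<le> ennreal (exp (- y n)) * g n i \<omega>}" by auto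
      show "{\<omega>\<in>space M. 1 \<le> ennreal (exp (- y n)) * g n i \<omega>} \<in> sets M" using g[OF i] by measurable
    qed
    also have "\<dots> \<le> ennreal (exp (- y n)) * (\<integral>\<^sup>+\<omega>. g n i \<omega> * indicator (space M) \<omega> \<partial>M)"
      using nn_integral_Markov_inequality[of "g n i" "space M" M "ennreal (exp (- y n))"] g[OF i] by simp
    also have "(\<integral>\<^sup>+\<omega>. g n i \<omega> * indicator (space M) \<omega> \<partial>M) = (\<integral>\<^sup>+\<omega>. g n i \<omega> \<partial>M)"
      by (rule nn_integral_cong) auto
    also have "ennreal (exp (- y n)) * \<dots> \<le> ennreal (exp (- y n)) * ennreal C"
      by (intro mult_left_mono gC i) auto
    also have "\<dots> = ennreal (C * exp (- y n))" using C by (simp add: ennreal_mult[symmetric] mult.commute)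
    finally show ?thesis using C by (simp add: emeasure_eq_measure)
  qed
  have mA: "measure M (A n) \<le> (real n + 1)\<^sup>2 * (C * exp (- y n))" for n
  proof -
    have "measure M (A n) \<le> (\<Sum>i\<in>I n. measure M {\<omega>\<in>space M. ennreal (exp (y n)) \<le> g n i \<omega>})"
      unfolding A_def using I(1) A1 by (intro finite_measure_subadditive_finite) auto
    also have "\<dots> \<le> (\<Sum>i\<in>I n. C * exp (- y n))" by (intro sum_mono one)
    also have "\<dots> = real (card (I n)) * (C * exp (- y n))" by simp
    also have "\<dots> \<le> real ((n + 1)\<^sup>2) * (C * exp (- y n))"
      using I(2)[of n] C by (intro mult_right_mono of_nat_mono) auto
    finally show ?thesis by (simp add: add.commute)
  qed
  have "summable (\<lambda>n. measure M (A n))"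
  proof (rule summable_comparison_test)
    show "\<exists>N. \<forall>n\<ge>N. norm (measure M (A n)) \<le> (real n + 1)\<^sup>2 * (C * exp (- y n))"
      using mA by auto
    have "(\<lambda>n. (real n + 1)\<^sup>2 * (C * exp (- y n))) \<in> O(\<lambda>n. real n powr (-2))"
      unfolding y_def using e by real_asymp
    then show "summable (\<lambda>n. (real n + 1)\<^sup>2 * (C * exp (- y n)))"
      by (rule summable_comparison_test_bigo[rotated]) (simp add: summable_real_powr_iff)
  qed
  then have "AE \<omega> in M. eventually (\<lambda>n. \<omega> \<in> space M - A n) sequentially"
    by (intro borel_cantelli_AE1) (auto simp: emeasure_eq_measure)
  then show ?thesis using Fg'
  proof eventually_elim
    case (elim \<omega>)
    note le = elim(2)
    from elim(1) show ?case
    proof eventually_elim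
      case (elim n)
      show ?case
      proof
        fix i assume i: "i \<in> I n"
        have "g n i \<omega> < ennreal (exp (y n))" using elim i by (auto simp: A_def not_le)
        then have "ennreal (exp (F n i \<omega>)) < ennreal (exp (y n))"
          using le i le_less_trans by blast
        then show "F n i \<omega> < real n powr e" by (simp add: ennreal_less_iff y_def)
      qed
    qed
  qed
qed

section \<open>Almost sure regularity of Brownian paths\<close>

text \<open>A left Riemann sum minus its first value is a sum of increments weighted by the fraction of time that
remains; this brings it into the form required by the moment estimate for weighted increments.\<close>

lemma sum_weighted_increments:
  fixes b :: "nat \<Rightarrow> real"
  shows "(\<Sum>r<K. (real K - 1 - real r) * (b (Suc r) - b r)) = (\<Sum>r<K. b r) - real K * b 0"
proof (induction K)
  case 0 then show ?case by simp
next
  case (Suc K)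
  have "(\<Sum>r<Suc K. (real (Suc K) - 1 - real r) * (b (Suc r) - b r))
    = (\<Sum>r<K. (real K - 1 - real r) * (b (Suc r) - b r)) + (\<Sum>r<K. b (Suc r) - b r)"
    by (simp add: sum.distrib[symmetric] algebra_simps)
  also have "(\<Sum>r<K. b (Suc r) - b r) = b K - b 0" by (rule sum_lessThan_telescope)
  finally show ?case using Suc by (simp add: algebra_simps)
qed

lemma exp_moment_riemann_excess:
  fixes B :: "real \<Rightarrow> 'a \<Rightarrow> real" and i d :: nat
  assumes B: "linear_brownian_motion M B"
  shows "exp_moment_le M (\<lambda>\<omega>. l * (\<Sum>m<d. (\<Sum>r<Suc K. B (real (i + m) + real r / real (Suc K)) \<omega>) / real (Suc K) - B (real (i + m)) \<omega>))
    (exp (l\<^sup>2 * real d / 2))"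
proof -
  define k where "k = Suc K"
  have k: "k > 0" by (simp add: k_def)
  define t where "t s = real i + real s / real k" for s :: nat
  define c where "c s = (real k - 1 - real (s mod k)) / real k" for s :: nat
  have c1: "\<bar>c s\<bar> \<le> 1" for s
  proof -
    have "s mod k < k" using k by simp
    then have "real (s mod k) \<le> real k - 1" by linarith
    then show ?thesis using k by (auto simp: c_def abs_le_iff divide_simps)
  qed
  have tm: "t s \<le> t (Suc s)" for s using k by (simp add: t_def divide_simps)
  have block: "(\<Sum>s\<in>{m * k..<m * k + k}. c s * (B (t (Suc s)) \<omega> - B (t s) \<omega>))
     = (\<Sum>r<k. B (real (i + m) + real r / real k) \<omega>) / real k - B (real (i + m)) \<omega>" for m \<omega>
  proof -
    define b where "b r = B (real (i + m) + real r / real k) \<omega>" for r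
    have tb: "B (t (m * k + r)) \<omega> = b r" for r
      using k by (simp add: t_def b_def add_divide_distrib add.assoc)
    have "(\<Sum>s\<in>{m * k..<m * k + k}. c s * (B (t (Suc s)) \<omega> - B (t s) \<omega>))
       = (\<Sum>r\<in>{0..<k}. c (m * k + r) * (B (t (Suc (m * k + r))) \<omega> - B (t (m * k + r)) \<omega>))"
      using sum.shift_bounds_nat_ivl[of "\<lambda>s. c s * (B (t (Suc s)) \<omega> - B (t s) \<omega>)" 0 "m * k" k]
      by (simp add: add.commute)
    also have "\<dots> = (\<Sum>r<k. (real k - 1 - real r) * (b (Suc r) - b r) / real k)"
      using tb[of "Suc r" for r] tb by (intro sum.cong) (auto simp: c_def)
    also have "\<dots> = ((\<Sum>r<k. b r) - real k * b 0) / real k"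
      by (simp add: sum_divide_distrib[symmetric] sum_weighted_increments)
    also have "\<dots> = (\<Sum>r<k. b r) / real k - b 0" using k by (simp add: diff_divide_distrib)
    finally show ?thesis by (simp add: b_def)
  qed
  have eq: "(\<Sum>s<d * k. c s * (B (t (Suc s)) \<omega> - B (t s) \<omega>))
     = (\<Sum>m<d. (\<Sum>r<k. B (real (i + m) + real r / real k) \<omega>) / real k - B (real (i + m)) \<omega>)" for \<omega>
    by (simp add: sum.nat_group[symmetric] block)
  have meas: "B s \<in> borel_measurable M" if "s \<ge> 0" for s
    using B that by (simp add: linear_brownian_motion_def)
  have "t (d * k) - t 0 = real d" using k by (simp add: t_def)
  then have "(\<integral>\<^sup>+\<omega>. ennreal (exp (l * (\<Sum>s<d * k. c s * (B (t (Suc s)) \<omega> - B (t s) \<omega>)))) \<partial>M)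
     \<le> ennreal (exp (l\<^sup>2 * real d / 2))"
    using mgf_weighted_increments[OF B, of t "d * k" c l] tm c1 by (simp add: t_def)
  then show ?thesis unfolding eq k_def[symmetric]
    by (intro exp_moment_leI) (auto intro!: borel_measurable_times borel_measurable_sum borel_measurable_diff borel_measurable_divide meas)
qed

lemma exp_moment_increment:
  assumes B: "linear_brownian_motion M B" and "0 \<le> s" "s \<le> t"
  shows "exp_moment_le M (\<lambda>\<omega>. l * (B t \<omega> - B s \<omega>)) (exp (l\<^sup>2 * (t - s) / 2))"
proof (rule exp_moment_leI)
  show "(\<lambda>\<omega>. l * (B t \<omega> - B s \<omega>)) \<in> borel_measurable M"
    using B assms unfolding linear_brownian_motion_def
    by (intro borel_measurable_times borel_measurable_diff) auto
  show "(\<integral>\<^sup>+\<omega>. ennreal (exp (l * (B t \<omega> - B s \<omega>))) \<partial>M) \<le> ennreal (exp (l\<^sup>2 * (t - s) / 2))"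
    using mgf_weighted_increments[OF B, of "\<lambda>i. if i = 0 then s else t" 1 "\<lambda>_. 1" l] assms by simp
qed

text \<open>On the unit cell starting at \<open>l\<close>, \<open>cell_excess\<close> is the error of the left-endpoint rule for the time
integral of the path.  It is of order one and does not get small, but over different cells these errors
are independent and centred for a Brownian path, so their partial sums grow only like square roots.\<close>

definition cell_excess :: "(real \<Rightarrow> 'v::euclidean_space) \<Rightarrow> nat \<Rightarrow> 'v" where
  "cell_excess w l = integral {real l..real l + 1} (\<lambda>s. w s - w (real l))"

definition cell_osc :: "(real \<Rightarrow> 'v::euclidean_space) \<Rightarrow> nat \<Rightarrow> real" where
  "cell_osc w l = integral {real l..real l + 1} (\<lambda>s. norm (w s - w (real l)))"

text \<open>Pathwise limit of Riemann sums, which have the same sub-Gaussian bound uniformly in the mesh.\<close>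

lemma exp_moment_cell_excess:
  assumes B: "linear_brownian_motion M B"
  shows "exp_moment_le M (\<lambda>\<omega>. l * (\<Sum>m<d. cell_excess (\<lambda>s. B s \<omega>) (i + m))) (exp (l\<^sup>2 * real d / 2))"
proof (rule exp_moment_le_limit[OF exp_moment_riemann_excess[OF B]])
  have "AE \<omega> in M. continuous_on {0..} (\<lambda>t. B t \<omega>)" using B by (simp add: linear_brownian_motion_def)
  then show "AE \<omega> in M. (\<lambda>K. l * (\<Sum>m<d. (\<Sum>r<Suc K. B (real (i + m) + real r / real (Suc K)) \<omega>) / real (Suc K) - B (real (i + m)) \<omega>))
     \<longlonglongrightarrow> l * (\<Sum>m<d. cell_excess (\<lambda>s. B s \<omega>) (i + m))"
  proof eventually_elim
    case (elim \<omega>)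
    have cont: "continuous_on {real j..real j + 1} (\<lambda>s. B s \<omega>)" for j
      by (rule continuous_on_subset[OF elim]) auto
    have ex: "cell_excess (\<lambda>s. B s \<omega>) j = integral {real j..real j + 1} (\<lambda>s. B s \<omega>) - B (real j) \<omega>" for j
      unfolding cell_excess_def using cont[of j]
      by (subst integral_diff) (auto intro: integrable_continuous_real)
    show ?case unfolding ex
      by (intro tendsto_intros riemann_sum_tendsto cont)
  qed
qed

lemma exp_moment_cell_osc:
  assumes B: "linear_brownian_motion M B"
  shows "exp_moment_le M (\<lambda>\<omega>. cell_osc (\<lambda>s. B s \<omega>) j) (2 * exp (1/2))"
proof (rule exp_moment_le_limit)
  fix K
  define f where "f r \<omega> = \<bar>B (real j + real r / real (Suc K)) \<omega> - B (real j) \<omega>\<bar>" for r \<omega>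
  have one: "exp_moment_le M (\<lambda>\<omega>. l * (B (real j + real r / real (Suc K)) \<omega> - B (real j) \<omega>)) (exp (1/2))"
    if "r < Suc K" "l \<in> {1, -1}" for r l
  proof -
    let ?s = "real r / real (Suc K)"
    have s: "0 \<le> ?s" "?s \<le> 1" using that(1) by (auto simp: divide_le_eq)
    have "exp_moment_le M (\<lambda>\<omega>. l * (B (real j + ?s) \<omega> - B (real j) \<omega>)) (exp (l\<^sup>2 * (real j + ?s - real j) / 2))"
      by (rule exp_moment_increment[OF B]) (use s in auto)
    moreover have "exp (l\<^sup>2 * (real j + ?s - real j) / 2) \<le> exp (1/2)" using s that(2) by auto
    ultimately show ?thesis unfolding exp_moment_le_def by (meson ennreal_leI order_trans)
  qed
  have "exp_moment_le M (f r) (2 * exp (1/2))" if "r < Suc K" for r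
    unfolding f_def using one[OF that, of 1] one[OF that, of "-1"] by (intro exp_moment_le_abs) auto
  then show "exp_moment_le M (\<lambda>\<omega>. (\<Sum>r<Suc K. f r \<omega>) / real (Suc K)) (2 * exp (1/2))"
    by (intro exp_moment_le_avg) auto
next
  have "AE \<omega> in M. continuous_on {0..} (\<lambda>t. B t \<omega>)" using B by (simp add: linear_brownian_motion_def)
  then show "AE \<omega> in M. (\<lambda>K. (\<Sum>r<Suc K. \<bar>B (real j + real r / real (Suc K)) \<omega> - B (real j) \<omega>\<bar>) / real (Suc K))
     \<longlonglongrightarrow> cell_osc (\<lambda>s. B s \<omega>) j"
  proof eventually_elim
    case (elim \<omega>)
    have cont: "continuous_on {real j..real j + 1} (\<lambda>s. \<bar>B s \<omega> - B (real j) \<omega>\<bar>)"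
      by (intro continuous_intros continuous_on_subset[OF elim]) auto
    show ?case unfolding cell_osc_def real_norm_def
      by (rule riemann_sum_tendsto[OF cont])
  qed
qed

text \<open>All that is ever used about the random path.  At scale \<open>n\<close>, increments over integer times and partial
sums of cell excesses have the square-root size of a random walk up to the factor \<open>Y\<close>, and the mean
oscillation within a cell is at most \<open>Y\<close>.  A mean suffices there because the path enters the
continuous model only through integrals.\<close>

definition tame_path :: "real \<Rightarrow> nat \<Rightarrow> (real \<Rightarrow> 'v::euclidean_space) \<Rightarrow> bool" where
  "tame_path Y n w \<longleftrightarrow>
     (\<forall>i j. i \<le> j \<longrightarrow> j \<le> n \<longrightarrow> norm (w (real j) - w (real i)) \<le> Y * sqrt (real j - real i)) \<and>
     (\<forall>i j. i \<le> j \<longrightarrow> j \<le> n \<longrightarrow> norm (\<Sum>l\<in>{i..<j}. cell_excess w l) \<le> Y * sqrt (real j - real i)) \<and>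
     (\<forall>l<n. cell_osc w l \<le> Y)"

lemma exp_moment_le_scale_abs:
  assumes F: "\<And>l. exp_moment_le M (\<lambda>\<omega>. l * F \<omega>) (exp (l\<^sup>2 * d / 2))" and d: "d > 0"
  shows "exp_moment_le M (\<lambda>\<omega>. \<bar>F \<omega>\<bar> / sqrt d) (2 * exp (1/2))"
proof -
  have "exp_moment_le M (\<lambda>\<omega>. \<bar>F \<omega> / sqrt d\<bar>) (2 * exp (1/2))"
    using F[of "1 / sqrt d"] F[of "- 1 / sqrt d"] d
    by (intro exp_moment_le_abs) (simp_all add: power_divide)
  then show ?thesis using d by (simp add: abs_divide)
qed

lemma AE_tame_path_linear:
  assumes B: "linear_brownian_motion M B" and e: "e > 0"
  shows "AE \<omega> in M. eventually (\<lambda>n. tame_path (real n powr e) n (\<lambda>t. B t \<omega>)) sequentially"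
proof -
  have M: "prob_space M" using B by (simp add: linear_brownian_motion_def)
  define I where "I n = {(i, j). i < j \<and> j \<le> n}" for n :: nat
  have Isub: "I n \<subseteq> {..n} \<times> {..n}" for n by (auto simp: I_def)
  have If: "finite (I n)" for n by (rule finite_subset[OF Isub]) simp
  have Ic: "card (I n) \<le> (n + 1)\<^sup>2" for n
    using card_mono[OF _ Isub[of n]] by (simp add: card_cartesian_product power2_eq_square)
  have 1: "AE \<omega> in M. eventually (\<lambda>n. \<forall>p\<in>I n. \<bar>B (real (snd p)) \<omega> - B (real (fst p)) \<omega>\<bar> / sqrt (real (snd p) - real (fst p)) < real n powr e) sequentially"
    by (rule AE_eventually_le_powr[OF M exp_moment_le_scale_abs[OF exp_moment_increment[OF B]] If Ic e]) (auto simp: I_def)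
  have 2: "AE \<omega> in M. eventually (\<lambda>n. \<forall>p\<in>I n. \<bar>\<Sum>m<snd p - fst p. cell_excess (\<lambda>s. B s \<omega>) (fst p + m)\<bar> / sqrt (real (snd p - fst p)) < real n powr e) sequentially"
    by (rule AE_eventually_le_powr[OF M exp_moment_le_scale_abs[OF exp_moment_cell_excess[OF B]] If Ic e]) (auto simp: I_def)
  have 3: "AE \<omega> in M. eventually (\<lambda>n. \<forall>l\<in>{..<n}. cell_osc (\<lambda>s. B s \<omega>) l < real n powr e) sequentially"
    by (rule AE_eventually_le_powr[OF M exp_moment_cell_osc[OF B] _ _ e]) (auto simp: power2_eq_square)
  from 1 2 3 show ?thesis
  proof eventually_elim
    case (elim \<omega>)
    from elim show ?case
    proof eventually_elim
      case (elim n)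
      show ?case unfolding tame_path_def
      proof (intro conjI allI impI)
        fix i j assume ij: "i \<le> j" "j \<le> n"
        show "norm (B (real j) \<omega> - B (real i) \<omega>) \<le> real n powr e * sqrt (real j - real i)"
        proof (cases "i = j")
          case False
          then have "(i, j) \<in> I n" using ij by (auto simp: I_def)
          with elim(1) show ?thesis using ij False by (force simp: divide_less_eq)
        qed simp
        show "norm (\<Sum>l\<in>{i..<j}. cell_excess (\<lambda>t. B t \<omega>) l) \<le> real n powr e * sqrt (real j - real i)"
        proof (cases "i = j")
          case False
          have eq: "(\<Sum>l\<in>{i..<j}. cell_excess (\<lambda>t. B t \<omega>) l) = (\<Sum>m<j - i. cell_excess (\<lambda>s. B s \<omega>) (i + m))"
            using sum.shift_bounds_nat_ivl[of "cell_excess (\<lambda>t. B t \<omega>)" 0 i "j - i"] ij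
            by (simp add: add.commute atLeast0LessThan)
          have "(i, j) \<in> I n" using ij False by (auto simp: I_def)
          with elim(2) show ?thesis unfolding eq using ij False by (force simp: divide_less_eq of_nat_diff)
        qed simp
      next
        fix l assume "l < n"
        then show "cell_osc (\<lambda>t. B t \<omega>) l \<le> real n powr e" using elim(3) by force
      qed
    qed
  qed
qed

lemma cell_excess_component:
  fixes w :: "real \<Rightarrow> real ^ 'd"
  assumes "continuous_on {0..} w"
  shows "cell_excess w l $ i = cell_excess (\<lambda>s. w s $ i) l"
proof -
  have "(\<lambda>s. w s - w (real l)) integrable_on {real l..real l + 1}"
    by (intro integrable_continuous_real continuous_intros continuous_on_subset[OF assms]) auto
  from integral_component_eq_cart[OF this, of i] show ?thesis by (simp add: cell_excess_def)
qed

lemma cell_osc_le_components: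
  fixes w :: "real \<Rightarrow> real ^ 'd"
  assumes w: "continuous_on {0..} w"
  shows "cell_osc w l \<le> (\<Sum>i\<in>UNIV. cell_osc (\<lambda>s. w s $ i) l)"
proof -
  have c: "continuous_on {real l..real l + 1} w" by (rule continuous_on_subset[OF w]) auto
  have int: "(\<lambda>s. norm (w s $ i - w (real l) $ i)) integrable_on {real l..real l + 1}" for i
    by (intro integrable_continuous_real continuous_intros c)
  have "cell_osc w l \<le> integral {real l..real l + 1} (\<lambda>s. \<Sum>i\<in>UNIV. norm (w s $ i - w (real l) $ i))"
    unfolding cell_osc_def
  proof (rule integral_le)
    show "(\<lambda>s. norm (w s - w (real l))) integrable_on {real l..real l + 1}"
      by (intro integrable_continuous_real continuous_intros c)
    show "(\<lambda>s. \<Sum>i\<in>UNIV. norm (w s $ i - w (real l) $ i)) integrable_on {real l..real l + 1}"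
      by (intro integrable_continuous_real continuous_intros c)
    show "norm (w s - w (real l)) \<le> (\<Sum>i\<in>UNIV. norm (w s $ i - w (real l) $ i))" for s
      using norm_le_l1_cart[of "w s - w (real l)"] by simp
  qed
  also have "\<dots> = (\<Sum>i\<in>UNIV. cell_osc (\<lambda>s. w s $ i) l)"
    unfolding cell_osc_def by (rule integral_sum) (use int in auto)
  finally show ?thesis .
qed

text \<open>The probabilistic half of the proof.  The bounds hold for each coordinate separately and are added,
which costs a factor equal to the dimension.\<close>

lemma AE_tame_path:
  fixes W :: "real \<Rightarrow> 'a \<Rightarrow> real ^ 'd"
  assumes W: "standard_brownian_motion M W" and e: "e > 0"
  shows "AE \<omega> in M. continuous_on {0..} (\<lambda>t. W t \<omega>) \<and> W 0 \<omega> = 0 \<and>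
     eventually (\<lambda>n. tame_path (real CARD('d) * real n powr e) n (\<lambda>t. W t \<omega>)) sequentially"
proof -
  have B: "linear_brownian_motion M (\<lambda>t \<omega>. W t \<omega> $ i)" for i
    using W by (simp add: standard_brownian_motion_def)
  have "AE \<omega> in M. (continuous_on {0..} (\<lambda>t. W t \<omega> $ i) \<and> W 0 \<omega> $ i = 0) \<and> 
     eventually (\<lambda>n. tame_path (real n powr e) n (\<lambda>t. W t \<omega> $ i)) sequentially" for i
    using B[of i] AE_tame_path_linear[OF B e, of i] unfolding linear_brownian_motion_def by auto
  then have "AE \<omega> in M. \<forall>i\<in>UNIV. (continuous_on {0..} (\<lambda>t. W t \<omega> $ i) \<and> W 0 \<omega> $ i = 0) \<and> 
     eventually (\<lambda>n. tame_path (real n powr e) n (\<lambda>t. W t \<omega> $ i)) sequentially"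
    by (intro AE_finite_allI) auto
  then show ?thesis
  proof eventually_elim
    case (elim \<omega>)
    have c: "continuous_on {0..} (\<lambda>t. W t \<omega>)"
      using elim continuous_on_vec_lambda[of "{0..}" "\<lambda>i t. W t \<omega> $ i"] by simp
    have "eventually (\<lambda>n. \<forall>i\<in>UNIV. tame_path (real n powr e) n (\<lambda>t. W t \<omega> $ i)) sequentially"
      using elim by (intro eventually_ball_finite) auto
    then have "eventually (\<lambda>n. tame_path (real CARD('d) * real n powr e) n (\<lambda>t. W t \<omega>)) sequentially"
    proof eventually_elim
      case (elim n)
      have l1: "norm v \<le> real CARD('d) * y" if "\<And>i. norm (v $ i) \<le> y" for v :: "real ^ 'd" and y
        using norm_le_l1_cart[of v] sum_bounded_above[of UNIV "\<lambda>i. \<bar>v $ i\<bar>" y] that by force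
      show ?case unfolding tame_path_def
      proof (intro conjI allI impI)
        fix i j assume ij: "i \<le> j" "j \<le> n"
        show "norm (W (real j) \<omega> - W (real i) \<omega>) \<le> real CARD('d) * real n powr e * sqrt (real j - real i)"
          using elim ij unfolding mult.assoc tame_path_def by (intro l1) simp
        show "norm (\<Sum>l\<in>{i..<j}. cell_excess (\<lambda>t. W t \<omega>) l) \<le> real CARD('d) * real n powr e * sqrt (real j - real i)"
          using elim ij unfolding mult.assoc tame_path_def by (intro l1) (simp add: cell_excess_component[OF c])
      next
        fix l assume "l < n"
        then have "(\<Sum>i\<in>UNIV. cell_osc (\<lambda>s. W s \<omega> $ i) l) \<le> (\<Sum>i\<in>(UNIV::'d set). real n powr e)"
          using elim by (intro sum_mono) (simp add: tame_path_def)
        then show "cell_osc (\<lambda>t. W t \<omega>) l \<le> real CARD('d) * real n powr e"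
          using cell_osc_le_components[OF c, of l] by simp
      qed
    qed
    moreover have "W 0 \<omega> = 0" using elim by (simp add: vec_eq_iff)
    ultimately show ?case using c by simp
  qed
qed

section \<open>Averages of a tame path against two close kernels\<close>

lemma integral_unit_cells:
  fixes g :: "real \<Rightarrow> 'v::euclidean_space"
  assumes "continuous_on {0..real n} g"
  shows "integral {0..real n} g = (\<Sum>l<n. integral {real l..real l + 1} g)"
  using assms
proof (induction n)
  case 0 then show ?case by simp
next
  case (Suc n)
  have "integral {0..real n} g + integral {real n..real (Suc n)} g = integral {0..real (Suc n)} g"
    using Suc.prems by (intro Henstock_Kurzweil_Integration.integral_combine integrable_continuous_real) auto
  moreover have "continuous_on {0..real n} g" by (rule continuous_on_subset[OF Suc.prems]) auto
  ultimately show ?case using Suc.IH by (simp add: add.commute)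
qed

lemma summation_by_parts_scaleR:
  fixes V :: "nat \<Rightarrow> 'v::real_vector"
  assumes "p \<le> m"
  shows "(\<Sum>l\<in>{p..<Suc m}. a l *\<^sub>R V l) =
    a m *\<^sub>R (\<Sum>l\<in>{p..<Suc m}. V l) + (\<Sum>l\<in>{p..<m}. (a l - a (Suc l)) *\<^sub>R (\<Sum>j\<in>{p..<Suc l}. V j))"
  using assms
proof (induction m rule: nat_induct_at_least)
  case base then show ?case by simp
next
  case (Suc m)
  then have "p \<le> Suc m" by simp
  then show ?case using Suc
    by (simp add: sum.atLeastLessThan_Suc algebra_simps)
qed

text \<open>Compare averaging a tame path against weights \<open>a l\<close> at integer times with integrating it against a
density \<open>q\<close>, when the two kernels are close (\<open>eps\<close>) in a window of length \<open>R\<close> and negligible (\<open>tau\<close>)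
elsewhere.  The difference splits into three parts.

First, \<open>a l\<close> minus the mass of \<open>q\<close> in the cell, times the path at \<open>l\<close>: in the window the path stays
within \<open>Y * sqrt R\<close> of a reference value, and the reference value itself is multiplied only by the
difference of the total masses.  Second, \<open>a l\<close> times the cell excess: estimating term by term would be
too crude, as the excesses have order one, so summation by parts moves the differences onto the slowly
varying weights and the sums onto the excesses, which again costs \<open>Y * sqrt R\<close>.  Third, the
fluctuation of \<open>q\<close> within a cell, which is at most \<open>eps\<close> because \<open>q\<close> is compared with \<open>a l\<close> on the
whole closed cell.  For the same reason neighbouring weights differ by at most \<open>2 * eps\<close>.  Up to the
contributions of \<open>tau\<close>, each part is at most a multiple of \<open>R * sqrt R * eps * Y\<close>.\<close>

lemma kernel_comparison:
  fixes w :: "real \<Rightarrow> 'v::euclidean_space" and a :: "nat \<Rightarrow> real" and q :: "real \<Rightarrow> real"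
  assumes n: "n \<ge> 1" and R: "1 \<le> R" "R \<le> real n" and pos: "0 \<le> eps" "0 \<le> tau" "0 \<le> Y"
    and w: "continuous_on {0..} w" "w 0 = 0" "tame_path Y n w"
    and q: "continuous_on {0..real n} q"
    and width: "hi - lo + 1 \<le> R"
    and inside: "\<And>l s. l < n \<Longrightarrow> lo \<le> real l \<Longrightarrow> real l \<le> hi \<Longrightarrow> s \<in> {real l..real l + 1} \<Longrightarrow> \<bar>a l - q s\<bar> \<le> eps"
    and outside: "\<And>l s. l < n \<Longrightarrow> \<not> (lo \<le> real l \<and> real l \<le> hi) \<Longrightarrow> s \<in> {real l..real l + 1} \<Longrightarrow> \<bar>a l\<bar> \<le> tau \<and> \<bar>q s\<bar> \<le> tau"
    and qn: "\<bar>q (real n)\<bar> \<le> tau"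
    and mass: "lo > 0 \<Longrightarrow> \<bar>(\<Sum>l<n. a l) - integral {0..real n} q\<bar> \<le> tau"
  shows "norm ((\<Sum>l<n. a l *\<^sub>R w (real l)) - integral {0..real n} (\<lambda>s. q s *\<^sub>R w s))
    \<le> 5 * (R * sqrt R) * eps * Y + 10 * (real n)\<^sup>2 * tau * Y"
proof -
  define V where "V = cell_excess w"
  define D where "D = cell_osc w"
  define Q where "Q l = integral {real l..real l + 1} q" for l :: nat
  define J where "J = {l. l < n \<and> lo \<le> real l \<and> real l \<le> hi}"
  define E where "E l = integral {real l..real l + 1} (\<lambda>s. (q s - a l) *\<^sub>R (w s - w (real l)))" for l :: nat
  define b where "b l = (if l \<in> J then eps else 2 * tau)" for l
  have Jn: "J \<subseteq> {..<n}" by (auto simp: J_def)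
  then have Jfin: "finite J" by (rule finite_subset) simp
  have tame1: "norm (w (real j) - w (real i)) \<le> Y * sqrt (real j - real i)" if "i \<le> j" "j \<le> n" for i j
    using w(3) that by (simp add: tame_path_def)
  have tame2: "norm (\<Sum>l\<in>{i..<j}. V l) \<le> Y * sqrt (real j - real i)" if "i \<le> j" "j \<le> n" for i j
    using w(3) that by (simp add: tame_path_def V_def)
  have tame3: "D l \<le> Y" if "l < n" for l
    using w(3) that by (simp add: tame_path_def D_def)
  have qc: "continuous_on {real l..real l + 1} q" if "l < n" for l
    by (rule continuous_on_subset[OF q]) (use that in auto)
  have wc: "continuous_on {real l..real l + 1} w" for l
    by (rule continuous_on_subset[OF w(1)]) auto
  have ab: "\<bar>a l - q s\<bar> \<le> b l" if "l < n" "s \<in> {real l..real l + 1}" for l s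
    using inside[of l s] outside[of l s] that by (auto simp: b_def J_def)
  have b0: "b l \<ge> 0" for l using pos by (simp add: b_def)
  have aQ: "\<bar>a l - Q l\<bar> \<le> b l" if l: "l < n" for l
  proof -
    have "integral {real l..real l + 1} (\<lambda>s. a l - q s) = a l - Q l"
      unfolding Q_def using qc[OF l]
      by (subst integral_diff) (auto intro: integrable_continuous_real)
    moreover have "norm (integral {real l..real l + 1} (\<lambda>s. a l - q s)) \<le> b l * (real l + 1 - real l)"
      using qc[OF l] ab[OF l] by (intro integral_bound continuous_intros) auto
    ultimately show ?thesis by simp
  qed
  have E: "norm (E l) \<le> b l * Y" if l: "l < n" for l
  proof -
    have "norm (E l) \<le> integral {real l..real l + 1} (\<lambda>s. b l * norm (w s - w (real l)))"
      unfolding E_def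
    proof (rule integral_norm_bound_integral)
      show "(\<lambda>s. (q s - a l) *\<^sub>R (w s - w (real l))) integrable_on {real l..real l + 1}"
        by (intro integrable_continuous_real continuous_intros qc wc l)
      show "(\<lambda>s. b l * norm (w s - w (real l))) integrable_on {real l..real l + 1}"
        by (intro integrable_continuous_real continuous_intros wc)
      show "norm ((q s - a l) *\<^sub>R (w s - w (real l))) \<le> b l * norm (w s - w (real l))"
        if "s \<in> {real l..real l + 1}" for s
        using ab[OF l that] by (simp add: mult_right_mono abs_minus_commute)
    qed
    also have "\<dots> = b l * D l" by (simp add: D_def cell_osc_def)
    also have "\<dots> \<le> b l * Y" using tame3[OF l] b0 by (intro mult_left_mono) auto
    finally show ?thesis .
  qed
  have cell: "integral {real l..real l + 1} (\<lambda>s. q s *\<^sub>R w s) = Q l *\<^sub>R w (real l) + a l *\<^sub>R V l + E l"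
    if l: "l < n" for l
  proof -
    have 1: "(\<lambda>s. q s *\<^sub>R w (real l)) integrable_on {real l..real l + 1}"
      by (intro integrable_continuous_real continuous_intros qc l)
    have 2: "(\<lambda>s. a l *\<^sub>R (w s - w (real l))) integrable_on {real l..real l + 1}"
      by (intro integrable_continuous_real continuous_intros wc)
    have 3: "(\<lambda>s. (q s - a l) *\<^sub>R (w s - w (real l))) integrable_on {real l..real l + 1}"
      by (intro integrable_continuous_real continuous_intros qc wc l)
    have 4: "q integrable_on {real l..real l + 1}" by (intro integrable_continuous_real qc l)
    have "integral {real l..real l + 1} (\<lambda>s. q s *\<^sub>R w s)
      = integral {real l..real l + 1} (\<lambda>s. (q s *\<^sub>R w (real l) + a l *\<^sub>R (w s - w (real l))) + (q s - a l) *\<^sub>R (w s - w (real l)))"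
      by (rule integral_cong) (simp add: algebra_simps)
    also have "\<dots> = (integral {real l..real l + 1} (\<lambda>s. q s *\<^sub>R w (real l)) + integral {real l..real l + 1} (\<lambda>s. a l *\<^sub>R (w s - w (real l)))) + E l"
      unfolding E_def by (simp add: integral_add integrable_add 1 2 3)
    also have "integral {real l..real l + 1} (\<lambda>s. q s *\<^sub>R w (real l)) = Q l *\<^sub>R w (real l)"
      using integral_linear[OF 4 bounded_linear_scaleR_left, of "w (real l)"] by (simp add: o_def Q_def)
    also have "integral {real l..real l + 1} (\<lambda>s. a l *\<^sub>R (w s - w (real l))) = a l *\<^sub>R V l"
      by (simp add: V_def cell_excess_def)
    finally show ?thesis .
  qed
  have wn: "norm (w (real l)) \<le> Y * sqrt (real n)" if "l < n" for l
  proof -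
    have "norm (w (real l)) \<le> Y * sqrt (real l)" using tame1[of 0 l] that w(2) by simp
    also have "\<dots> \<le> Y * sqrt (real n)" using that pos by (intro mult_left_mono) auto
    finally show ?thesis .
  qed
  have "integral {0..real n} (\<lambda>s. q s *\<^sub>R w s) = (\<Sum>l<n. Q l *\<^sub>R w (real l) + a l *\<^sub>R V l + E l)"
    using cell by (subst integral_unit_cells)
      (auto intro!: continuous_intros q continuous_on_subset[OF w(1)] sum.cong)
  then have diff: "(\<Sum>l<n. a l *\<^sub>R w (real l)) - integral {0..real n} (\<lambda>s. q s *\<^sub>R w s)
     = (\<Sum>l<n. (a l - Q l) *\<^sub>R w (real l)) - (\<Sum>l<n. a l *\<^sub>R V l) - (\<Sum>l<n. E l)"
    by (simp add: sum.distrib sum_subtractf algebra_simps)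
  have split: "(\<Sum>l<n. f l) = (\<Sum>l\<in>J. f l) + (\<Sum>l\<in>{..<n} - J. f l)" for f :: "nat \<Rightarrow> 'c::ab_group_add"
    using sum.subset_diff[OF Jn] by (simp add: add.commute)
  have out_le: "norm (\<Sum>l\<in>{..<n} - J. f l) \<le> real n * y"
    if f: "\<And>l. l < n \<Longrightarrow> l \<notin> J \<Longrightarrow> norm (f l) \<le> y" and "0 \<le> y" for f :: "nat \<Rightarrow> 'c::real_normed_vector" and y
  proof -
    have "norm (\<Sum>l\<in>{..<n} - J. f l) \<le> (\<Sum>l\<in>{..<n} - J. y)" by (rule order_trans[OF norm_sum sum_mono]) (use f in auto)
    also have "\<dots> = real (card ({..<n} - J)) * y" by simp
    also have "\<dots> \<le> real n * y"
      using card_mono[of "{..<n}" "{..<n} - J"] \<open>0 \<le> y\<close> by (intro mult_right_mono) auto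
    finally show ?thesis .
  qed
  have outV: "norm (a l *\<^sub>R V l) \<le> tau * Y" if "l < n" "l \<notin> J" for l
  proof -
    have "norm (V l) \<le> Y" using tame2[of l "Suc l"] that by simp
    moreover have "\<bar>a l\<bar> \<le> tau" using outside[of l "real l"] that by (auto simp: J_def)
    ultimately show ?thesis using pos by (simp add: mult_mono)
  qed
  have outE: "norm (E l) \<le> 2 * tau * Y" if "l < n" "l \<notin> J" for l
    using E[of l] that by (simp add: b_def)
  have outW: "norm ((a l - Q l) *\<^sub>R w (real l)) \<le> 2 * tau * (Y * sqrt (real n))" if "l < n" "l \<notin> J" for l
    using aQ[of l] wn[of l] that pos unfolding norm_scaleR by (intro mult_mono) (auto simp: b_def)
  have cJ: "real (card J) \<le> R"
  proof (cases "J = {}")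
    case True then show ?thesis using R by simp
  next
    case False
    have "J \<subseteq> {Min J..Max J}" using Jfin by auto
    from card_mono[OF _ this] have "card J \<le> Suc (Max J) - Min J" by simp
    moreover have "Min J \<le> Max J" using False Jfin by auto
    ultimately have "real (card J) \<le> real (Max J) + 1 - real (Min J)" by linarith
    moreover have "Min J \<in> J" "Max J \<in> J" using False Jfin by auto
    then have "lo \<le> real (Min J)" "real (Max J) \<le> hi" by (simp_all add: J_def)
    ultimately show ?thesis using width by linarith
  qed
  have in_le: "norm (\<Sum>l\<in>J. f l) \<le> R * y"
    if f: "\<And>l. l \<in> J \<Longrightarrow> norm (f l) \<le> y" and "0 \<le> y" for f :: "nat \<Rightarrow> 'v" and y
  proof -
    have "norm (\<Sum>l\<in>J. f l) \<le> (\<Sum>l\<in>J. y)" by (rule order_trans[OF norm_sum sum_mono]) (use f in auto)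
    also have "\<dots> = real (card J) * y" by simp
    also have "\<dots> \<le> R * y" using cJ \<open>0 \<le> y\<close> by (intro mult_right_mono) auto
    finally show ?thesis .
  qed
  have inE: "norm (\<Sum>l\<in>J. E l) \<le> R * (eps * Y)"
    by (rule in_le) (use E Jn pos in \<open>force simp: b_def\<close>)+
  \<comment> \<open>The reference value is the path at the start of the window.  If the window reaches time zero, the
    masses may differ, but then \<open>w 0 = 0\<close> itself is close to the path in the window.\<close>
  define c where "c = (if lo > 0 \<and> J \<noteq> {} then w (real (Min J)) else 0)"
  have cdist: "norm (w (real l) - c) \<le> Y * sqrt R" if l: "l \<in> J" for l
  proof (cases "lo > 0")
    case True
    have "Min J \<le> l" "Min J \<in> J" using l Jfin by (auto intro!: Min_in)
    then have "norm (w (real l) - c) \<le> Y * sqrt (real l - real (Min J))"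
      using tame1[of "Min J" l] l True Jn by (auto simp: c_def)
    also have "\<dots> \<le> Y * sqrt R"
      using l \<open>Min J \<in> J\<close> width pos by (intro mult_left_mono) (auto simp: J_def)
    finally show ?thesis .
  next
    case False
    have "norm (w (real l) - c) \<le> Y * sqrt (real l)"
      using tame1[of 0 l] l False Jn w(2) by (auto simp: c_def)
    also have "\<dots> \<le> Y * sqrt R"
      using l width pos False by (intro mult_left_mono) (auto simp: J_def)
    finally show ?thesis .
  qed
  have inW: "norm (\<Sum>l\<in>J. (a l - Q l) *\<^sub>R (w (real l) - c)) \<le> R * (eps * (Y * sqrt R))"
  proof (rule in_le)
    show "norm ((a l - Q l) *\<^sub>R (w (real l) - c)) \<le> eps * (Y * sqrt R)" if "l \<in> J" for l
      using aQ[of l] cdist[OF that] that Jn pos unfolding norm_scaleR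
      by (intro mult_mono) (auto simp: b_def)
  qed (use pos R in auto)
  have refc: "norm ((\<Sum>l\<in>J. a l - Q l) *\<^sub>R c) \<le> (tau + real n * (2 * tau)) * (Y * sqrt (real n))"
  proof (cases "lo > 0 \<and> J \<noteq> {}")
    case True
    have "integral {0..real n} q = (\<Sum>l<n. Q l)" unfolding Q_def by (rule integral_unit_cells[OF q])
    then have "\<bar>\<Sum>l<n. a l - Q l\<bar> \<le> tau" using mass True by (simp add: sum_subtractf)
    moreover have "norm (\<Sum>l\<in>{..<n} - J. a l - Q l) \<le> real n * (2 * tau)"
      by (rule out_le) (use aQ pos in \<open>force simp: b_def\<close>)+
    ultimately have "\<bar>\<Sum>l\<in>J. a l - Q l\<bar> \<le> tau + real n * (2 * tau)"
      using split[of "\<lambda>l. a l - Q l"] by simp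
    moreover have "norm c \<le> Y * sqrt (real n)"
      using True Jn Min_in[OF Jfin] by (auto simp: c_def intro!: wn)
    ultimately show ?thesis unfolding norm_scaleR using pos by (intro mult_mono) auto
  next
    case False then show ?thesis using pos by (auto simp: c_def)
  qed
  have W: "norm (\<Sum>l<n. (a l - Q l) *\<^sub>R w (real l)) \<le> R * (eps * (Y * sqrt R))
     + (tau + real n * (2 * tau)) * (Y * sqrt (real n)) + real n * (2 * tau * (Y * sqrt (real n)))"
  proof -
    have "(\<Sum>l<n. (a l - Q l) *\<^sub>R w (real l)) = (\<Sum>l\<in>J. (a l - Q l) *\<^sub>R (w (real l) - c))
       + (\<Sum>l\<in>J. a l - Q l) *\<^sub>R c + (\<Sum>l\<in>{..<n} - J. (a l - Q l) *\<^sub>R w (real l))"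
      unfolding split scaleR_sum_left by (simp add: scaleR_diff_right sum_subtractf)
    moreover have "norm (\<Sum>l\<in>{..<n} - J. (a l - Q l) *\<^sub>R w (real l)) \<le> real n * (2 * tau * (Y * sqrt (real n)))"
      by (rule out_le[OF outW]) (use pos in auto)
    ultimately show ?thesis
      using inW refc by (simp only:) (intro order_trans[OF norm_triangle_ineq] add_mono)
  qed
  have inV: "norm (\<Sum>l\<in>J. a l *\<^sub>R V l) \<le> (eps + tau) * (Y * sqrt R) + R * (2 * eps * (Y * sqrt R))"
  proof (cases "J = {}")
    case True then show ?thesis using pos R by simp
  next
    case False
    define p where "p = Min J"
    define m where "m = Max J"
    have pm: "p \<in> J" "m \<in> J" "p \<le> m" using False Jfin by (auto simp: p_def m_def)
    have "l \<in> J" if "p \<le> l" "l < Suc m" for l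
    proof -
      have "real p \<le> real l" "real l \<le> real m" using that by auto
      then show ?thesis using pm that by (auto simp: J_def)
    qed
    moreover have "p \<le> l \<and> l < Suc m" if "l \<in> J" for l
      using that Jfin unfolding p_def m_def less_Suc_eq_le by simp
    ultimately have J: "J = {p..<Suc m}" by auto
    have len: "real (Suc m) - real p \<le> R" using pm width by (simp add: J_def)
    have SV: "norm (\<Sum>j\<in>{p..<Suc l}. V j) \<le> Y * sqrt R" if "l \<in> {p..m}" for l
    proof -
      have "norm (\<Sum>j\<in>{p..<Suc l}. V j) \<le> Y * sqrt (real (Suc l) - real p)"
        using that pm Jn by (intro tame2) auto
      also have "\<dots> \<le> Y * sqrt R" using that len pos by (intro mult_left_mono) auto
      finally show ?thesis .
    qed
    have am: "\<bar>a m\<bar> \<le> eps + tau"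
    proof -
      have "m < n" using pm Jn by auto
      then have 1: "\<bar>a m - q (real m + 1)\<bar> \<le> eps" using ab[of m "real m + 1"] pm by (simp add: b_def)
      have "\<bar>q (real m + 1)\<bar> \<le> tau"
      proof (cases "Suc m < n")
        case True
        have "Suc m \<notin> J" using J by simp
        then show ?thesis using outside[of "Suc m" "real m + 1"] True by (auto simp: J_def)
      next
        case False
        then have "real m + 1 = real n" using \<open>m < n\<close> by linarith
        then show ?thesis using qn by simp
      qed
      with 1 show ?thesis by linarith
    qed
    have da: "\<bar>a l - a (Suc l)\<bar> \<le> 2 * eps" if "l \<in> {p..<m}" for l
    proof -
      have "l \<in> J" "Suc l \<in> J" unfolding J using that by auto
      then show ?thesis using ab[of l "real l + 1"] ab[of "Suc l" "real l + 1"] Jn by (auto simp: b_def)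
    qed
    have "(\<Sum>l\<in>J. a l *\<^sub>R V l) = a m *\<^sub>R (\<Sum>l\<in>{p..<Suc m}. V l)
       + (\<Sum>l\<in>{p..<m}. (a l - a (Suc l)) *\<^sub>R (\<Sum>j\<in>{p..<Suc l}. V j))"
      unfolding J by (rule summation_by_parts_scaleR[OF pm(3)])
    moreover have "norm (a m *\<^sub>R (\<Sum>l\<in>{p..<Suc m}. V l)) \<le> (eps + tau) * (Y * sqrt R)"
      unfolding norm_scaleR using am SV[of m] pm pos by (intro mult_mono) auto
    moreover have "norm (\<Sum>l\<in>{p..<m}. (a l - a (Suc l)) *\<^sub>R (\<Sum>j\<in>{p..<Suc l}. V j)) \<le> R * (2 * eps * (Y * sqrt R))"
    proof -
      have "norm (\<Sum>l\<in>{p..<m}. (a l - a (Suc l)) *\<^sub>R (\<Sum>j\<in>{p..<Suc l}. V j)) \<le> (\<Sum>l\<in>{p..<m}. 2 * eps * (Y * sqrt R))"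
      proof (rule order_trans[OF norm_sum sum_mono])
        fix l assume l: "l \<in> {p..<m}"
        show "norm ((a l - a (Suc l)) *\<^sub>R (\<Sum>j\<in>{p..<Suc l}. V j)) \<le> 2 * eps * (Y * sqrt R)"
          unfolding norm_scaleR using da[OF l] SV[of l] l pos by (intro mult_mono) auto
      qed
      also have "\<dots> = real (m - p) * (2 * eps * (Y * sqrt R))" by simp
      also have "\<dots> \<le> R * (2 * eps * (Y * sqrt R))"
        using len pm pos R by (intro mult_right_mono) (auto simp: of_nat_diff)
      finally show ?thesis .
    qed
    ultimately show ?thesis by (simp only:) (intro order_trans[OF norm_triangle_ineq] add_mono)
  qed
  have aV: "norm (\<Sum>l<n. a l *\<^sub>R V l) \<le> (eps + tau) * (Y * sqrt R) + R * (2 * eps * (Y * sqrt R)) + real n * (tau * Y)"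
    unfolding split by (intro order_trans[OF norm_triangle_ineq] add_mono inV out_le[OF outV]) (use pos in auto)
  have EE: "norm (\<Sum>l<n. E l) \<le> R * (eps * Y) + real n * (2 * tau * Y)"
    unfolding split by (intro order_trans[OF norm_triangle_ineq] add_mono inE out_le[OF outE]) (use pos in auto)
  have sR: "1 \<le> sqrt R" "sqrt R \<le> sqrt n" "sqrt n \<le> real n" 
    using R n by (auto intro: real_le_lsqrt simp: power2_eq_square)
  have RR: "sqrt R \<le> R * sqrt R" "R \<le> R * sqrt R" using R sR by auto
  have n2: "real n \<le> (real n)\<^sup>2" using n by (simp add: power2_eq_square)
  have nn: "sqrt n \<le> (real n)\<^sup>2" "real n * sqrt n \<le> (real n)\<^sup>2" "sqrt R \<le> (real n)\<^sup>2"
    using n2 sR mult_left_mono[of "sqrt n" "real n" "real n"] unfolding power2_eq_square by linarith+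
  have eY: "0 \<le> eps * Y" "0 \<le> tau * Y" using pos by auto
  have "norm ((\<Sum>l<n. a l *\<^sub>R w (real l)) - integral {0..real n} (\<lambda>s. q s *\<^sub>R w s)) \<le> 
     (R * (eps * (Y * sqrt R)) + (tau + real n * (2 * tau)) * (Y * sqrt (real n)) + real n * (2 * tau * (Y * sqrt (real n))))
     + ((eps + tau) * (Y * sqrt R) + R * (2 * eps * (Y * sqrt R)) + real n * (tau * Y))
     + (R * (eps * Y) + real n * (2 * tau * Y))"
    unfolding diff by (intro order_trans[OF norm_triangle_ineq4] add_mono W aV EE)
  also have "\<dots> = (eps * Y) * (3 * (R * sqrt R) + sqrt R + R) + (tau * Y) * (sqrt n + 4 * (real n * sqrt n) + sqrt R + 3 * real n)"
    by (simp add: algebra_simps)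
  also have "\<dots> \<le> (eps * Y) * (5 * (R * sqrt R)) + (tau * Y) * (10 * (real n)\<^sup>2)"
    using RR nn n2 by (intro add_mono mult_left_mono eY) linarith+
  finally show ?thesis by (simp add: mult_ac)
qed

section \<open>Stirling's formula with error bound\<close>

text \<open>Stirling's formula in the form used below: from \<open>n = 1\<close> on, this sequence decreases to
\<open>ln (2 * pi) / 2\<close> with error at most \<open>1 / n\<close>.\<close>

definition stirling_rem :: "nat \<Rightarrow> real" where
  "stirling_rem n = ln (fact n) - (real n + 1/2) * ln (real n) + real n"

text \<open>The function is \<open>2 * artanh t - 2 * t\<close>, whose derivative is \<open>2 * t^2 / (1 - t^2)\<close>.\<close>

lemma atanh_cubic_bound:
  fixes t :: real
  assumes "0 \<le> t" "t \<le> 1/3"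
  shows "0 \<le> ln (1 + t) - ln (1 - t) - 2 * t" "ln (1 + t) - ln (1 - t) - 2 * t \<le> 3/4 * t ^ 3"
proof -
  define f where "f s = ln (1 + s) - ln (1 - s) - 2 * s" for s :: real
  define f' where "f' s = 1 / (1 + s) + 1 / (1 - s) - 2" for s :: real
  have d: "(f has_real_derivative f' s) (at s)" if "0 \<le> s" "s \<le> t" for s
    unfolding f_def f'_def using that assms by (auto intro!: derivative_eq_intros)
  have f': "f' s = 2 * s\<^sup>2 / (1 - s\<^sup>2)" if "0 \<le> s" "s \<le> t" for s
  proof -
    have "1 + s \<noteq> 0" "1 - s \<noteq> 0" using that assms by auto
    moreover have "1 - s\<^sup>2 = (1 + s) * (1 - s)" by (simp add: power2_eq_square algebra_simps)
    ultimately show ?thesis unfolding f'_def by (simp add: divide_simps)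
  qed
  have b: "0 \<le> f' s \<and> f' s \<le> 9/4 * s\<^sup>2" if "0 \<le> s" "s \<le> t" for s
  proof -
    have "s\<^sup>2 \<le> (1/3)\<^sup>2" using that assms by (intro power_mono) auto
    then have *: "8/9 \<le> 1 - s\<^sup>2" by (simp add: power2_eq_square)
    have "2 * s\<^sup>2 / (1 - s\<^sup>2) \<le> 2 * s\<^sup>2 / (8/9)"
      using * by (intro divide_left_mono mult_pos_pos) auto
    then show ?thesis unfolding f'[OF that] using * by auto
  qed
  have "f 0 \<le> f t"
    by (rule DERIV_nonneg_imp_nondecreasing[OF assms(1)]) (use d b in blast)
  then show "0 \<le> ln (1 + t) - ln (1 - t) - 2 * t" by (simp add: f_def)
  have "f t - 3/4 * t^3 \<le> f 0 - 3/4 * 0^3"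
  proof (rule DERIV_nonpos_imp_nonincreasing[OF assms(1)])
    fix s assume s: "0 \<le> s" "s \<le> t"
    have "((\<lambda>s. f s - 3/4 * s^3) has_real_derivative f' s - 9/4 * s\<^sup>2) (at s)"
      by (auto intro!: derivative_eq_intros d[OF s])
    then show "\<exists>y. ((\<lambda>s. f s - 3/4 * s^3) has_real_derivative y) (at s) \<and> y \<le> 0"
      using b[OF s] by auto
  qed
  then show "ln (1 + t) - ln (1 - t) - 2 * t \<le> 3/4 * t ^ 3" by (simp add: f_def)
qed

text \<open>With \<open>t = 1 / (2 * n + 1)\<close> the quotient \<open>(n + 1) / n\<close> is \<open>(1 + t) / (1 - t)\<close>, so one step of the
remainder is \<open>artanh t / t - 1\<close>, of order \<open>t^2\<close>; the bound is put in telescoping form.\<close>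

lemma stirling_rem_step:
  assumes n: "n \<ge> 1"
  shows "stirling_rem (Suc n) \<le> stirling_rem n"
    "stirling_rem n - stirling_rem (Suc n) \<le> 1 / real n - 1 / real (Suc n)"
proof -
  define t where "t = 1 / (2 * real n + 1)"
  have t: "0 < t" "t \<le> 1/3" using n by (auto simp: t_def divide_simps)
  have nt: "real n + 1/2 = 1 / (2 * t)" using n by (simp add: t_def)
  have q: "(1 + t) = 2 * (real n + 1) / (2 * real n + 1)" "(1 - t) = 2 * real n / (2 * real n + 1)"
    using n by (auto simp: t_def divide_simps)
  have ln: "ln (real (Suc n)) - ln (real n) = ln (1 + t) - ln (1 - t)"
  proof -
    have "ln (2 * (real n + 1) / (2 * real n + 1)) = ln 2 + ln (real n + 1) - ln (2 * real n + 1)"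
      "ln (2 * real n / (2 * real n + 1)) = ln 2 + ln (real n) - ln (2 * real n + 1)"
      using n by (simp_all only: ln_div ln_mult_pos) (simp_all add: ln_div ln_mult_pos)
    then show ?thesis unfolding q by (simp add: add.commute)
  qed
  have "stirling_rem n - stirling_rem (Suc n) = (real n + 1/2) * (ln (real (Suc n)) - ln (real n)) - 1"
  proof -
    have "ln (fact (Suc n) :: real) = ln (real (Suc n)) + ln (fact n)"
      by (simp add: ln_mult_pos del: of_nat_Suc)
    then show ?thesis by (simp add: stirling_rem_def algebra_simps del: fact_Suc)
  qed
  also have "\<dots> = (ln (1 + t) - ln (1 - t) - 2 * t) / (2 * t)"
    unfolding ln nt using t by (simp add: field_simps)
  finally have eq: "stirling_rem n - stirling_rem (Suc n) = (ln (1 + t) - ln (1 - t) - 2 * t) / (2 * t)" .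
  have "0 \<le> (ln (1 + t) - ln (1 - t) - 2 * t) / (2 * t)"
    using atanh_cubic_bound(1)[of t] t by (intro divide_nonneg_pos) auto
  then show "stirling_rem (Suc n) \<le> stirling_rem n" using eq by simp
  have "(ln (1 + t) - ln (1 - t) - 2 * t) / (2 * t) \<le> (3/4 * t^3) / (2 * t)"
    using atanh_cubic_bound(2)[of t] t by (intro divide_right_mono) auto
  also have "\<dots> = 3/8 * t\<^sup>2" using t by (simp add: power3_eq_cube power2_eq_square)
  also have "\<dots> \<le> 4 * t\<^sup>2" by simp
  also have "\<dots> \<le> 1 / real n - 1 / real (Suc n)"
    using n by (simp add: t_def power2_eq_square divide_simps) (simp add: algebra_simps)
  finally show "stirling_rem n - stirling_rem (Suc n) \<le> 1 / real n - 1 / real (Suc n)" using eq by simp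
qed

lemma wallis_product_closed:
  "(\<Prod>k=1..n. (4 * real k^2) / (4 * real k^2 - 1)) = (4 ^ n * (fact n)\<^sup>2 / fact (2 * n))\<^sup>2 / (2 * real n + 1)"
proof (induction n)
  case 0 then show ?case by simp
next
  case (Suc n)
  have "(\<Prod>k=1..Suc n. (4 * real k^2) / (4 * real k^2 - 1))
     = (4 ^ n * (fact n)\<^sup>2 / fact (2 * n))\<^sup>2 / (2 * real n + 1) * ((4 * real (Suc n)^2) / (4 * real (Suc n)^2 - 1))"
    using Suc by simp
  also have "4 * real (Suc n)^2 - 1 = (2 * real n + 1) * (2 * real n + 3)"
    by (simp add: power2_eq_square algebra_simps)
  also have "(4 ^ n * (fact n)\<^sup>2 / fact (2 * n))\<^sup>2 / (2 * real n + 1) * ((4 * real (Suc n)^2) / ((2 * real n + 1) * (2 * real n + 3)))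
     = (4 ^ Suc n * (fact (Suc n))\<^sup>2 / fact (2 * Suc n))\<^sup>2 / (2 * real (Suc n) + 1)"
  proof -
    have *: "4 * P * ((N + 1) * F)\<^sup>2 / ((2 * N + 2) * (2 * N + 1) * G) = P * F\<^sup>2 / G * (2 * (N + 1) / (2 * N + 1))"
      if "G > 0" "N \<ge> 0" for P F G N :: real
    proof -
      have "4 * P * ((N + 1) * F)\<^sup>2 / ((2 * N + 2) * (2 * N + 1) * G)
          = (2 * (N + 1)) * (P * F\<^sup>2 * (2 * (N + 1))) / ((2 * (N + 1)) * (G * (2 * N + 1)))"
        by (simp add: power2_eq_square algebra_simps)
      also have "\<dots> = P * F\<^sup>2 * (2 * (N + 1)) / (G * (2 * N + 1))"
        using that by (subst mult_divide_mult_cancel_left) auto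
      finally show ?thesis by simp
    qed
    have **: "A\<^sup>2 / K * (4 * M\<^sup>2 / (K * L)) = (A * (2 * M / K))\<^sup>2 / L" for A K M L :: real
      by (simp add: power_mult_distrib power_divide power2_eq_square mult_ac)
    have f1: "(fact (2 * Suc n) :: real) = (2 * real n + 2) * (2 * real n + 1) * fact (2 * n)"
    proof -
      have "(fact (2 * Suc n) :: real) = fact (Suc (Suc (2 * n)))" by simp
      also have "\<dots> = (2 * real n + 2) * (2 * real n + 1) * fact (2 * n)"
        unfolding fact_Suc by (simp add: algebra_simps)
      finally show ?thesis .
    qed
    have f2: "(fact (Suc n) :: real) = (real n + 1) * fact n" by (simp add: add.commute)
    have "4 ^ Suc n * (fact (Suc n))\<^sup>2 / fact (2 * Suc n)
        = 4 * 4 ^ n * ((real n + 1) * fact n)\<^sup>2 / ((2 * real n + 2) * (2 * real n + 1) * fact (2 * n))"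
      by (simp only: f1 f2 power_Suc)
    also have "\<dots> = 4 ^ n * (fact n)\<^sup>2 / fact (2 * n) * (2 * (real n + 1) / (2 * real n + 1))"
      by (rule *) auto
    finally have f3: "4 ^ Suc n * (fact (Suc n))\<^sup>2 / fact (2 * Suc n)
      = 4 ^ n * (fact n)\<^sup>2 / fact (2 * n) * (2 * (real n + 1) / (2 * real n + 1))" .
    have f4: "real (Suc n) = real n + 1" "2 * (real n + 1) + 1 = 2 * real n + 3" by auto
    show ?thesis unfolding f3 f4 by (rule **)
  qed
  finally show ?case .
qed

text \<open>The limit exists by monotonicity, and Wallis' product identifies it: the logarithm of the product up to
\<open>n\<close> is an explicit combination of the remainders at \<open>n\<close> and \<open>2 * n\<close>.\<close>

lemma stirling_rem_bounds:
  assumes "n \<ge> 1"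
  shows "0 \<le> stirling_rem n - ln (2 * pi) / 2" "stirling_rem n - ln (2 * pi) / 2 \<le> 1 / real n"
proof -
  define s where "s n = stirling_rem (Suc n)" for n
  define u where "u n = s n - 1 / real (Suc n)" for n
  have dec: "decseq s" unfolding s_def by (rule decseq_SucI) (rule stirling_rem_step, simp)
  have inc: "incseq u" unfolding u_def s_def 
  proof (rule incseq_SucI)
    fix n
    show "stirling_rem (Suc n) - 1 / real (Suc n) \<le> stirling_rem (Suc (Suc n)) - 1 / real (Suc (Suc n))"
      using stirling_rem_step(2)[of "Suc n"] by linarith
  qed
  have lb: "u 0 \<le> s n" for n
    using incseqD[OF inc, of 0 n] by (simp add: u_def) (smt (verit) divide_nonneg_nonneg of_nat_0_le_iff)
  obtain c where c: "s \<longlonglongrightarrow> c" using decseq_convergent[OF dec] lb by metis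
  have uc: "u \<longlonglongrightarrow> c"
    unfolding u_def using tendsto_diff[OF c LIMSEQ_inverse_real_of_nat] by (simp add: inverse_eq_divide)
  have b: "c \<le> s n" "u n \<le> c" for n
    using decseq_ge[OF dec c] incseq_le[OF inc uc] by auto
  have sc: "stirling_rem \<longlonglongrightarrow> c" using c unfolding s_def by (rule LIMSEQ_imp_Suc)
  have s2c: "(\<lambda>n. stirling_rem (2 * n)) \<longlonglongrightarrow> c"
    using LIMSEQ_subseq_LIMSEQ[OF sc, of "\<lambda>n. 2 * n"] by (auto simp: o_def strict_mono_def)
  have A: "(\<lambda>n. 4 * stirling_rem n - 2 * stirling_rem (2 * n) + (ln (real n) - ln 2 - ln (2 * real n + 1)))
     \<longlonglongrightarrow> 4 * c - 2 * c + (- 2 * ln 2)"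
  proof (intro tendsto_intros sc s2c)
    have "(\<lambda>n. ln (real n) - ln 2 - ln (2 * real n + 1)) \<longlonglongrightarrow> - ln 2 - ln 2" by real_asymp
    then show "(\<lambda>n. ln (real n) - ln 2 - ln (2 * real n + 1)) \<longlonglongrightarrow> - 2 * ln 2" by simp
  qed
  have B: "(\<lambda>n. ln (\<Prod>k=1..n. (4*real k^2) / (4*real k^2 - 1))) \<longlonglongrightarrow> ln (pi / 2)"
    by (intro tendsto_ln wallis) simp
  have ev: "eventually (\<lambda>n. ln (\<Prod>k=1..n. (4*real k^2) / (4*real k^2 - 1))
     = 4 * stirling_rem n - 2 * stirling_rem (2 * n) + (ln (real n) - ln 2 - ln (2 * real n + 1))) sequentially"
    using eventually_gt_at_top[of 0]
  proof eventually_elim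
    case (elim n)
    have "ln (\<Prod>k=1..n. (4*real k^2) / (4*real k^2 - 1)) 
      = 2 * (real n * ln 4 + 2 * ln (fact n) - ln (fact (2 * n))) - ln (2 * real n + 1)"
      unfolding wallis_product_closed using elim
      by (simp add: ln_div ln_mult ln_realpow)
    also have "ln (4::real) = 2 * ln 2" using ln_realpow[of 2 2] by simp
    also have "2 * (real n * (2 * ln 2) + 2 * ln (fact n) - ln (fact (2 * n))) - ln (2 * real n + 1)
       = 4 * stirling_rem n - 2 * stirling_rem (2 * n) + (ln (real n) - ln 2 - ln (2 * real n + 1))"
      using elim by (simp add: stirling_rem_def ln_mult algebra_simps)
    finally show ?case .
  qed
  have "4 * c - 2 * c + (- 2 * ln 2) = ln (pi / 2)"
    by (rule LIMSEQ_unique[OF A Lim_transform_eventually[OF B ev]])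
  then have "c = ln (2 * pi) / 2" by (simp add: ln_div ln_mult)
  then show "0 \<le> stirling_rem n - ln (2 * pi) / 2" "stirling_rem n - ln (2 * pi) / 2 \<le> 1 / real n"
    using b[of "n - 1"] assms by (auto simp: u_def s_def)
qed

text \<open>The derivative of the left-hand expression is \<open>ln (1 + t) - t\<close>, which is quadratically small.\<close>

lemma entropy_quadratic:
  fixes t :: real
  assumes "\<bar>t\<bar> \<le> 1/2"
  shows "\<bar>(1 + t) * ln (1 + t) - t - t\<^sup>2 / 2\<bar> \<le> 2 * \<bar>t\<bar> ^ 3"
proof -
  define f where "f s = (1 + s) * ln (1 + s) - s - s\<^sup>2 / 2" for s :: real
  have d: "(f has_field_derivative (ln (1 + s) - s)) (at s within {-\<bar>t\<bar>..\<bar>t\<bar>})" if "s \<in> {-\<bar>t\<bar>..\<bar>t\<bar>}" for s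
  proof -
    have "1 + s > 0" using that assms by auto
    then show ?thesis unfolding f_def by (auto intro!: derivative_eq_intros)
  qed
  have "norm (f t - f 0) \<le> (2 * \<bar>t\<bar>\<^sup>2) * norm (t - 0)"
  proof (rule field_differentiable_bound[OF _ d])
    fix s assume s: "s \<in> {-\<bar>t\<bar>..\<bar>t\<bar>}"
    then have "\<bar>ln (1 + s) - s\<bar> \<le> 2 * s\<^sup>2" using assms by (intro abs_ln_one_plus_x_minus_x_bound) auto
    also have "\<dots> \<le> 2 * \<bar>t\<bar>\<^sup>2" using s abs_le_square_iff[of s t] by auto
    finally show "norm (ln (1 + s) - s) \<le> 2 * \<bar>t\<bar>\<^sup>2" by simp
  qed auto
  then show ?thesis by (simp add: f_def power2_eq_square power3_eq_cube mult.assoc)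
qed

lemma abs_ln_one_plus_le:
  fixes y :: real
  assumes "\<bar>y\<bar> \<le> 1/2" shows "\<bar>ln (1 + y)\<bar> \<le> 2 * \<bar>y\<bar>"
proof -
  have "\<bar>ln (1 + y) - y\<bar> \<le> 2 * y\<^sup>2" using assms by (rule abs_ln_one_plus_x_minus_x_bound)
  moreover have "2 * y\<^sup>2 \<le> \<bar>y\<bar>"
    using mult_right_mono[OF assms, of "\<bar>y\<bar>"] by (simp add: power2_eq_square flip: abs_mult)
  ultimately show ?thesis by linarith
qed

section \<open>The discrete line as a negative binomial average\<close>

text \<open>The law of a sum of \<open>k\<close> independent geometric waiting times, i.e. of the time of the \<open>k\<close>-th success in
Bernoulli trials with success probability \<open>\<alpha>\<close>.\<close>

fun neg_binomial :: "real \<Rightarrow> nat \<Rightarrow> nat \<Rightarrow> real" where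
  "neg_binomial \<alpha> 0 m = (if m = 0 then 1 else 0)"
| "neg_binomial \<alpha> (Suc k) 0 = 0"
| "neg_binomial \<alpha> (Suc k) (Suc m) = real (m choose k) * \<alpha> ^ Suc k * (1 - \<alpha>) ^ (m - k)"

lemma neg_binomial_rec:
  "neg_binomial \<alpha> (Suc k) (Suc m) = (1 - \<alpha>) * neg_binomial \<alpha> (Suc k) m + \<alpha> * neg_binomial \<alpha> k m"
proof (cases m)
  case 0
  then show ?thesis by (cases k) auto
next
  case [simp]: (Suc i)
  show ?thesis
  proof (cases k)
    case 0 then show ?thesis by (simp add: mult_ac)
  next
    case [simp]: (Suc j)
    show ?thesis
    proof (cases "j < i")
      case True
      then have "i - j = Suc (i - Suc j)" by simp
      then show ?thesis by (simp add: algebra_simps)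
    next
      case False then show ?thesis by (cases "i = j") (auto simp: algebra_simps binomial_eq_0)
    qed
  qed
qed

text \<open>Each member of the line averages the past of its predecessor with geometric weights; iterating \<open>k\<close>
times convolves the weights.  The member with index \<open>Suc k\<close> is separated from the leader by \<open>k\<close> delays.\<close>

lemma conga_eq_neg_binomial_average:
  "conga \<alpha> w (Suc k) n = (\<Sum>m\<le>n. neg_binomial \<alpha> k m *\<^sub>R w (real (n - m)))"
proof (induction k arbitrary: n)
  case 0
  have "(\<Sum>m\<le>n. neg_binomial \<alpha> 0 m *\<^sub>R w (real (n - m))) = (\<Sum>m\<in>{0}. neg_binomial \<alpha> 0 m *\<^sub>R w (real (n - m)))"
    by (rule sum.mono_neutral_right) auto
  then show ?case by simp
next
  case (Suc k)
  note IH = Suc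
  show ?case
  proof (induction n)
    case 0 then show ?case by simp
  next
    case (Suc n)
    have "conga \<alpha> w (Suc (Suc k)) (Suc n) = (\<Sum>m\<le>n. neg_binomial \<alpha> (Suc k) (Suc m) *\<^sub>R w (real (n - m)))"
      unfolding conga.simps Suc IH neg_binomial_rec
      by (simp add: scaleR_sum_right sum.distrib scaleR_add_left)
    also have "\<dots> = (\<Sum>m\<le>Suc n. neg_binomial \<alpha> (Suc k) m *\<^sub>R w (real (Suc n - m)))"
      by (subst sum.atMost_Suc_shift) simp
    finally show ?case .
  qed
qed

text \<open>The \<open>k\<close>-th success comes by time \<open>n\<close> unless there are fewer than \<open>k\<close> successes in \<open>n\<close> trials.  Both
sides satisfy the same recursion.\<close>

lemma neg_binomial_mass:
  "(\<Sum>m\<le>n. neg_binomial \<alpha> k m) = 1 - (\<Sum>j<k. real (n choose j) * \<alpha> ^ j * (1 - \<alpha>) ^ (n - j))"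
proof (induction n arbitrary: k)
  case 0 
  show ?case
  proof (cases k)
    case (Suc i)
    have "(\<Sum>j<Suc i. real (0 choose j) * \<alpha> ^ j * (1 - \<alpha>) ^ (0 - j)) = (\<Sum>j\<in>{0}. real (0 choose j) * \<alpha> ^ j * (1 - \<alpha>) ^ (0 - j))"
      by (rule sum.mono_neutral_right) (auto simp: binomial_eq_0)
    then show ?thesis using Suc by simp
  qed simp
next
  case (Suc n)
  show ?case
  proof (cases k)
    case 0 then show ?thesis using Suc[of 0] by simp
  next
    case [simp]: (Suc i)
    let ?b = "\<lambda>n j. real (n choose j) * \<alpha> ^ j * (1 - \<alpha>) ^ (n - j)"
    have rec: "?b (Suc n) (Suc j) = (1 - \<alpha>) * ?b n (Suc j) + \<alpha> * ?b n j" for j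
    proof (cases "j < n")
      case True
      then have "n - j = Suc (n - Suc j)" by simp
      then show ?thesis by (simp add: algebra_simps)
    next
      case False then show ?thesis by (cases "n = j") (auto simp: algebra_simps binomial_eq_0)
    qed
    have "(\<Sum>j<Suc i. ?b (Suc n) j) = (1 - \<alpha>) ^ Suc n + (\<Sum>j<i. ?b (Suc n) (Suc j))"
      by (subst sum.lessThan_Suc_shift) simp
    also have "\<dots> = (1 - \<alpha>) * (?b n 0 + (\<Sum>j<i. ?b n (Suc j))) + \<alpha> * (\<Sum>j<i. ?b n j)"
      unfolding rec by (simp add: sum.distrib sum_distrib_left distrib_left)
    also have "?b n 0 + (\<Sum>j<i. ?b n (Suc j)) = (\<Sum>j<Suc i. ?b n j)"
      by (subst sum.lessThan_Suc_shift) simp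
    finally have b: "(\<Sum>j<Suc i. ?b (Suc n) j) = (1 - \<alpha>) * (\<Sum>j<Suc i. ?b n j) + \<alpha> * (\<Sum>j<i. ?b n j)" .
    have "(\<Sum>m\<le>Suc n. neg_binomial \<alpha> (Suc i) m) = (\<Sum>m\<le>n. neg_binomial \<alpha> (Suc i) (Suc m))"
      by (subst sum.atMost_Suc_shift) simp
    also have "\<dots> = (1 - \<alpha>) * (\<Sum>m\<le>n. neg_binomial \<alpha> (Suc i) m) + \<alpha> * (\<Sum>m\<le>n. neg_binomial \<alpha> i m)"
      unfolding neg_binomial_rec by (simp add: sum.distrib sum_distrib_left)
    also have "\<dots> = 1 - (\<Sum>j<Suc i. ?b (Suc n) j)" unfolding b Suc.IH by (simp add: algebra_simps)
    finally show ?thesis by simp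
  qed
qed

text \<open>The difference of two consecutive kernels is the kernel itself times an explicit factor.  Hence the
local limit theorem for the kernel also gives that for its discrete derivative, with no further
expansion.\<close>

lemma neg_binomial_step:
  assumes "0 < \<alpha>" "\<alpha> < 1" "1 \<le> k" "k \<le> m"
  shows "neg_binomial \<alpha> (Suc k) m - neg_binomial \<alpha> k m
    = neg_binomial \<alpha> k m * ((\<alpha> * real m - real k) / (real k * (1 - \<alpha>)))"
proof -
  obtain j i where [simp]: "k = Suc j" "m = Suc i" using assms by (cases k; cases m) auto
  have ji: "j \<le> i" using assms by simp
  have ch: "real (i choose Suc j) * real (Suc j) = real (i choose j) * real (i - j)"
  proof -
    have "Suc j * (i choose Suc j) = (i - j) * (i choose j)"
      using binomial_absorb_comp[of i j] Suc_times_binomial[of j "i - 1"] by (cases i) auto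
    then show ?thesis by (metis of_nat_mult mult.commute)
  qed
  show ?thesis
  proof (cases "j < i")
    case True
    then have ij: "i - j = Suc (i - Suc j)" by simp
    define c where "c = real (i choose j) * \<alpha> ^ Suc j * (1 - \<alpha>) ^ (i - Suc j)"
    have c1: "real (i choose Suc j) = real (i choose j) * real (i - j) / real (Suc j)"
      using ch by (simp add: field_simps)
    have 1: "neg_binomial \<alpha> (Suc k) m = c * \<alpha> * real (i - j) / real (Suc j)"
      by (simp add: c_def c1)
    have 2: "neg_binomial \<alpha> k m = c * (1 - \<alpha>)" using ij by (simp add: c_def)
    have "real (i - j) = real i - real j" using True by (simp add: of_nat_diff)
    then have "c * \<alpha> * real (i - j) / real (Suc j) - c * (1 - \<alpha>) = c * (\<alpha> * real m - real k) / real k"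
      by (simp add: field_simps)
    also have "\<dots> = c * (1 - \<alpha>) * ((\<alpha> * real m - real k) / (real k * (1 - \<alpha>)))"
      using assms by simp
    finally show ?thesis unfolding 1 2 .
  next
    case False
    then have [simp]: "i = j" using ji by simp
    have "real k * (1 - \<alpha>) > 0" using assms by (intro mult_pos_pos) auto
    moreover have "\<alpha> * real m - real k = - (real k * (1 - \<alpha>))" by (simp add: algebra_simps)
    ultimately have "(\<alpha> * real m - real k) / (real k * (1 - \<alpha>)) = -1"
      by (metis divide_minus_left divide_self less_irrefl)
    then show ?thesis by (simp add: binomial_eq_0 del: of_nat_Suc)
  qed
qed

section \<open>The local limit theorem\<close>

lemma neg_binomial_eq_choose:
  assumes "1 \<le> k" "k \<le> m"
  shows "neg_binomial \<alpha> k m = real k / real m * (real (m choose k) * \<alpha> ^ k * (1 - \<alpha>) ^ (m - k))"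
proof -
  obtain j i where [simp]: "k = Suc j" "m = Suc i" using assms by (cases k; cases m) auto
  have "real (Suc j) * real (Suc i choose Suc j) = real (Suc i) * real (i choose j)"
    by (metis Suc_times_binomial of_nat_mult)
  then have "real k / real m * real (m choose k) = real (i choose j)" by (simp add: divide_simps)
  then show ?thesis by (metis \<open>k = Suc j\<close> \<open>m = Suc i\<close> diff_Suc_Suc mult.assoc neg_binomial.simps(3))
qed

text \<open>Stirling's formula turns the logarithm into an entropy plus a prefactor; expanding the entropy to
second order around \<open>k = \<alpha> * m\<close> leaves the Gaussian exponent, since
\<open>1 / \<alpha> + 1 / (1 - \<alpha>) = 1 / (\<alpha> * (1 - \<alpha>))\<close>, and a cubic error.\<close>

lemma ln_neg_binomial_approx:
  fixes k m :: nat and \<alpha> :: real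
  assumes \<alpha>: "0 < \<alpha>" "\<alpha> < 1" and km: "1 \<le> k" "k < m"
    and h: "h = real k - \<alpha> * real m" "\<bar>h\<bar> \<le> \<alpha> * real m / 2" "\<bar>h\<bar> \<le> (1 - \<alpha>) * real m / 2"
  shows "\<bar>ln (neg_binomial \<alpha> k m) - ((ln (real k) - ln (real m) - ln (real (m - k)) - ln (2 * pi)) / 2
       - h\<^sup>2 / (2 * \<alpha> * (1 - \<alpha>) * real m))\<bar>
    \<le> 1 / real m + 1 / real k + 1 / real (m - k) + 2 * \<bar>h\<bar> ^ 3 / (\<alpha> * real m)\<^sup>2 + 2 * \<bar>h\<bar> ^ 3 / ((1 - \<alpha>) * real m)\<^sup>2"
proof -
  define b where "b = 1 - \<alpha>"
  define l where "l = m - k"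
  define M where "M = real m"
  have pos: "M > 0" "b > 0" "real k > 0" "real l > 0" using assms by (auto simp: M_def b_def l_def)
  have kl: "real k = \<alpha> * M + h" "real l = b * M - h"
    using h(1) km by (simp_all add: M_def b_def l_def of_nat_diff algebra_simps)
  define t where "t = h / (\<alpha> * M)"
  define s where "s = - h / (b * M)"
  have ts: "\<bar>t\<bar> \<le> 1/2" "\<bar>s\<bar> \<le> 1/2"
    using h(2,3) pos \<alpha> by (auto simp: t_def s_def M_def b_def abs_divide abs_mult divide_le_eq)
  have k: "real k = \<alpha> * M * (1 + t)" and l: "real l = b * M * (1 + s)"
    using pos \<alpha> by (auto simp: kl t_def s_def field_simps)
  have pts: "1 + t > 0" "1 + s > 0" using ts by auto
  have lnk: "ln (real k) = ln \<alpha> + ln M + ln (1 + t)" and lnl: "ln (real l) = ln b + ln M + ln (1 + s)"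
    unfolding k l using pos \<alpha> pts by (simp_all add: ln_mult_pos)
  define S where "S n = stirling_rem n - ln (2 * pi) / 2" for n
  have fct: "ln (fact n) = S n + ln (2 * pi) / 2 + (real n + 1/2) * ln (real n) - real n" for n
    by (simp add: S_def stirling_rem_def)
  have "real (m choose k) = fact m / (fact k * fact l)"
    using km by (simp add: binomial_fact l_def)
  then have "neg_binomial \<alpha> k m = real k / M * (fact m / (fact k * fact l) * \<alpha> ^ k * b ^ l)"
    using neg_binomial_eq_choose[of k m \<alpha>] km by (simp add: M_def b_def l_def)
  then have "ln (neg_binomial \<alpha> k m) = ln (real k) - ln M + (ln (fact m) - (ln (fact k) + ln (fact l)) + real k * ln \<alpha> + real l * ln b)"
    using pos \<alpha> km by (simp add: ln_mult_pos ln_divide_pos ln_realpow)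
  also have "\<dots> = (ln (real k) - ln M - ln (real l) - ln (2 * pi)) / 2 + (S m - S k - S l)
      - (\<alpha> * M * ((1 + t) * ln (1 + t)) + b * M * ((1 + s) * ln (1 + s)))"
  proof -
    have "real k * ln (real k) = real k * ln \<alpha> + real k * ln M + \<alpha> * M * ((1 + t) * ln (1 + t))"
      unfolding lnk by (simp add: k algebra_simps)
    moreover have "real l * ln (real l) = real l * ln b + real l * ln M + b * M * ((1 + s) * ln (1 + s))"
      unfolding lnl by (simp add: l algebra_simps)
    moreover have "M * ln M = real k * ln M + real l * ln M" "M = real k + real l"
      using km by (simp_all add: M_def l_def of_nat_diff algebra_simps)
    moreover have "(N + 1/2) * ln N = N * ln N + ln N / 2" for N :: real by (simp add: algebra_simps)
    ultimately show ?thesis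
      unfolding fct M_def[symmetric] by simp
  qed
  finally have ln: "ln (neg_binomial \<alpha> k m) = \<dots>" .
  define e1 where "e1 = (1 + t) * ln (1 + t) - t - t\<^sup>2 / 2"
  define e2 where "e2 = (1 + s) * ln (1 + s) - s - s\<^sup>2 / 2"
  have e: "\<bar>e1\<bar> \<le> 2 * \<bar>t\<bar> ^ 3" "\<bar>e2\<bar> \<le> 2 * \<bar>s\<bar> ^ 3"
    unfolding e1_def e2_def using ts by (auto intro: entropy_quadratic)
  have quad: "\<alpha> * M * (t + t\<^sup>2 / 2) + b * M * (s + s\<^sup>2 / 2) = h\<^sup>2 / (2 * \<alpha> * (1 - \<alpha>) * M)"
  proof -
    have "\<alpha> * M * (t + t\<^sup>2 / 2) = h + h\<^sup>2 / (2 * \<alpha> * M)"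
      using pos \<alpha> by (simp add: t_def field_simps power2_eq_square)
    moreover have "b * M * (s + s\<^sup>2 / 2) = - h + h\<^sup>2 / (2 * b * M)"
      using pos \<alpha> by (simp add: s_def field_simps power2_eq_square)
    moreover have "h\<^sup>2 / (2 * \<alpha> * M) + h\<^sup>2 / (2 * b * M) = h\<^sup>2 * (\<alpha> + b) / (2 * \<alpha> * b * M)"
      using pos \<alpha> by (simp add: field_simps)
    ultimately show ?thesis by (simp add: b_def)
  qed
  have "\<alpha> * M * ((1 + t) * ln (1 + t)) + b * M * ((1 + s) * ln (1 + s))
     = (\<alpha> * M * (t + t\<^sup>2 / 2) + b * M * (s + s\<^sup>2 / 2)) + \<alpha> * M * e1 + b * M * e2"
    by (simp add: e1_def e2_def algebra_simps)
  then have "ln (neg_binomial \<alpha> k m) - ((ln (real k) - ln (real m) - ln (real (m - k)) - ln (2 * pi)) / 2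
       - h\<^sup>2 / (2 * \<alpha> * (1 - \<alpha>) * real m)) = (S m - S k - S l) - \<alpha> * M * e1 - b * M * e2"
    unfolding ln quad by (simp add: M_def l_def)
  moreover have "\<bar>\<alpha> * M * e1\<bar> \<le> 2 * \<bar>h\<bar> ^ 3 / (\<alpha> * M)\<^sup>2"
  proof -
    have "\<bar>\<alpha> * M * e1\<bar> \<le> \<alpha> * M * (2 * \<bar>t\<bar> ^ 3)"
      using e pos \<alpha> by (simp add: abs_mult mult_left_mono)
    also have "\<dots> = 2 * \<bar>h\<bar> ^ 3 / (\<alpha> * M)\<^sup>2"
      using pos \<alpha> by (simp add: t_def abs_divide abs_mult power_divide power2_eq_square power3_eq_cube)
    finally show ?thesis .
  qed
  moreover have "\<bar>b * M * e2\<bar> \<le> 2 * \<bar>h\<bar> ^ 3 / (b * M)\<^sup>2"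
  proof -
    have "\<bar>b * M * e2\<bar> \<le> b * M * (2 * \<bar>s\<bar> ^ 3)"
      using e pos \<alpha> by (simp add: abs_mult mult_left_mono)
    also have "\<dots> = 2 * \<bar>h\<bar> ^ 3 / (b * M)\<^sup>2"
      using pos \<alpha> by (simp add: s_def abs_divide abs_mult power_divide power2_eq_square power3_eq_cube)
    finally show ?thesis .
  qed
  moreover have "\<bar>S m\<bar> \<le> 1 / M" "\<bar>S k\<bar> \<le> 1 / real k" "\<bar>S l\<bar> \<le> 1 / real l"
    using stirling_rem_bounds[of m] stirling_rem_bounds[of k] stirling_rem_bounds[of l] km pos
    by (auto simp: S_def M_def abs_le_iff)
  ultimately show ?thesis unfolding M_def[symmetric] l_def[symmetric] b_def[symmetric] by linarith
qed

text \<open>The kernel of the continuous line, with exactly the conventions of its defining integral; in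
particular it vanishes at \<open>z = 0\<close> by division by zero, which is the continuous extension for \<open>x > 0\<close>.\<close>

definition conga_kernel :: "real \<Rightarrow> real \<Rightarrow> real \<Rightarrow> real" where
  "conga_kernel \<alpha> x z = 1 / sqrt (2 * pi) * ((x + \<alpha> * z) / (2 * conga_sigma \<alpha> * z powr (3/2))) *
         exp (- ((x - \<alpha> * z)\<^sup>2 / (2 * (conga_sigma \<alpha>)\<^sup>2 * z)))"

lemma conga_sigma:
  assumes "0 < \<alpha>" "\<alpha> < 1"
  shows "conga_sigma \<alpha> > 0" "(conga_sigma \<alpha>)\<^sup>2 = \<alpha> * (1 - \<alpha>)" "ln (conga_sigma \<alpha>) = (ln \<alpha> + ln (1 - \<alpha>)) / 2"
  using assms by (simp_all add: conga_sigma_def ln_sqrt ln_mult_pos)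

lemma ln_conga_kernel:
  assumes \<alpha>: "0 < \<alpha>" "\<alpha> < 1" and "z > 0" "x + \<alpha> * z > 0"
  shows "ln (conga_kernel \<alpha> x z) = ln (x + \<alpha> * z) - ln 2 - (ln \<alpha> + ln (1 - \<alpha>)) / 2 - 3/2 * ln z - ln (2 * pi) / 2
     - (x - \<alpha> * z)\<^sup>2 / (2 * \<alpha> * (1 - \<alpha>) * z)"
    "conga_kernel \<alpha> x z > 0"
proof -
  note s = conga_sigma[OF \<alpha>]
  have "ln (1 / sqrt (2 * pi)) = - ln (2 * pi) / 2" by (simp add: ln_divide_pos ln_sqrt)
  moreover have "ln ((x + \<alpha> * z) / (2 * conga_sigma \<alpha> * z powr (3/2))) = ln (x + \<alpha> * z) - (ln 2 + (ln \<alpha> + ln (1 - \<alpha>)) / 2 + 3/2 * ln z)"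
    using assms s by (simp add: ln_divide_pos ln_mult_pos ln_powr)
  moreover have "(x + \<alpha> * z) / (2 * conga_sigma \<alpha> * z powr (3/2)) > 0" using assms s by simp
  ultimately show "ln (conga_kernel \<alpha> x z) = ln (x + \<alpha> * z) - ln 2 - (ln \<alpha> + ln (1 - \<alpha>)) / 2 - 3/2 * ln z - ln (2 * pi) / 2
     - (x - \<alpha> * z)\<^sup>2 / (2 * \<alpha> * (1 - \<alpha>) * z)"
  proof -
    have "ln (A * B * exp (- C)) = ln A + ln B - C" if "A > 0" "B > 0" for A B C :: real
      using that by (simp add: ln_mult_pos)
    from this[of "1 / sqrt (2 * pi)" "(x + \<alpha> * z) / (2 * conga_sigma \<alpha> * z powr (3/2))" "(x - \<alpha> * z)\<^sup>2 / (2 * (conga_sigma \<alpha>)\<^sup>2 * z)"]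
    have "ln (conga_kernel \<alpha> x z) = ln (1 / sqrt (2 * pi)) + ln ((x + \<alpha> * z) / (2 * conga_sigma \<alpha> * z powr (3/2)))
      - (x - \<alpha> * z)\<^sup>2 / (2 * (conga_sigma \<alpha>)\<^sup>2 * z)"
      unfolding conga_kernel_def using \<open>(x + \<alpha> * z) / _ > 0\<close> by simp
    then show ?thesis using \<open>ln (1 / sqrt (2 * pi)) = _\<close> \<open>ln ((x + \<alpha> * z) / _) = _\<close>
      unfolding s(2) mult.assoc by linarith
  qed
  show "conga_kernel \<alpha> x z > 0" unfolding conga_kernel_def using assms s by simp
qed

text \<open>The local limit theorem.  In a window of half-width \<open>H \<ge> sqrt m\<close> the relative error is of order
\<open>H^3 / m^2\<close>, the size of the cubic term of the entropy.  The arguments of the continuous kernel may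
differ by \<open>O(1)\<close> from \<open>k\<close> and \<open>m\<close>, because such a shift changes the logarithm by \<open>O(H / m)\<close> only; this
freedom treats all real \<open>x\<close> at once and absorbs the index offsets of the discrete line.\<close>

lemma ln_neg_binomial_conga_kernel:
  fixes k m :: nat and \<alpha> x z H c :: real
  assumes \<alpha>: "0 < \<alpha>" "\<alpha> < 1" and c: "0 < c" "c \<le> \<alpha>" "c \<le> 1 - \<alpha>" and km: "1 \<le> k" "k < m"
    and x: "\<bar>x - real k\<bar> \<le> 2" and z: "\<bar>z - real m\<bar> \<le> 1"
    and H: "1 \<le> H" "real m \<le> H\<^sup>2" "\<bar>real k - \<alpha> * real m\<bar> \<le> H" "4 * H \<le> c * real m"
  shows "\<bar>ln (neg_binomial \<alpha> k m) - ln (conga_kernel \<alpha> x z)\<bar> \<le> 50 / c\<^sup>2 * (H ^ 3 / (real m)\<^sup>2)"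
proof -
  define b where "b = 1 - \<alpha>"
  define M where "M = real m"
  define h where "h = real k - \<alpha> * M"
  define l where "l = m - k"
  define E where "E = H ^ 3 / M\<^sup>2"
  have pos: "M > 0" "b > 0" "real k > 0" "real l > 0" "c < 1" using assms by (auto simp: M_def b_def l_def)
  have cM: "4 * H \<le> c * M" using H by (simp add: M_def)
  have M4: "4 \<le> M"
  proof -
    have "4 \<le> c * M" using H(1) cM by linarith
    also have "\<dots> \<le> 1 * M" using pos by (intro mult_right_mono) auto
    finally show ?thesis by simp
  qed
  have cab: "c * M \<le> \<alpha> * M" "c * M \<le> b * M" using c pos by (auto simp: b_def)
  have hH: "\<bar>h\<bar> \<le> H" using H by (simp add: h_def M_def)
  have h2: "\<bar>h\<bar> \<le> \<alpha> * M / 2" "\<bar>h\<bar> \<le> b * M / 2" using hH cM cab H(1) by linarith+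
  have kl: "real k = \<alpha> * M + h" "real l = b * M - h"
    using km by (simp_all add: h_def M_def b_def l_def of_nat_diff algebra_simps)
  have kl2: "c * M / 2 \<le> real k" "c * M / 2 \<le> real l" unfolding kl using h2 cab by linarith+
  \<comment> \<open>Since \<open>H^2 \<ge> M\<close>, the cubic error \<open>E\<close> dominates all other error scales.\<close>
  have E1: "1 / M \<le> E" "H / M \<le> E" "H\<^sup>2 / M\<^sup>2 \<le> E" "0 \<le> E"
  proof -
    have "H * M \<le> H * H\<^sup>2" using H by (intro mult_left_mono) (auto simp: M_def)
    then have "H * M / M\<^sup>2 \<le> H * H\<^sup>2 / M\<^sup>2" by (intro divide_right_mono) auto
    then show "H / M \<le> E" using pos by (simp add: E_def power2_eq_square power3_eq_cube mult.assoc)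
    moreover have "1 / M \<le> H / M" using H pos by (intro divide_right_mono) auto
    ultimately show "1 / M \<le> E" by linarith
    have "H\<^sup>2 \<le> H ^ 3" using H by (simp add: power2_eq_square power3_eq_cube)
    then show "H\<^sup>2 / M\<^sup>2 \<le> E" unfolding E_def by (intro divide_right_mono) auto
    show "0 \<le> E" using H by (simp add: E_def)
  qed
  have c1: "1 \<le> 1 / c" "1 / c \<le> 1 / c\<^sup>2" "1 \<le> 1 / c\<^sup>2" using c pos by (auto simp: power2_eq_square divide_simps mult_le_one)
  have zpos: "M / 2 \<le> z" "z > 0" using z M4 by (auto simp: M_def abs_le_iff)
  have xz: "x + \<alpha> * z = 2 * \<alpha> * M * (1 + (h + (x - real k) + \<alpha> * (z - M)) / (2 * \<alpha> * M))"
    using pos \<alpha> by (simp add: h_def field_simps)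
  have za: "\<bar>\<alpha> * (z - M)\<bar> \<le> 1"
    unfolding abs_mult using z \<alpha> mult_mono[of "\<bar>\<alpha>\<bar>" 1 "\<bar>z - M\<bar>" 1] by (simp add: M_def)
  have g: "\<bar>h + (x - real k) + \<alpha> * (z - M)\<bar> \<le> H + 3" using hH x za by linarith
  define y where "y = (h + (x - real k) + \<alpha> * (z - M)) / (2 * \<alpha> * M)"
  have y: "\<bar>y\<bar> \<le> 2 * (H / (c * M))" "\<bar>y\<bar> \<le> 1/2"
  proof -
    have "\<bar>y\<bar> = \<bar>h + (x - real k) + \<alpha> * (z - M)\<bar> / (2 * \<alpha> * M)"
      using pos \<alpha> by (simp add: y_def abs_divide abs_mult)
    also have "\<dots> \<le> (4 * H) / (2 * (c * M))"
      using g H cab pos c \<alpha> by (intro frac_le mult_pos_pos) auto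
    finally show "\<bar>y\<bar> \<le> 2 * (H / (c * M))" by (simp add: mult.commute)
    also have "\<dots> \<le> 1/2" using cM pos c by (simp add: divide_le_eq)
    finally show "\<bar>y\<bar> \<le> 1/2" .
  qed
  define t where "t = h / (\<alpha> * M)"
  define s where "s = - h / (b * M)"
  have ts: "\<bar>t\<bar> \<le> 1/2" "\<bar>s\<bar> \<le> 1/2"
    using h2 pos \<alpha> by (auto simp: t_def s_def abs_divide abs_mult divide_le_eq)
  have ts': "\<bar>t\<bar> \<le> H / (c * M)" "\<bar>s\<bar> \<le> H / (c * M)"
    unfolding t_def s_def abs_divide abs_mult using hH cab pos \<alpha> c by (auto intro!: frac_le)
  have k: "real k = \<alpha> * M * (1 + t)" and l: "real l = b * M * (1 + s)"
    using pos \<alpha> by (auto simp: kl t_def s_def field_simps)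
  have lnk: "ln (real k) = ln \<alpha> + ln M + ln (1 + t)" and lnl: "ln (real l) = ln b + ln M + ln (1 + s)"
    unfolding k l using pos \<alpha> ts by (simp_all add: ln_mult_pos)
  have lnx: "ln (x + \<alpha> * z) = ln 2 + ln \<alpha> + ln M + ln (1 + y)"
    unfolding xz y_def[symmetric] using pos \<alpha> y by (simp add: ln_mult_pos)
  have xzpos: "x + \<alpha> * z > 0" unfolding xz y_def[symmetric] using pos \<alpha> y by simp
  define r where "r = (z - M) / M"
  have r: "\<bar>r\<bar> \<le> 1 / M" "\<bar>r\<bar> \<le> 1/2"
  proof -
    show "\<bar>r\<bar> \<le> 1 / M" using z pos by (auto simp: r_def abs_divide M_def intro!: divide_right_mono)
    also have "\<dots> \<le> 1/2" using M4 by (simp add: divide_simps)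
    finally show "\<bar>r\<bar> \<le> 1/2" .
  qed
  have zr: "z = M * (1 + r)" using pos by (simp add: r_def field_simps)
  then have lnz: "ln z = ln M + ln (1 + r)" using pos r by (simp add: ln_mult_pos)
  \<comment> \<open>Both prefactors are \<open>sqrt (\<alpha> / (b * M))\<close> up to a relative error of order \<open>H / M\<close>.\<close>
  have pre: "\<bar>((ln (real k) - ln M - ln (real l)) / 2) - (ln (x + \<alpha> * z) - ln 2 - (ln \<alpha> + ln b) / 2 - 3/2 * ln z)\<bar> \<le> 9 / c\<^sup>2 * E"
  proof -
    have "((ln (real k) - ln M - ln (real l)) / 2) - (ln (x + \<alpha> * z) - ln 2 - (ln \<alpha> + ln b) / 2 - 3/2 * ln z)
       = (ln (1 + t) - ln (1 + s)) / 2 - ln (1 + y) + 3/2 * ln (1 + r)"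
      unfolding lnk lnl lnx lnz by (simp add: field_simps)
    moreover have "\<bar>(A - B) / 2 - C + 3/2 * D\<bar> \<le> 6 * p + 3 * q"
      if "\<bar>A\<bar> \<le> 2 * p" "\<bar>B\<bar> \<le> 2 * p" "\<bar>C\<bar> \<le> 4 * p" "\<bar>D\<bar> \<le> 2 * q" for A B C D p q :: real
      using that unfolding abs_le_iff by (auto simp: field_simps)
    moreover have "\<bar>ln (1 + t)\<bar> \<le> 2 * (H / (c * M))" "\<bar>ln (1 + s)\<bar> \<le> 2 * (H / (c * M))"
      "\<bar>ln (1 + y)\<bar> \<le> 4 * (H / (c * M))" "\<bar>ln (1 + r)\<bar> \<le> 2 * (1 / M)"
      using abs_ln_one_plus_le[OF ts(1)] abs_ln_one_plus_le[OF ts(2)] abs_ln_one_plus_le[OF y(2)]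
        abs_ln_one_plus_le[OF r(2)] ts' y(1) r(1) by linarith+
    ultimately have "\<bar>((ln (real k) - ln M - ln (real l)) / 2) - (ln (x + \<alpha> * z) - ln 2 - (ln \<alpha> + ln b) / 2 - 3/2 * ln z)\<bar>
       \<le> 6 * (H / (c * M)) + 3 * (1 / M)"
      by (simp only:)
    also have "6 * (H / (c * M)) \<le> 6 * (1 / c\<^sup>2 * E)"
    proof -
      have "H / (c * M) = 1 / c * (H / M)" by simp
      also have "\<dots> \<le> 1 / c\<^sup>2 * E" using c1 E1 H pos by (intro mult_mono) auto
      finally show ?thesis by linarith
    qed
    also have "1 / M \<le> 1 / c\<^sup>2 * E" using mult_right_mono[OF c1(3) E1(4)] E1(1) by linarith
    finally show ?thesis by simp
  qed
  \<comment> \<open>The exponents differ by shifts of order one in \<open>x - \<alpha> * z\<close> and in \<open>z\<close>.\<close>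
  define f where "f = (x - real k) - \<alpha> * (z - M)"
  have f: "\<bar>f\<bar> \<le> 3" unfolding f_def using x za by linarith
  have xf: "x - \<alpha> * z = h + f" by (simp add: h_def f_def algebra_simps)
  have quad: "\<bar>h\<^sup>2 / (2 * \<alpha> * b * M) - (x - \<alpha> * z)\<^sup>2 / (2 * \<alpha> * b * z)\<bar> \<le> 16 / c\<^sup>2 * E"
  proof -
    have "h\<^sup>2 / M - (h + f)\<^sup>2 / z = h\<^sup>2 * (z - M) / (M * z) - (2 * h * f + f\<^sup>2) / z"
      using pos zpos by (simp add: field_simps power2_eq_square)
    moreover have "\<bar>h\<^sup>2 * (z - M) / (M * z)\<bar> \<le> 2 * (H\<^sup>2 / M\<^sup>2)"
    proof -
      have "\<bar>h\<^sup>2 * (z - M) / (M * z)\<bar> = h\<^sup>2 * \<bar>z - M\<bar> / (M * z)"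
        using pos zpos by (simp add: abs_divide abs_mult)
      also have "\<dots> \<le> (H\<^sup>2 * 1) / (M * (M / 2))"
        using pos zpos z hH by (intro frac_le mult_mono mult_pos_pos) (auto simp: M_def abs_le_square_iff[symmetric])
      also have "\<dots> = 2 * (H\<^sup>2 / M\<^sup>2)" by (simp add: power2_eq_square)
      finally show ?thesis .
    qed
    moreover have "\<bar>(2 * h * f + f\<^sup>2) / z\<bar> \<le> 30 * (H / M)"
    proof -
      have "\<bar>h * f\<bar> \<le> H * 3" unfolding abs_mult using hH f by (intro mult_mono) auto
      moreover have "f\<^sup>2 \<le> 9" using f abs_le_square_iff[of f 3] by simp
      ultimately have "\<bar>2 * h * f + f\<^sup>2\<bar> \<le> 15 * H"
        using H(1) zero_le_power2[of f] unfolding abs_le_iff mult.assoc by linarith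
      then have "\<bar>2 * h * f + f\<^sup>2\<bar> / z \<le> (15 * H) / (M / 2)"
        using pos zpos H by (intro frac_le) auto
      then show ?thesis using zpos by (simp add: abs_divide)
    qed
    ultimately have "\<bar>h\<^sup>2 / M - (h + f)\<^sup>2 / z\<bar> \<le> 2 * E + 30 * E" using E1 by linarith
    moreover have "h\<^sup>2 / (2 * \<alpha> * b * M) - (x - \<alpha> * z)\<^sup>2 / (2 * \<alpha> * b * z) = 1 / (2 * (\<alpha> * b)) * (h\<^sup>2 / M - (h + f)\<^sup>2 / z)"
      unfolding xf by (simp add: right_diff_distrib)
    moreover have "0 < 1 / (2 * (\<alpha> * b))" "1 / (2 * (\<alpha> * b)) \<le> 1 / (2 * c\<^sup>2)"
    proof -
      have "c * c \<le> \<alpha> * b" using c by (intro mult_mono) (auto simp: b_def)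
      then show "1 / (2 * (\<alpha> * b)) \<le> 1 / (2 * c\<^sup>2)" using c by (intro divide_left_mono) (auto simp: power2_eq_square intro!: mult_pos_pos pos \<alpha>)
    qed (use pos \<alpha> in auto)
    ultimately have "\<bar>h\<^sup>2 / (2 * \<alpha> * b * M) - (x - \<alpha> * z)\<^sup>2 / (2 * \<alpha> * b * z)\<bar> \<le> 1 / (2 * c\<^sup>2) * (32 * E)"
      unfolding abs_mult using E1 by (simp only: abs_mult) (intro mult_mono, auto)
    then show ?thesis by simp
  qed
  have main: "\<bar>ln (neg_binomial \<alpha> k m) - ((ln (real k) - ln M - ln (real l) - ln (2 * pi)) / 2
       - h\<^sup>2 / (2 * \<alpha> * b * M))\<bar>
    \<le> 1 / M + 1 / real k + 1 / real l + 2 * \<bar>h\<bar> ^ 3 / (\<alpha> * M)\<^sup>2 + 2 * \<bar>h\<bar> ^ 3 / (b * M)\<^sup>2"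
    unfolding M_def b_def l_def using h2 by (intro ln_neg_binomial_approx \<alpha> km) (auto simp: h_def M_def b_def)
  have kl3: "1 / real k \<le> 2 / c\<^sup>2 * E" "1 / real l \<le> 2 / c\<^sup>2 * E"
  proof -
    have "2 / c * (1 / M) \<le> 2 / c\<^sup>2 * E" using E1 c c1 pos by (intro mult_mono) auto
    moreover have "1 / real k \<le> 1 / (c * M / 2)" "1 / real l \<le> 1 / (c * M / 2)"
      using frac_le[of 1 1 "c * M / 2" "real k"] frac_le[of 1 1 "c * M / 2" "real l"] kl2 pos c by simp_all
    ultimately show "1 / real k \<le> 2 / c\<^sup>2 * E" "1 / real l \<le> 2 / c\<^sup>2 * E" by auto
  qed
  have cub: "2 * \<bar>h\<bar> ^ 3 / (q * M)\<^sup>2 \<le> 2 / c\<^sup>2 * E" if "c \<le> q" for q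
  proof -
    have "c * M \<le> q * M" using that pos by simp
    then have "2 * \<bar>h\<bar> ^ 3 / (q * M)\<^sup>2 \<le> 2 * H ^ 3 / (c * M)\<^sup>2"
      using hH pos c H by (intro frac_le mult_left_mono power_mono) auto
    then show ?thesis by (simp add: E_def power_mult_distrib)
  qed
  have "1 / M \<le> 1 / c\<^sup>2 * E" using mult_right_mono[OF c1(3) E1(4)] E1(1) by linarith
  then have "\<bar>ln (neg_binomial \<alpha> k m) - ((ln (real k) - ln M - ln (real l) - ln (2 * pi)) / 2
       - h\<^sup>2 / (2 * \<alpha> * b * M))\<bar> \<le> 9 * (1 / c\<^sup>2 * E)"
    using main kl3 cub[of \<alpha>] cub[of b] c unfolding b_def[symmetric] by simp
  then have "\<bar>ln (neg_binomial \<alpha> k m) - ln (conga_kernel \<alpha> x z)\<bar> \<le> 9 * (1 / c\<^sup>2 * E) + 9 / c\<^sup>2 * E + 16 / c\<^sup>2 * E"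
  proof -
    have "\<bar>N - (B - L - X)\<bar> \<le> p + q + r"
      if "\<bar>N - ((K - L') / 2 - Y)\<bar> \<le> p" "\<bar>K / 2 - B\<bar> \<le> q" "\<bar>Y - X\<bar> \<le> r" "L = L' / 2" for N B L L' X K Y p q r :: real
      using that unfolding abs_le_iff by (auto simp: field_simps)
    from this[OF \<open>\<bar>ln (neg_binomial \<alpha> k m) - _\<bar> \<le> 9 * (1 / c\<^sup>2 * E)\<close> pre quad refl] show ?thesis
      unfolding ln_conga_kernel(1)[OF \<alpha> zpos(2) xzpos] b_def[symmetric] .
  qed
  also have "\<dots> \<le> 50 / c\<^sup>2 * E" using E1(4) by (simp add: divide_right_mono)
  finally show ?thesis by (simp add: E_def M_def)
qed

section \<open>Tails and masses of the negative binomial kernel\<close>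

text \<open>Up to the factor \<open>\<alpha>\<close> the weight is a binomial probability for \<open>m - 1\<close> trials, so Hoeffding's inequality
applies; the subtracted \<open>1\<close> pays for the shift from \<open>m\<close> to \<open>m - 1\<close> and from \<open>k\<close> to \<open>k - 1\<close>.\<close>

lemma neg_binomial_tail:
  assumes \<alpha>: "0 < \<alpha>" "\<alpha> < 1" and "2 \<le> k" and t: "0 \<le> t" "t \<le> \<bar>\<alpha> * real m - real k\<bar> - 1"
    and m: "1 \<le> m" "m \<le> n"
  shows "\<bar>neg_binomial \<alpha> k m\<bar> \<le> 2 * exp (- 2 * t\<^sup>2 / real n)"
proof -
  interpret binomial_distribution "m - 1" \<alpha> by standard (use \<alpha> in auto)
  obtain j i where ji [simp]: "k = Suc j" "m = Suc i" using assms by (cases k; cases m) auto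
  show ?thesis
  proof (cases "i = 0")
    case True
    then show ?thesis using \<open>2 \<le> k\<close> by (simp add: binomial_eq_0)
  next
    case False
    have "pmf (binomial_pmf i \<alpha>) j = real (i choose j) * \<alpha> ^ j * (1 - \<alpha>) ^ (i - j)"
      using \<alpha> by (subst pmf_binomial) auto
    then have "neg_binomial \<alpha> k m = \<alpha> * pmf (binomial_pmf i \<alpha>) j" by simp
    then have "\<bar>neg_binomial \<alpha> k m\<bar> \<le> pmf (binomial_pmf i \<alpha>) j"
      using \<alpha> mult_right_mono[of \<alpha> 1 "pmf (binomial_pmf i \<alpha>) j"]
      by (simp add: abs_mult del: pmf_binomial neg_binomial.simps)
    also have "\<dots> = measure_pmf.prob (binomial_pmf i \<alpha>) {j}" by (simp add: pmf.rep_eq)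
    also have "\<dots> \<le> measure_pmf.prob (binomial_pmf i \<alpha>) {x. \<bar>real x - real i * \<alpha>\<bar> \<ge> t}"
    proof (rule measure_pmf.finite_measure_mono)
      have "\<alpha> * real m - real k = real i * \<alpha> - real j + (\<alpha> - 1)" by (simp add: algebra_simps)
      then have "t \<le> \<bar>real j - real i * \<alpha>\<bar>" using t \<alpha> by linarith
      then show "{j} \<subseteq> {x. \<bar>real x - real i * \<alpha>\<bar> \<ge> t}" by simp
    qed simp
    also have "\<dots> \<le> 2 * exp (- 2 * t\<^sup>2 / real i)"
      using prob_abs_ge[of t] False t by simp
    also have "\<dots> \<le> 2 * exp (- 2 * t\<^sup>2 / real n)"
    proof -
      have "2 * t\<^sup>2 / real n \<le> 2 * t\<^sup>2 / real i"
        using m False by (intro divide_left_mono) auto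
      then show ?thesis by simp
    qed
    finally show ?thesis .
  qed
qed

lemma neg_binomial_mass_defect:
  assumes \<alpha>: "0 < \<alpha>" "\<alpha> < 1" and t: "0 \<le> t" "t \<le> \<alpha> * real n - real k" and n: "1 \<le> n"
  shows "\<bar>(\<Sum>m\<le>n. neg_binomial \<alpha> k m) - 1\<bar> \<le> exp (- 2 * t\<^sup>2 / real n)"
proof -
  interpret binomial_distribution n \<alpha> by standard (use \<alpha> in auto)
  have "(\<Sum>j<k. real (n choose j) * \<alpha> ^ j * (1 - \<alpha>) ^ (n - j)) = (\<Sum>j<k. pmf (binomial_pmf n \<alpha>) j)"
    using \<alpha> by (intro sum.cong) (auto simp: pmf_binomial)
  also have "\<dots> = measure_pmf.prob (binomial_pmf n \<alpha>) {..<k}"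
    by (simp add: measure_measure_pmf_finite)
  finally have eq: "1 - (\<Sum>m\<le>n. neg_binomial \<alpha> k m) = measure_pmf.prob (binomial_pmf n \<alpha>) {..<k}"
    unfolding neg_binomial_mass by simp
  have "measure_pmf.prob (binomial_pmf n \<alpha>) {..<k} \<le> measure_pmf.prob (binomial_pmf n \<alpha>) {x. real x \<le> real n * \<alpha> - t}"
  proof (rule measure_pmf.finite_measure_mono)
    show "{..<k} \<subseteq> {x. real x \<le> real n * \<alpha> - t}"
    proof safe
      fix x assume "x < k"
      then have "real x < real k" by simp
      then show "real x \<le> real n * \<alpha> - t" using t by (simp add: mult.commute)
    qed
  qed simp
  also have "\<dots> \<le> exp (- 2 * t\<^sup>2 / real n)" using prob_le[of t] n t by simp
  finally show ?thesis using eq measure_nonneg[of "binomial_pmf n \<alpha>" "{..<k}"] by linarith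
qed

section \<open>The normal distribution function\<close>

text \<open>The kernel of the continuous line is the derivative in time of this distribution function at the
standardised position, which makes its total mass computable.\<close>

definition normal_cdf :: "real \<Rightarrow> real" where
  "normal_cdf y = measure (density lborel std_normal_density) {..y}"

lemma normal_cdf_diff:
  assumes "a \<le> b"
  shows "normal_cdf b - normal_cdf a = integral {a..b} std_normal_density"
proof -
  interpret N: prob_space "density lborel std_normal_density" by (rule prob_space_normal_density) simp
  have "measure (density lborel std_normal_density) {..b} = measure (density lborel std_normal_density) ({..a} \<union> {a<..b})"
    using assms by (intro arg_cong[of _ _ "measure _"]) auto
  also have "\<dots> = normal_cdf a + measure (density lborel std_normal_density) {a<..b}"
    unfolding normal_cdf_def by (rule N.finite_measure_Union) auto
  finally have "normal_cdf b - normal_cdf a = measure (density lborel std_normal_density) {a<..b}"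
    by (simp add: normal_cdf_def)
  also have "\<dots> = integral {a..b} std_normal_density"
  proof -
    have cont: "continuous_on {a..b} std_normal_density"
      unfolding std_normal_density_def by (intro continuous_intros) auto
    have "ennreal (measure (density lborel std_normal_density) {a<..b}) = (\<integral>\<^sup>+u. ennreal (std_normal_density u) * indicator {a<..b} u \<partial>lborel)"
      by (simp add: N.emeasure_eq_measure[symmetric] emeasure_density)
    also have "\<dots> = (\<integral>\<^sup>+u. ennreal (std_normal_density u) * indicator {a..b} u \<partial>lborel)"
      using AE_lborel_singleton[of a] by (intro nn_integral_cong_AE) (auto split: split_indicator elim!: eventually_mono)
    also have "\<dots> = ennreal (integral {a..b} std_normal_density)"
      by (rule nn_integral_has_integral_lebesgue'[OF _ integrable_integral[OF integrable_continuous_real[OF cont]]]) simp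
    finally show ?thesis
      by (simp add: integral_nonneg integrable_continuous_real[OF cont])
  qed
  finally show ?thesis .
qed

lemma has_derivative_normal_cdf: "(normal_cdf has_real_derivative std_normal_density y) (at y)"
proof -
  have "((\<lambda>u. integral {y - 1..u} std_normal_density) has_real_derivative std_normal_density y) (at y within {y - 1..y + 1})"
    by (rule integral_has_real_derivative) (auto simp: std_normal_density_def intro!: continuous_intros)
  moreover have "at y within {y - 1..y + 1} = at y" by (rule at_within_interior) simp
  ultimately have "((\<lambda>u. integral {y - 1..u} std_normal_density) has_real_derivative std_normal_density y) (at y)"
    by simp
  from DERIV_add[OF DERIV_const this]
  have "((\<lambda>u. normal_cdf (y - 1) + integral {y - 1..u} std_normal_density) has_real_derivative std_normal_density y) (at y)"
    by simp
  then show ?thesis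
  proof (rule DERIV_cong_ev[THEN iffD1, rotated -1])
    have "eventually (\<lambda>u. u \<in> {y - 1<..}) (nhds y)"
      by (rule eventually_nhds_in_open) auto
    then show "eventually (\<lambda>u. normal_cdf (y - 1) + integral {y - 1..u} std_normal_density = normal_cdf u) (nhds y)"
    proof eventually_elim
      case (elim u)
      then have "y - 1 \<le> u" by simp
      from normal_cdf_diff[OF this] show ?case by simp
    qed
  qed auto
qed

lemma has_derivative_std_normal_density:
  "(std_normal_density has_real_derivative - y * std_normal_density y) (at y)"
proof -
  have "((\<lambda>y. c * exp (- y\<^sup>2 / 2)) has_real_derivative - y * (c * exp (- y\<^sup>2 / 2))) (at y)" for c :: real
    by (auto intro!: derivative_eq_intros)
  then show ?thesis unfolding std_normal_density_def .
qed

text \<open>Chernoff's bound for either tail: on \<open>A\<close> the weight \<open>exp (y * (u - y))\<close> is at least one.\<close>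

lemma normal_tail:
  fixes y :: real and A :: "real set"
  assumes A: "A \<in> sets borel" "\<And>u. u \<in> A \<Longrightarrow> y * (u - y) \<ge> 0"
  shows "measure (density lborel std_normal_density) A \<le> exp (- y\<^sup>2 / 2)"
proof -
  interpret N: prob_space "density lborel std_normal_density" by (rule prob_space_normal_density) simp
  have "ennreal (measure (density lborel std_normal_density) A) = (\<integral>\<^sup>+u. ennreal (std_normal_density u) * indicator A u \<partial>lborel)"
    using A(1) by (simp add: N.emeasure_eq_measure[symmetric] emeasure_density)
  also have "\<dots> \<le> (\<integral>\<^sup>+u. ennreal (exp (- y\<^sup>2)) * (ennreal (std_normal_density u) * ennreal (exp (y * u))) \<partial>lborel)"
  proof (intro nn_integral_mono)
    fix u
    show "ennreal (std_normal_density u) * indicator A u \<le> ennreal (exp (- y\<^sup>2)) * (ennreal (std_normal_density u) * ennreal (exp (y * u)))"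
    proof (cases "u \<in> A")
      case True
      then have "1 \<le> exp (- y\<^sup>2) * exp (y * u)"
        using A(2)[OF True] by (simp add: exp_add[symmetric] power2_eq_square algebra_simps)
      then have "std_normal_density u * 1 \<le> std_normal_density u * (exp (- y\<^sup>2) * exp (y * u))"
        by (intro mult_left_mono) auto
      then show ?thesis using True by (simp add: ennreal_mult[symmetric] ennreal_leI mult_ac)
    qed simp
  qed
  also have "\<dots> = ennreal (exp (- y\<^sup>2)) * ennreal (exp (y\<^sup>2 / 2))"
    using nn_integral_exp_normal[of 1 y] by (simp add: nn_integral_cmult)
  also have "\<dots> = ennreal (exp (- y\<^sup>2 / 2))"
    by (simp add: ennreal_mult[symmetric] exp_add[symmetric])
  finally show ?thesis by simp
qed

lemma normal_cdf_tails:
  "0 \<le> normal_cdf y" "y \<le> 0 \<Longrightarrow> normal_cdf y \<le> exp (- y\<^sup>2 / 2)" "0 \<le> y \<Longrightarrow> \<bar>normal_cdf y - 1\<bar> \<le> exp (- y\<^sup>2 / 2)"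
proof -
  interpret N: prob_space "density lborel std_normal_density" by (rule prob_space_normal_density) simp
  show "0 \<le> normal_cdf y" by (simp add: normal_cdf_def)
  show "normal_cdf y \<le> exp (- y\<^sup>2 / 2)" if "y \<le> 0"
    unfolding normal_cdf_def by (rule normal_tail) (use that in \<open>auto intro: mult_nonpos_nonpos\<close>)
  assume y: "0 \<le> y"
  have "1 - normal_cdf y = measure (density lborel std_normal_density) (space (density lborel std_normal_density) - {..y})"
    unfolding normal_cdf_def by (subst N.prob_compl) auto
  also have "\<dots> \<le> exp (- y\<^sup>2 / 2)" by (rule normal_tail) (use y in auto)
  finally have "1 - normal_cdf y \<le> exp (- y\<^sup>2 / 2)" .
  moreover have "normal_cdf y \<le> 1" by (simp add: normal_cdf_def)
  ultimately show "\<bar>normal_cdf y - 1\<bar> \<le> exp (- y\<^sup>2 / 2)" by simp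
qed

section \<open>The kernel of the continuous line\<close>

text \<open>The derivative in \<open>x\<close>, written as the kernel times its logarithmic derivative.\<close>

definition conga_kernel_dx :: "real \<Rightarrow> real \<Rightarrow> real \<Rightarrow> real" where
  "conga_kernel_dx \<alpha> x z = conga_kernel \<alpha> x z * (1 / (x + \<alpha> * z) - (x - \<alpha> * z) / ((conga_sigma \<alpha>)\<^sup>2 * z))"

text \<open>The standardised position: by the central limit theorem the \<open>k\<close>-th success comes by time \<open>z\<close> with
probability close to \<open>normal_cdf (conga_score \<alpha> k z)\<close>.\<close>

definition conga_score :: "real \<Rightarrow> real \<Rightarrow> real \<Rightarrow> real" where
  "conga_score \<alpha> x z = (\<alpha> * z - x) / (conga_sigma \<alpha> * sqrt z)"

lemma powr_three_halves: "(z::real) \<ge> 0 \<Longrightarrow> z powr (3/2) = z * sqrt z"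
  using powr_add[of z 1 "1/2"] by (cases "z = 0") (auto simp: powr_half_sqrt)

lemma conga_kernel_zero [simp]: "conga_kernel \<alpha> x 0 = 0" "conga_kernel_dx \<alpha> x 0 = 0"
  by (simp_all add: conga_kernel_def conga_kernel_dx_def)

text \<open>The factor \<open>exp (- E / z)\<close> beats every power of \<open>1 / z\<close>; this controls all kernels near time zero.\<close>

lemma exp_reciprocal_bounds:
  fixes E z :: real
  assumes "E > 0" "z > 0"
  shows "(1 + 1 / z)^3 * exp (- E / z) \<le> ((4 / E)^4 * exp E) * z"
proof -
  define y where "y = 1 / z"
  have y: "y > 0" "z = 1 / y" using assms by (auto simp: y_def)
  have "E * (1 + y) / 4 \<le> exp (E * (1 + y) / 4)" using exp_ge_add_one_self[of "E * (1 + y) / 4"] by linarith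
  then have "(E * (1 + y) / 4)^4 \<le> exp (E * (1 + y) / 4)^4"
    using assms y by (intro power_mono) auto
  also have "\<dots> = exp (E * (1 + y))" by (simp flip: exp_of_nat_mult)
  also have "\<dots> = exp E * exp (E * y)" by (simp add: exp_add[symmetric] distrib_left)
  also have "(E * (1 + y) / 4)^4 = (E / 4)^4 * (1 + y)^4" by (simp only: power_mult_distrib[symmetric]) simp
  finally have "(E / 4)^4 * (1 + y)^4 \<le> exp E * exp (E * y)" .
  then have "(4 / E)^4 * ((E / 4)^4 * (1 + y)^4) \<le> (4 / E)^4 * (exp E * exp (E * y))"
    using assms by (intro mult_left_mono) auto
  then have "(1 + y)^4 \<le> (4 / E)^4 * (exp E * exp (E * y))"
    using assms by (simp add: power_divide)
  then have "(1 + y)^4 * exp (- E * y) \<le> (4 / E)^4 * (exp E * exp (E * y)) * exp (- E * y)"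
    by (intro mult_right_mono) auto
  also have "\<dots> = (4 / E)^4 * exp E" by (simp add: exp_add[symmetric] mult.assoc)
  finally have *: "(1 + y)^4 * exp (- E * y) \<le> (4 / E)^4 * exp E" .
  have "y * ((1 + y)^3 * exp (- E * y)) \<le> (1 + y) * ((1 + y)^3 * exp (- E * y))"
    using y by (intro mult_right_mono) auto
  also have "\<dots> = (1 + y)^4 * exp (- E * y)" by (simp add: power_numeral_reduce mult_ac)
  finally have "y * ((1 + y)^3 * exp (- E * y)) \<le> (4 / E)^4 * exp E" using * by linarith
  then have "(1 + y)^3 * exp (- E * y) \<le> (4 / E)^4 * exp E / y" using y by (simp add: pos_le_divide_eq mult.commute)
  then show ?thesis unfolding y(2) by simp
qed

context
  fixes \<alpha> \<sigma> :: real
  assumes \<alpha>: "0 < \<alpha>" "\<alpha> < 1"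
  defines "\<sigma> \<equiv> conga_sigma \<alpha>"
begin

lemma conga_sigma_le: "0 < \<sigma>" "\<sigma>\<^sup>2 = \<alpha> * (1 - \<alpha>)" "\<sigma> \<le> 1/2" "\<sigma>\<^sup>2 \<le> 1/4"
proof -
  show s: "0 < \<sigma>" "\<sigma>\<^sup>2 = \<alpha> * (1 - \<alpha>)" using conga_sigma[OF \<alpha>] by (simp_all add: \<sigma>_def)
  have "0 \<le> (\<alpha> - 1/2)\<^sup>2" by simp
  then show "\<sigma>\<^sup>2 \<le> 1/4" unfolding s by (simp add: power2_eq_square algebra_simps)
  then have "\<sigma>\<^sup>2 \<le> (1/2)\<^sup>2" by (simp add: power2_eq_square)
  then show "\<sigma> \<le> 1/2" using power2_le_imp_le by fastforce
qed

lemmas \<sigma> = conga_sigma_le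

lemma conga_kernel_eq:
  assumes z: "z > 0"
  shows "conga_kernel \<alpha> x z = std_normal_density (conga_score \<alpha> x z) * ((x + \<alpha> * z) / (2 * \<sigma> * (z * sqrt z)))"
proof -
  have "(conga_score \<alpha> x z)\<^sup>2 / 2 = (x - \<alpha> * z)\<^sup>2 / (2 * \<sigma>\<^sup>2 * z)"
    using z \<sigma> by (simp add: conga_score_def \<sigma>_def power_divide power_mult_distrib power2_commute[of "\<alpha> * z" x])
  then show ?thesis
    using z by (simp add: conga_kernel_def std_normal_density_def powr_three_halves \<sigma>_def)
qed

lemma has_derivative_conga_score:
  assumes z: "z > 0"
  shows "(conga_score \<alpha> x has_real_derivative (x + \<alpha> * z) / (2 * \<sigma> * (z * sqrt z))) (at z)"
proof -
  have "(conga_score \<alpha> x has_real_derivative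
     (\<alpha> * (\<sigma> * sqrt z) - (\<alpha> * z - x) * (\<sigma> * (inverse (sqrt z) / 2))) / ((\<sigma> * sqrt z) * (\<sigma> * sqrt z))) (at z)"
    unfolding conga_score_def \<sigma>_def[symmetric] using z \<sigma>
    by (auto intro!: derivative_eq_intros simp: field_simps)
  moreover have "(\<alpha> * (\<sigma> * sqrt z) - (\<alpha> * z - x) * (\<sigma> * (inverse (sqrt z) / 2))) / ((\<sigma> * sqrt z) * (\<sigma> * sqrt z))
     = (x + \<alpha> * z) / (2 * \<sigma> * (z * sqrt z))"
  proof -
    define r where "r = sqrt z"
    have r: "r > 0" "z = r * r" using z by (auto simp: r_def)
    show ?thesis unfolding r_def[symmetric] r(2) using r(1) \<sigma>(1) by (simp add: field_simps)
  qed
  ultimately show ?thesis by simp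
qed

lemma has_derivative_conga_kernel_primitive:
  assumes z: "z > 0"
  shows "((\<lambda>z. normal_cdf (conga_score \<alpha> x z)) has_real_derivative conga_kernel \<alpha> x z) (at z)"
  using DERIV_chain2[OF has_derivative_normal_cdf has_derivative_conga_score[OF z]]
  by (simp add: conga_kernel_eq[OF z])

lemma conga_kernel_dx_eq:
  assumes z: "z > 0" and x: "x > 0"
  shows "conga_kernel_dx \<alpha> x z = std_normal_density (conga_score \<alpha> x z)
    * ((1 - (x + \<alpha> * z) * (x - \<alpha> * z) / (\<sigma>\<^sup>2 * z)) / (2 * \<sigma> * (z * sqrt z)))"
proof -
  have "x + \<alpha> * z > 0" using assms \<alpha> by (simp add: add_pos_pos)
  then have "(x + \<alpha> * z) * (1 / (x + \<alpha> * z) - (x - \<alpha> * z) / (\<sigma>\<^sup>2 * z)) = 1 - (x + \<alpha> * z) * (x - \<alpha> * z) / (\<sigma>\<^sup>2 * z)"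
    by (simp add: right_diff_distrib)
  moreover have "F * (A / B) * Y = F * ((A * Y) / B)" for F A B Y :: real by simp
  ultimately show ?thesis
    by (simp only: conga_kernel_dx_def conga_kernel_eq[OF z] \<sigma>_def[symmetric])
qed

text \<open>The derivative in \<open>x\<close> of the primitive \<open>normal_cdf (conga_score \<alpha> x z)\<close> is a primitive of the derivative.\<close>

lemma has_derivative_conga_kernel_dx_primitive:
  assumes z: "z > 0" and x: "x > 0"
  shows "((\<lambda>z. - (std_normal_density (conga_score \<alpha> x z) / (\<sigma> * sqrt z))) has_real_derivative conga_kernel_dx \<alpha> x z) (at z)"
proof -
  define r where "r = sqrt z"
  have r: "r > 0" "z = r * r" using z by (auto simp: r_def)
  define f where "f = std_normal_density (conga_score \<alpha> x z)"
  have d1: "((\<lambda>z. std_normal_density (conga_score \<alpha> x z)) has_real_derivative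
      - conga_score \<alpha> x z * f * ((x + \<alpha> * z) / (2 * \<sigma> * (z * sqrt z)))) (at z)"
    unfolding f_def by (rule DERIV_chain2[OF has_derivative_std_normal_density has_derivative_conga_score[OF z]])
  have d2: "((\<lambda>z. \<sigma> * sqrt z) has_real_derivative \<sigma> * (inverse (sqrt z) / 2)) (at z)"
    using z by (auto intro!: derivative_eq_intros)
  have "((\<lambda>z. - (std_normal_density (conga_score \<alpha> x z) / (\<sigma> * sqrt z))) has_real_derivative
     - ((- conga_score \<alpha> x z * f * ((x + \<alpha> * z) / (2 * \<sigma> * (z * sqrt z))) * (\<sigma> * sqrt z) - f * (\<sigma> * (inverse (sqrt z) / 2)))
       / ((\<sigma> * sqrt z) * (\<sigma> * sqrt z)))) (at z)"
    unfolding f_def using z \<sigma>(1) by (intro DERIV_minus DERIV_divide d1[unfolded f_def] d2) auto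
  moreover have "- ((- conga_score \<alpha> x z * f * ((x + \<alpha> * z) / (2 * \<sigma> * (z * sqrt z))) * (\<sigma> * sqrt z) - f * (\<sigma> * (inverse (sqrt z) / 2)))
       / ((\<sigma> * sqrt z) * (\<sigma> * sqrt z))) = conga_kernel_dx \<alpha> x z"
  proof -
    have "- ((- (a / (\<sigma> * r)) * f * (b / (2 * \<sigma> * (r * r * r))) * (\<sigma> * r) - f * (\<sigma> * (inverse r / 2))) / ((\<sigma> * r) * (\<sigma> * r)))
        = f * ((1 - b * (- a) / (\<sigma>\<^sup>2 * (r * r))) / (2 * \<sigma> * (r * r * r)))" for a b
      using r(1) \<sigma>(1) by (simp add: divide_simps power2_eq_square) (simp add: algebra_simps)
    from this[of "\<alpha> * z - x" "x + \<alpha> * z"] show ?thesis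
      unfolding conga_kernel_dx_eq[OF z x] f_def[symmetric]
      unfolding conga_score_def \<sigma>_def[symmetric] r_def[symmetric] r(2)[symmetric] by simp
  qed
  ultimately show ?thesis by simp
qed

lemma has_derivative_conga_kernel_dx:
  assumes x: "x > 0" and z: "z \<ge> 0"
  shows "((\<lambda>x. conga_kernel \<alpha> x z) has_real_derivative conga_kernel_dx \<alpha> x z) (at x)"
proof (cases "z = 0")
  case False
  then have z: "z > 0" using z by simp
  define g where "g x = 1 / sqrt (2 * pi) * ((x + \<alpha> * z) / (2 * \<sigma> * z powr (3/2)))" for x
  define e where "e x = exp (- ((x - \<alpha> * z)\<^sup>2 / (2 * \<sigma>\<^sup>2 * z)))" for x
  have pos: "x + \<alpha> * z > 0" using assms \<alpha> z by (simp add: add_pos_pos)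
  have g: "(g has_real_derivative g x / (x + \<alpha> * z)) (at x)"
    unfolding g_def using pos z \<sigma>(1) by (auto intro!: derivative_eq_intros)
  have e: "(e has_real_derivative e x * (- ((x - \<alpha> * z) / (\<sigma>\<^sup>2 * z)))) (at x)"
  proof -
    have nz: "\<sigma>\<^sup>2 * z \<noteq> 0" using z \<sigma>(1) by simp
    have "((\<lambda>x. - ((x - \<alpha> * z)\<^sup>2 / (2 * (\<sigma>\<^sup>2 * z)))) has_real_derivative - ((x - \<alpha> * z) / (\<sigma>\<^sup>2 * z))) (at x)"
      using nz by (auto intro!: derivative_eq_intros simp: field_simps)
    from DERIV_fun_exp[OF this] show ?thesis by (simp add: e_def[abs_def] mult.assoc)
  qed
  have "((\<lambda>x. g x * e x) has_real_derivative g x / (x + \<alpha> * z) * e x + e x * (- ((x - \<alpha> * z) / (\<sigma>\<^sup>2 * z))) * g x) (at x)"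
    by (rule DERIV_mult[OF g e])
  moreover have "(\<lambda>x. g x * e x) = (\<lambda>x. conga_kernel \<alpha> x z)"
    by (simp add: fun_eq_iff g_def e_def conga_kernel_def \<sigma>_def)
  moreover have "conga_kernel_dx \<alpha> x z = g x / (x + \<alpha> * z) * e x + e x * (- ((x - \<alpha> * z) / (\<sigma>\<^sup>2 * z))) * g x"
  proof -
    have "conga_kernel \<alpha> x z = g x * e x" by (simp add: g_def e_def conga_kernel_def \<sigma>_def)
    then show ?thesis unfolding conga_kernel_dx_def \<sigma>_def[symmetric] by (simp add: algebra_simps)
  qed
  ultimately show ?thesis by simp
qed simp

text \<open>Only the exponential factor matters: these bounds are used near time zero and away from the window,
where it overwhelms any polynomial.\<close>

lemma conga_kernel_crude_bounds:
  assumes x: "x > 0" and z: "z > 0"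
  shows "0 < conga_kernel \<alpha> x z"
    "conga_kernel \<alpha> x z \<le> (x + z) / \<sigma> * (1 + 1 / z)\<^sup>2 * exp (- ((x - \<alpha> * z)\<^sup>2 / (2 * \<sigma>\<^sup>2 * z)))"
    "\<bar>conga_kernel_dx \<alpha> x z\<bar> \<le> (x + z) / \<sigma> * (1 / x + (x + z) / \<sigma>\<^sup>2) * (1 + 1 / z)^3 * exp (- ((x - \<alpha> * z)\<^sup>2 / (2 * \<sigma>\<^sup>2 * z)))"
proof -
  define e where "e = exp (- ((x - \<alpha> * z)\<^sup>2 / (2 * \<sigma>\<^sup>2 * z)))"
  have az: "0 < \<alpha> * z" "\<alpha> * z \<le> z" using \<alpha> z by auto
  show pos: "0 < conga_kernel \<alpha> x z" using ln_conga_kernel(2)[OF \<alpha> z] az x by simp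
  have s1: "1 / sqrt (2 * pi) \<le> 1" using pi_gt3 by simp
  have s2: "1 / (z * sqrt z) \<le> (1 + 1 / z)\<^sup>2"
  proof -
    have "1 / sqrt z \<le> 1 + 1 / z"
    proof (cases "z \<ge> 1")
      case True
      then have "1 / sqrt z \<le> 1" by simp
      moreover have "0 < 1 / z" using z by simp
      ultimately show ?thesis by linarith
    next
      case False
      then have "z * 1 \<le> sqrt z"
        using z real_le_rsqrt[of z z] mult_left_mono[of z 1 z] by (simp add: power2_eq_square)
      then have "1 / sqrt z \<le> 1 / z" using z by (intro divide_left_mono) auto
      then show ?thesis by simp
    qed
    then have "1 / z * (1 / sqrt z) \<le> (1 + 1 / z) * (1 + 1 / z)"
      using z by (intro mult_mono) auto
    then show ?thesis by (simp add: power2_eq_square)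
  qed
  have s3: "(x + \<alpha> * z) / (2 * \<sigma>) \<le> (x + z) / \<sigma>"
    using az x z \<sigma>(1) by (intro frac_le) auto
  have "conga_kernel \<alpha> x z = 1 / sqrt (2 * pi) * ((x + \<alpha> * z) / (2 * \<sigma>) * (1 / (z * sqrt z))) * e"
    using z by (simp add: conga_kernel_def e_def \<sigma>_def powr_three_halves)
  also have "\<dots> \<le> 1 * ((x + z) / \<sigma> * (1 + 1 / z)\<^sup>2) * e"
    using s1 s2 s3 x z az \<sigma>(1) by (intro mult_right_mono mult_mono) (auto simp: e_def)
  finally have k: "conga_kernel \<alpha> x z \<le> (x + z) / \<sigma> * (1 + 1 / z)\<^sup>2 * e" by simp
  then show "conga_kernel \<alpha> x z \<le> (x + z) / \<sigma> * (1 + 1 / z)\<^sup>2 * exp (- ((x - \<alpha> * z)\<^sup>2 / (2 * \<sigma>\<^sup>2 * z)))"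
    by (simp add: e_def)
  have "\<bar>1 / (x + \<alpha> * z) - (x - \<alpha> * z) / (\<sigma>\<^sup>2 * z)\<bar> \<le> 1 / x + (x + z) / \<sigma>\<^sup>2 * (1 / z)"
  proof -
    have "\<bar>1 / (x + \<alpha> * z)\<bar> \<le> 1 / x" using x az by (auto intro!: frac_le)
    moreover have "\<bar>(x - \<alpha> * z) / (\<sigma>\<^sup>2 * z)\<bar> \<le> (x + z) / (\<sigma>\<^sup>2 * z)"
    proof -
      have "\<bar>x - \<alpha> * z\<bar> \<le> x + z" using x az z by linarith
      then have "\<bar>x - \<alpha> * z\<bar> / (\<sigma>\<^sup>2 * z) \<le> (x + z) / (\<sigma>\<^sup>2 * z)" using z by (intro divide_right_mono) auto
      then show ?thesis using z by (simp add: abs_divide abs_mult)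
    qed
    ultimately have "\<bar>1 / (x + \<alpha> * z) - (x - \<alpha> * z) / (\<sigma>\<^sup>2 * z)\<bar> \<le> 1 / x + (x + z) / (\<sigma>\<^sup>2 * z)"
      by linarith
    then show ?thesis by simp
  qed
  also have "\<dots> \<le> 1 / x * (1 + 1 / z) + (x + z) / \<sigma>\<^sup>2 * (1 + 1 / z)"
    using x z by (intro add_mono mult_left_mono) (auto simp: divide_simps)
  also have "\<dots> = (1 / x + (x + z) / \<sigma>\<^sup>2) * (1 + 1 / z)" by (simp add: distrib_right)
  finally have b: "\<bar>1 / (x + \<alpha> * z) - (x - \<alpha> * z) / (\<sigma>\<^sup>2 * z)\<bar> \<le> (1 / x + (x + z) / \<sigma>\<^sup>2) * (1 + 1 / z)" .
  have "\<bar>conga_kernel_dx \<alpha> x z\<bar> = conga_kernel \<alpha> x z * \<bar>1 / (x + \<alpha> * z) - (x - \<alpha> * z) / (\<sigma>\<^sup>2 * z)\<bar>"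
    unfolding conga_kernel_dx_def \<sigma>_def[symmetric] abs_mult using pos by simp
  also have "\<dots> \<le> ((x + z) / \<sigma> * (1 + 1 / z)\<^sup>2 * e) * ((1 / x + (x + z) / \<sigma>\<^sup>2) * (1 + 1 / z))"
    using k b pos x z \<sigma>(1) by (intro mult_mono) (auto simp: e_def)
  finally show "\<bar>conga_kernel_dx \<alpha> x z\<bar> \<le> (x + z) / \<sigma> * (1 / x + (x + z) / \<sigma>\<^sup>2) * (1 + 1 / z)^3 * exp (- ((x - \<alpha> * z)\<^sup>2 / (2 * \<sigma>\<^sup>2 * z)))"
    by (simp add: e_def power3_eq_cube power2_eq_square mult_ac)
qed

end

section \<open>The continuous line and its derivative\<close>

lemma integral_reflect_interval:
  fixes f :: "real \<Rightarrow> 'v::euclidean_space"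
  assumes "0 \<le> T" "continuous_on {0..T} f"
  shows "integral {0..T} (\<lambda>s. f (T - s)) = integral {0..T} f"
proof -
  have "(f has_integral integral {0..T} f) (cbox 0 T)"
    using assms by (simp add: integrable_continuous_real integrable_integral)
  from has_integral_affinity[OF this, of "-1" T]
  have "((\<lambda>s. f (- s + T)) has_integral integral {0..T} f) ((\<lambda>s. T - s) ` {0..T})"
    by (simp add: algebra_simps)
  moreover have "(\<lambda>s. T - s) ` {0..T} = {0..T}"
  proof -
    have "s \<in> (\<lambda>s. T - s) ` {0..T}" if "s \<in> {0..T}" for s
      using that by (intro image_eqI[of _ _ "T - s"]) auto
    then show ?thesis by auto
  qed
  ultimately show ?thesis by (simp add: integral_unique add.commute)
qed

text \<open>Joint continuity up to time zero from a linear bound near it, as needed to differentiate under the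
integral sign.\<close>

lemma continuous_on_zero_extension:
  fixes f :: "real \<Rightarrow> real \<Rightarrow> real"
  assumes pos: "\<And>x z. x \<in> X \<Longrightarrow> 0 < z \<Longrightarrow> z \<le> T \<Longrightarrow> continuous (at (x, z) within X \<times> {0..T}) (\<lambda>(x, z). f x z)"
    and zero: "\<And>x. x \<in> X \<Longrightarrow> f x 0 = 0" and z0: "z0 > 0"
    and bound: "\<And>x z. x \<in> X \<Longrightarrow> 0 < z \<Longrightarrow> z < z0 \<Longrightarrow> \<bar>f x z\<bar> \<le> C * z"
  shows "continuous_on (X \<times> {0..T}) (\<lambda>(x, z). f x z)"
  unfolding continuous_on_eq_continuous_within
proof safe
  fix x z assume x: "x \<in> X" and z: "z \<in> {0..T}"
  show "continuous (at (x, z) within X \<times> {0..T}) (\<lambda>(x, z). f x z)"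
  proof (cases "z = 0")
    case False then show ?thesis using pos x z by auto
  next
    case [simp]: True
    let ?F = "at (x, z) within X \<times> {0..T}"
    have snd0: "((\<lambda>p. C * snd p) \<longlongrightarrow> C * snd (x, z)) ?F" by (intro tendsto_intros)
    have "eventually (\<lambda>p. snd p < z0) ?F"
    proof -
      have "(snd \<longlongrightarrow> snd (x, z)) ?F" by (intro tendsto_intros)
      then show ?thesis using z0 by (auto elim!: order_tendstoD(2))
    qed
    moreover have "eventually (\<lambda>p. p \<in> X \<times> {0..T}) ?F" by (simp add: eventually_at_filter)
    ultimately have "eventually (\<lambda>p. norm (case p of (x, z) \<Rightarrow> f x z) \<le> C * snd p) ?F"
    proof eventually_elim
      case (elim p)
      obtain u v where p: "p = (u, v)" by (cases p)
      have uv: "u \<in> X" "0 \<le> v" "v < z0" using elim by (auto simp: p)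
      show ?case
      proof (cases "v = 0")
        case True then show ?thesis using zero[OF uv(1)] by (simp add: p)
      next
        case False then show ?thesis using bound[of u v] uv by (simp add: p)
      qed
    qed
    moreover have "((\<lambda>p. C * snd p) \<longlongrightarrow> 0) ?F" using snd0 by simp
    ultimately have "((\<lambda>(x, z). f x z) \<longlongrightarrow> 0) ?F" by (rule Lim_null_comparison)
    then have "((\<lambda>(x, z). f x z) \<longlongrightarrow> (case (x, z) of (x, z) \<Rightarrow> f x z)) ?F" using zero[OF x] by simp
    then show ?thesis unfolding continuous_within .
  qed
qed

lemma integral_vanishing_primitive:
  fixes F f :: "real \<Rightarrow> real"
  assumes T: "0 < T" and F: "\<And>z. 0 < z \<Longrightarrow> (F has_real_derivative f z) (at z)"
    and z0: "0 < z0" and b: "\<And>z. 0 < z \<Longrightarrow> z < z0 \<Longrightarrow> \<bar>F z\<bar> \<le> C * z"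
  shows "integral {0..T} f = F T"
proof -
  define G where "G z = (if z = 0 then 0 else F z)" for z
  have G: "(G has_real_derivative f z) (at z)" if "0 < z" for z
  proof (rule DERIV_cong_ev[THEN iffD1, OF refl _ refl F[OF that]])
    have "eventually (\<lambda>u. u \<in> {0<..}) (nhds z)" by (rule eventually_nhds_in_open) (use that in auto)
    then show "eventually (\<lambda>u. F u = G u) (nhds z)" by eventually_elim (simp add: G_def)
  qed
  have "continuous_on {0..T} G"
    unfolding continuous_on_eq_continuous_within
  proof
    fix z assume z: "z \<in> {0..T}"
    show "continuous (at z within {0..T}) G"
    proof (cases "z = 0")
      case False
      then have "isCont G z" using z by (intro DERIV_isCont[OF G]) auto
      then show ?thesis by (rule continuous_at_imp_continuous_at_within)
    next
      case [simp]: True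
      have "eventually (\<lambda>u. u < z0) (at 0 within {0..T})"
        by (rule order_tendstoD(2)[OF tendsto_ident_at z0])
      moreover have "eventually (\<lambda>u. u \<in> {0..T}) (at 0 within {0..T})" by (simp add: eventually_at_filter)
      ultimately have "eventually (\<lambda>u. norm (G u) \<le> C * u) (at 0 within {0..T})"
        by eventually_elim (use b in \<open>auto simp: G_def\<close>)
      moreover have "((\<lambda>u. C * u) \<longlongrightarrow> C * 0) (at 0 within {0..T})" by (intro tendsto_intros)
      then have "((\<lambda>u. C * u) \<longlongrightarrow> 0) (at 0 within {0..T})" by simp
      ultimately have "(G \<longlongrightarrow> 0) (at 0 within {0..T})" by (rule Lim_null_comparison)
      then show ?thesis by (simp add: continuous_within G_def)
    qed
  qed
  then have "(f has_integral G T - G 0) {0..T}"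
    using T G by (intro fundamental_theorem_of_calculus_interior) (auto simp: has_real_derivative_iff_has_vector_derivative[symmetric])
  then show ?thesis using T by (simp add: integral_unique G_def)
qed

context
  fixes \<alpha> \<sigma> :: real
  assumes \<alpha>: "0 < \<alpha>" "\<alpha> < 1"
  defines "\<sigma> \<equiv> conga_sigma \<alpha>"
begin

lemmas \<sigma>' = conga_sigma_le(1,3,4)[OF \<alpha>, folded \<sigma>_def]

text \<open>For \<open>x\<close> bounded away from zero and small \<open>z\<close> the exponent is at most \<open>- E / z\<close> with one constant
\<open>E > 0\<close>, so both kernels and their primitives vanish at least linearly at time zero.\<close>

lemma small_time_bounds:
  assumes x1: "0 < x1"
  obtains C z0 where "0 < z0"
    "\<And>x z. x \<in> {x1..x2} \<Longrightarrow> 0 < z \<Longrightarrow> z < z0 \<Longrightarrow> \<bar>conga_kernel \<alpha> x z\<bar> \<le> C * z"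
    "\<And>x z. x \<in> {x1..x2} \<Longrightarrow> 0 < z \<Longrightarrow> z < z0 \<Longrightarrow> \<bar>conga_kernel_dx \<alpha> x z\<bar> \<le> C * z"
    "\<And>x z. x \<in> {x1..x2} \<Longrightarrow> 0 < z \<Longrightarrow> z < z0 \<Longrightarrow> \<bar>normal_cdf (conga_score \<alpha> x z)\<bar> \<le> C * z"
    "\<And>x z. x \<in> {x1..x2} \<Longrightarrow> 0 < z \<Longrightarrow> z < z0 \<Longrightarrow> \<bar>std_normal_density (conga_score \<alpha> x z) / (\<sigma> * sqrt z)\<bar> \<le> C * z"
proof -
  define z0 where "z0 = min 1 (x1 / 2)"
  define E where "E = x1\<^sup>2 / (8 * \<sigma>\<^sup>2)"
  define K where "K = (4 / E)^4 * exp E"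
  define y where "y = max x2 x1 + 1"
  define B where "B = 1 / \<sigma> + y / \<sigma> * (1 + 1 / x1 + y / \<sigma>\<^sup>2)"
  have E: "E > 0" using x1 \<sigma>'(1) by (simp add: E_def)
  have y: "y > 0" using x1 by (simp add: y_def)
  have B: "y / \<sigma> \<le> B" "y / \<sigma> * (1 / x1 + y / \<sigma>\<^sup>2) \<le> B" "1 / \<sigma> \<le> B" "1 \<le> B"
  proof -
    have p: "0 \<le> y / \<sigma>" "0 \<le> y / \<sigma> * (1 / x1)" "0 \<le> y / \<sigma> * (y / \<sigma>\<^sup>2)" "1 \<le> 1 / \<sigma>"
      using x1 y \<sigma>'(1,2) by auto
    have e: "B = 1 / \<sigma> + y / \<sigma> + y / \<sigma> * (1 / x1) + y / \<sigma> * (y / \<sigma>\<^sup>2)"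
      unfolding B_def distrib_left by simp
    show "y / \<sigma> \<le> B" "y / \<sigma> * (1 / x1 + y / \<sigma>\<^sup>2) \<le> B" "1 / \<sigma> \<le> B" "1 \<le> B"
      unfolding e distrib_left using p by linarith+
  qed
  have K: "\<bar>v\<bar> \<le> (B * K) * z" if "\<bar>v\<bar> \<le> b * (1 + 1 / z) ^ i * exp (- ((x - \<alpha> * z)\<^sup>2 / (2 * \<sigma>\<^sup>2 * z)))"
    "b \<le> B" "i \<le> 3" "x \<in> {x1..x2}" "0 < z" "z < z0" for v b x z :: real and i :: nat
  proof -
    have "\<alpha> * z \<le> z" using that \<alpha> by simp
    moreover have "x1 \<le> x" "z < x1 / 2" using that by (auto simp: z0_def)
    ultimately have "x1 / 2 \<le> x - \<alpha> * z" by linarith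
    then have "(x1 / 2)\<^sup>2 \<le> (x - \<alpha> * z)\<^sup>2" using x1 by (intro power_mono) auto
    then have "(x1 / 2)\<^sup>2 / (2 * \<sigma>\<^sup>2 * z) \<le> (x - \<alpha> * z)\<^sup>2 / (2 * \<sigma>\<^sup>2 * z)"
      using that by (intro divide_right_mono) auto
    moreover have "(x1 / 2)\<^sup>2 / (2 * \<sigma>\<^sup>2 * z) = E / z" by (simp add: E_def power_divide)
    ultimately have e: "exp (- ((x - \<alpha> * z)\<^sup>2 / (2 * \<sigma>\<^sup>2 * z))) \<le> exp (- E / z)" by simp
    have "b * (1 + 1 / z) ^ i * exp (- ((x - \<alpha> * z)\<^sup>2 / (2 * \<sigma>\<^sup>2 * z))) \<le> B * (1 + 1 / z) ^ 3 * exp (- E / z)"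
      using that B e by (intro mult_mono power_increasing) auto
    also have "\<dots> = B * ((1 + 1 / z) ^ 3 * exp (- E / z))" by simp
    also have "\<dots> \<le> B * (K * z)"
      unfolding K_def using exp_reciprocal_bounds[OF E \<open>0 < z\<close>] B by (intro mult_left_mono) auto
    finally show ?thesis using that(1) by simp
  qed
  have sc: "(conga_score \<alpha> x z)\<^sup>2 / 2 = (x - \<alpha> * z)\<^sup>2 / (2 * \<sigma>\<^sup>2 * z)" if "z > 0" for x z
    using that by (simp add: conga_score_def \<sigma>_def power_divide power_mult_distrib power2_commute[of "\<alpha> * z" x])
  show ?thesis
  proof (rule that[of z0 "B * K"])
    show "0 < z0" using x1 by (simp add: z0_def)
    fix x z assume x: "x \<in> {x1..x2}" and z: "0 < z" "z < z0"
    have xp: "x > 0" "x + z \<le> y" using x x1 z by (auto simp: y_def z0_def)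
    note cr = conga_kernel_crude_bounds[OF \<alpha> xp(1) z(1), folded \<sigma>_def]
    have "(x + z) / \<sigma> \<le> y / \<sigma>" using xp \<sigma>' by (intro divide_right_mono) auto
    with B have b1: "(x + z) / \<sigma> \<le> B" by linarith
    show "\<bar>conga_kernel \<alpha> x z\<bar> \<le> B * K * z"
      by (rule K[OF _ b1 _ x z, where i = 2]) (use cr in auto)
    have "(x + z) / \<sigma> * (1 / x + (x + z) / \<sigma>\<^sup>2) \<le> y / \<sigma> * (1 / x1 + y / \<sigma>\<^sup>2)"
      using xp x x1 z y \<sigma>' by (intro mult_mono add_mono divide_right_mono divide_left_mono) auto
    with B have b2: "(x + z) / \<sigma> * (1 / x + (x + z) / \<sigma>\<^sup>2) \<le> B" by linarith
    show "\<bar>conga_kernel_dx \<alpha> x z\<bar> \<le> B * K * z"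
      by (rule K[OF cr(3) b2 _ x z]) simp
    have "\<alpha> * z \<le> z" using z \<alpha> by simp
    moreover have "z < x1 / 2" "x1 \<le> x" using z x by (auto simp: z0_def)
    ultimately have "\<alpha> * z - x \<le> 0" using x1 by linarith
    then have "conga_score \<alpha> x z \<le> 0" using z \<sigma>' by (simp add: conga_score_def \<sigma>_def divide_nonpos_pos)
    then have "\<bar>normal_cdf (conga_score \<alpha> x z)\<bar> \<le> 1 * (1 + 1 / z) ^ 0 * exp (- ((x - \<alpha> * z)\<^sup>2 / (2 * \<sigma>\<^sup>2 * z)))"
      using normal_cdf_tails(1,2)[of "conga_score \<alpha> x z"] sc[OF z(1), of x] by simp
    then show "\<bar>normal_cdf (conga_score \<alpha> x z)\<bar> \<le> B * K * z"
      by (rule K[OF _ B(4) _ x z]) simp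
    have "1 / sqrt z \<le> 1 + 1 / z"
    proof -
      have "z \<le> sqrt z" using z real_le_rsqrt[of z z] mult_left_mono[of z 1 z] by (auto simp: power2_eq_square z0_def)
      then have "1 / sqrt z \<le> 1 / z" using z by (intro divide_left_mono) auto
      then show ?thesis by simp
    qed
    moreover have "1 / sqrt (2 * pi) \<le> 1" using pi_gt3 by simp
    ultimately have "1 / sqrt (2 * pi) * exp (- ((x - \<alpha> * z)\<^sup>2 / (2 * \<sigma>\<^sup>2 * z))) * (1 / sqrt z) \<le> 1 * exp (- ((x - \<alpha> * z)\<^sup>2 / (2 * \<sigma>\<^sup>2 * z))) * (1 + 1 / z)"
      using z by (intro mult_mono) auto
    then have "1 / \<sigma> * (1 / sqrt (2 * pi) * exp (- ((x - \<alpha> * z)\<^sup>2 / (2 * \<sigma>\<^sup>2 * z))) * (1 / sqrt z)) \<le> 1 / \<sigma> * (1 * exp (- ((x - \<alpha> * z)\<^sup>2 / (2 * \<sigma>\<^sup>2 * z))) * (1 + 1 / z))"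
      using \<sigma>' by (intro mult_left_mono) auto
    moreover have "std_normal_density (conga_score \<alpha> x z) = 1 / sqrt (2 * pi) * exp (- ((x - \<alpha> * z)\<^sup>2 / (2 * \<sigma>\<^sup>2 * z)))"
      using sc[OF z(1), of x] by (simp add: std_normal_density_def)
    ultimately have "\<bar>std_normal_density (conga_score \<alpha> x z) / (\<sigma> * sqrt z)\<bar> \<le> 1 / \<sigma> * (1 + 1 / z) ^ 1 * exp (- ((x - \<alpha> * z)\<^sup>2 / (2 * \<sigma>\<^sup>2 * z)))"
      using z \<sigma>' by (simp add: abs_mult mult_ac)
    then show "\<bar>std_normal_density (conga_score \<alpha> x z) / (\<sigma> * sqrt z)\<bar> \<le> B * K * z"
      by (rule K[OF _ B(3) _ x z]) simp
  qed
qed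

lemma continuous_on_conga_kernel:
  assumes x1: "0 < x1"
  shows "continuous_on ({x1..x2} \<times> {0..T}) (\<lambda>(x, z). conga_kernel \<alpha> x z)"
    "continuous_on ({x1..x2} \<times> {0..T}) (\<lambda>(x, z). conga_kernel_dx \<alpha> x z)"
proof -
  obtain C z0 where z0: "0 < z0"
    and b: "\<And>x z. x \<in> {x1..x2} \<Longrightarrow> 0 < z \<Longrightarrow> z < z0 \<Longrightarrow> \<bar>conga_kernel \<alpha> x z\<bar> \<le> C * z"
    "\<And>x z. x \<in> {x1..x2} \<Longrightarrow> 0 < z \<Longrightarrow> z < z0 \<Longrightarrow> \<bar>conga_kernel_dx \<alpha> x z\<bar> \<le> C * z"
    using small_time_bounds[OF x1, of x2] by metis
  have op: "open ({0<..} \<times> {0<..} :: (real \<times> real) set)" by (intro open_Times) auto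
  have nz: "x + \<alpha> * z \<noteq> 0" if "0 < x" "0 < z" for x z using that \<alpha> by (smt (verit) mult_pos_pos)
  have c1: "continuous_on ({0<..} \<times> {0<..}) (\<lambda>(x, z). conga_kernel \<alpha> x z)"
    unfolding conga_kernel_def case_prod_beta \<sigma>_def[symmetric] using \<sigma>'
    by (intro continuous_intros) auto
  have c2: "continuous_on ({0<..} \<times> {0<..}) (\<lambda>(x, z). conga_kernel_dx \<alpha> x z)"
    unfolding conga_kernel_dx_def \<sigma>_def[symmetric] case_prod_beta using \<sigma>' c1 nz
    by (intro continuous_intros) (auto simp: case_prod_beta)
  have at: "continuous (at (x, z) within {x1..x2} \<times> {0..T}) f"
    if "continuous_on ({0<..} \<times> {0<..}) f" "x \<in> {x1..x2}" "0 < z" for f :: "real \<times> real \<Rightarrow> real" and x z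
  proof -
    have "(x, z) \<in> {0<..} \<times> {0<..}" using that x1 by auto
    then have "isCont f (x, z)" using that(1) op by (simp add: continuous_on_eq_continuous_at)
    then show ?thesis by (rule continuous_at_imp_continuous_at_within)
  qed
  show "continuous_on ({x1..x2} \<times> {0..T}) (\<lambda>(x, z). conga_kernel \<alpha> x z)"
    by (rule continuous_on_zero_extension[OF at[OF c1] _ z0 b(1)]) auto
  show "continuous_on ({x1..x2} \<times> {0..T}) (\<lambda>(x, z). conga_kernel_dx \<alpha> x z)"
    by (rule continuous_on_zero_extension[OF at[OF c2] _ z0 b(2)]) auto
qed

lemma continuous_on_conga_kernel_section:
  assumes x: "0 < x"
  shows "continuous_on {0..T} (conga_kernel \<alpha> x)" "continuous_on {0..T} (conga_kernel_dx \<alpha> x)"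
proof -
  have p: "continuous_on {0..T} (\<lambda>z. (x, z))" by (intro continuous_intros)
  show "continuous_on {0..T} (conga_kernel \<alpha> x)"
    using continuous_on_compose2[OF continuous_on_conga_kernel(1)[OF x, of x T] p] by (simp add: image_subset_iff)
  show "continuous_on {0..T} (conga_kernel_dx \<alpha> x)"
    using continuous_on_compose2[OF continuous_on_conga_kernel(2)[OF x, of x T] p] by (simp add: image_subset_iff)
qed

text \<open>By the primitives, the mass of the kernel up to time \<open>T\<close> is a normal probability and that of its
derivative is a normal density; both are extreme as soon as \<open>x\<close> is far below \<open>\<alpha> * T\<close>.\<close>

lemma conga_kernel_masses:
  assumes x: "0 < x" and T: "0 < T" "x \<le> \<alpha> * T"
  shows "\<bar>integral {0..T} (conga_kernel \<alpha> x) - 1\<bar> \<le> exp (- ((\<alpha> * T - x)\<^sup>2 / (2 * \<sigma>\<^sup>2 * T)))"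
    "\<bar>integral {0..T} (conga_kernel_dx \<alpha> x)\<bar> \<le> exp (- ((\<alpha> * T - x)\<^sup>2 / (2 * \<sigma>\<^sup>2 * T))) / (\<sigma> * sqrt T)"
proof -
  obtain C z0 where z0: "0 < z0"
    and b: "\<And>z. 0 < z \<Longrightarrow> z < z0 \<Longrightarrow> \<bar>normal_cdf (conga_score \<alpha> x z)\<bar> \<le> C * z"
    "\<And>z. 0 < z \<Longrightarrow> z < z0 \<Longrightarrow> \<bar>std_normal_density (conga_score \<alpha> x z) / (\<sigma> * sqrt z)\<bar> \<le> C * z"
    using small_time_bounds[OF x, of x] by (metis atLeastAtMost_iff order_refl)
  have i1: "integral {0..T} (conga_kernel \<alpha> x) = normal_cdf (conga_score \<alpha> x T)"
    by (rule integral_vanishing_primitive[OF T(1) has_derivative_conga_kernel_primitive[OF \<alpha>] z0 b(1)])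
  have i2: "integral {0..T} (conga_kernel_dx \<alpha> x) = - (std_normal_density (conga_score \<alpha> x T) / (\<sigma> * sqrt T))"
    by (rule integral_vanishing_primitive[OF T(1) has_derivative_conga_kernel_dx_primitive[OF \<alpha> _ x, folded \<sigma>_def] z0]) (use b(2) in auto)
  have sc: "(conga_score \<alpha> x T)\<^sup>2 / 2 = (\<alpha> * T - x)\<^sup>2 / (2 * \<sigma>\<^sup>2 * T)"
    using T by (simp add: conga_score_def \<sigma>_def power_divide power_mult_distrib)
  have "0 \<le> conga_score \<alpha> x T" using T \<sigma>' by (simp add: conga_score_def \<sigma>_def)
  then show "\<bar>integral {0..T} (conga_kernel \<alpha> x) - 1\<bar> \<le> exp (- ((\<alpha> * T - x)\<^sup>2 / (2 * \<sigma>\<^sup>2 * T)))"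
    unfolding i1 using normal_cdf_tails(3)[of "conga_score \<alpha> x T"] sc by simp
  have "- (conga_score \<alpha> x T)\<^sup>2 / 2 = - ((\<alpha> * T - x)\<^sup>2 / (2 * \<sigma>\<^sup>2 * T))" using sc by linarith
  then have "std_normal_density (conga_score \<alpha> x T) = 1 / sqrt (2 * pi) * exp (- ((\<alpha> * T - x)\<^sup>2 / (2 * \<sigma>\<^sup>2 * T)))"
    by (simp only: std_normal_density_def)
  also have "\<dots> \<le> 1 * exp (- ((\<alpha> * T - x)\<^sup>2 / (2 * \<sigma>\<^sup>2 * T)))"
    using pi_gt3 by (intro mult_right_mono) auto
  finally have "std_normal_density (conga_score \<alpha> x T) \<le> exp (- ((\<alpha> * T - x)\<^sup>2 / (2 * \<sigma>\<^sup>2 * T)))" by simp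
  then show "\<bar>integral {0..T} (conga_kernel_dx \<alpha> x)\<bar> \<le> exp (- ((\<alpha> * T - x)\<^sup>2 / (2 * \<sigma>\<^sup>2 * T))) / (\<sigma> * sqrt T)"
    unfolding i2 using T \<sigma>' by (simp add: divide_right_mono)
qed

text \<open>Time is reversed so that the path, rather than the kernel, is evaluated at the integration variable.
The second formula is differentiation under the integral sign.\<close>

lemma conga_cont_eq:
  fixes w :: "real \<Rightarrow> 'v::euclidean_space"
  assumes w: "continuous_on {0..} w" and x: "0 < x" and T: "0 \<le> T"
  shows "conga_cont \<alpha> w x T = integral {0..T} (\<lambda>s. conga_kernel \<alpha> x (T - s) *\<^sub>R w s)"
    "conga_cont_dx \<alpha> w x T = integral {0..T} (\<lambda>s. conga_kernel_dx \<alpha> x (T - s) *\<^sub>R w s)"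
proof -
  have wc: "continuous_on {0..T} (\<lambda>z. w (T - z))"
    by (rule continuous_on_compose2[OF w]) (auto intro!: continuous_intros)
  have flip: "integral {0..T} (\<lambda>z. f z *\<^sub>R w (T - z)) = integral {0..T} (\<lambda>s. f (T - s) *\<^sub>R w s)"
    if "continuous_on {0..T} f" for f :: "real \<Rightarrow> real"
    using integral_reflect_interval[OF T, of "\<lambda>z. f z *\<^sub>R w (T - z)"] that wc by (simp add: continuous_intros)
  have def: "conga_cont \<alpha> w y T = integral {0..T} (\<lambda>z. conga_kernel \<alpha> y z *\<^sub>R w (T - z))" for y
    by (simp add: conga_cont_def conga_kernel_def)
  show "conga_cont \<alpha> w x T = integral {0..T} (\<lambda>s. conga_kernel \<alpha> x (T - s) *\<^sub>R w s)"
    unfolding def by (rule flip[OF continuous_on_conga_kernel_section(1)[OF x]])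
  define U where "U = {x / 2..x + 1}"
  have U: "y \<in> U \<Longrightarrow> 0 < y" for y using x by (auto simp: U_def)
  have "((\<lambda>y. integral (cbox 0 T) (\<lambda>z. conga_kernel \<alpha> y z *\<^sub>R w (T - z))) has_vector_derivative
      integral (cbox 0 T) (\<lambda>z. conga_kernel_dx \<alpha> x z *\<^sub>R w (T - z))) (at x within U)"
  proof (rule leibniz_rule_vector_derivative)
    fix y z assume y: "y \<in> U" and z: "z \<in> cbox 0 T"
    have "((\<lambda>y. conga_kernel \<alpha> y z) has_real_derivative conga_kernel_dx \<alpha> y z) (at y within U)"
      using has_derivative_conga_kernel_dx[OF \<alpha> U[OF y], of z] z by (auto intro: has_field_derivative_at_within)
    from has_vector_derivative_scaleR[OF this has_vector_derivative_const]
    show "((\<lambda>y. conga_kernel \<alpha> y z *\<^sub>R w (T - z)) has_vector_derivative conga_kernel_dx \<alpha> y z *\<^sub>R w (T - z)) (at y within U)"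
      by simp
  next
    fix y assume y: "y \<in> U"
    show "(\<lambda>z. conga_kernel \<alpha> y z *\<^sub>R w (T - z)) integrable_on cbox 0 T"
      unfolding box_real
      by (intro integrable_continuous_real continuous_on_scaleR continuous_on_conga_kernel_section(1)[OF U[OF y]] wc)
  next
    have "continuous_on (U \<times> cbox 0 T) (\<lambda>(y, z). conga_kernel_dx \<alpha> y z)"
      using continuous_on_conga_kernel(2)[of "x / 2" "x + 1" T] x by (simp add: U_def)
    moreover have "continuous_on (U \<times> cbox 0 T) (\<lambda>p. w (T - snd p))"
      by (rule continuous_on_compose2[OF wc]) (auto intro!: continuous_intros)
    ultimately show "continuous_on (U \<times> cbox 0 T) (\<lambda>(y, z). conga_kernel_dx \<alpha> y z *\<^sub>R w (T - z))"
      by (simp add: case_prod_beta continuous_intros)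
  qed (use x in \<open>auto simp: U_def\<close>)
  moreover have "at x within U = at x" using x unfolding U_def by (intro at_within_interior) simp
  ultimately have "((\<lambda>y. conga_cont \<alpha> w y T) has_vector_derivative
      integral {0..T} (\<lambda>z. conga_kernel_dx \<alpha> x z *\<^sub>R w (T - z))) (at x)"
    by (simp add: def)
  then have "conga_cont_dx \<alpha> w x T = integral {0..T} (\<lambda>z. conga_kernel_dx \<alpha> x z *\<^sub>R w (T - z))"
    unfolding conga_cont_dx_def by (rule vector_derivative_at)
  also have "\<dots> = integral {0..T} (\<lambda>s. conga_kernel_dx \<alpha> x (T - s) *\<^sub>R w s)"
    by (rule flip[OF continuous_on_conga_kernel_section(2)[OF x]])
  finally show "conga_cont_dx \<alpha> w x T = \<dots>" .
qed

text \<open>Since \<open>\<sigma>^2 \<le> 1/4\<close>, the exponent is at least \<open>L^2 / (2 * z)\<close>; half of it gives the decay at the worst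
time \<open>z = N\<close>, and the other half absorbs the powers of \<open>1 / z\<close>.\<close>

lemma conga_kernel_tail:
  assumes x: "1 \<le> x" "x \<le> N" and z: "0 \<le> z" "z \<le> N" and L: "2 \<le> L" "L / 2 \<le> \<bar>x - \<alpha> * z\<bar>"
  shows "\<bar>conga_kernel \<alpha> x z\<bar> \<le> 486 / \<sigma>^3 * N\<^sup>2 * exp (- L\<^sup>2 / (4 * N))"
    "\<bar>conga_kernel_dx \<alpha> x z\<bar> \<le> 486 / \<sigma>^3 * N\<^sup>2 * exp (- L\<^sup>2 / (4 * N))"
proof -
  have N: "1 \<le> N" using x by simp
  have "\<bar>conga_kernel \<alpha> x z\<bar> \<le> 486 / \<sigma>^3 * N\<^sup>2 * exp (- L\<^sup>2 / (4 * N)) \<and> \<bar>conga_kernel_dx \<alpha> x z\<bar> \<le> 486 / \<sigma>^3 * N\<^sup>2 * exp (- L\<^sup>2 / (4 * N))"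
  proof (cases "z = 0")
    case True then show ?thesis using \<sigma>' by simp
  next
    case False
    then have z0: "z > 0" using z by simp
    define y where "y = 1 / z"
    have y: "y > 0" "1 / N \<le> y" using z0 z by (auto simp: y_def intro!: divide_left_mono)
    note cr = conga_kernel_crude_bounds[OF \<alpha> _ z0, of x, folded \<sigma>_def]
    define e where "e = exp (- ((x - \<alpha> * z)\<^sup>2 / (2 * \<sigma>\<^sup>2 * z)))"
    have "(L / 2)\<^sup>2 \<le> \<bar>x - \<alpha> * z\<bar>\<^sup>2" using L by (intro power_mono) auto
    then have "(L / 2)\<^sup>2 / (2 * (1/4) * z) \<le> (x - \<alpha> * z)\<^sup>2 / (2 * \<sigma>\<^sup>2 * z)"
      using z0 \<sigma>'(1,3) by (intro frac_le) auto
    then have "L\<^sup>2 / 2 * y \<le> (x - \<alpha> * z)\<^sup>2 / (2 * \<sigma>\<^sup>2 * z)" by (simp add: y_def power_divide)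
    moreover have "L\<^sup>2 / 4 * y \<ge> 1 * y" 
    proof (rule mult_right_mono)
      have "2\<^sup>2 \<le> L\<^sup>2" using L by (intro power_mono) auto
      then show "1 \<le> L\<^sup>2 / 4" by simp
    qed (use y in simp)
    moreover have "L\<^sup>2 / 4 * y \<ge> L\<^sup>2 / 4 * (1 / N)" using y by (intro mult_left_mono) auto
    ultimately have "y + L\<^sup>2 / (4 * N) \<le> (x - \<alpha> * z)\<^sup>2 / (2 * \<sigma>\<^sup>2 * z)" by simp
    then have e: "e \<le> exp (- y) * exp (- L\<^sup>2 / (4 * N))" by (simp add: e_def exp_add[symmetric])
    have "(1 + y) / 3 \<le> exp ((1 + y) / 3)" using exp_ge_add_one_self[of "(1 + y) / 3"] by linarith
    then have "((1 + y) / 3)^3 \<le> exp ((1 + y) / 3)^3" using y by (intro power_mono) auto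
    also have "\<dots> = exp 1 * exp y" by (simp add: exp_add[symmetric] flip: exp_of_nat_mult)
    also have "\<dots> \<le> 3 * exp y" using exp_le by (intro mult_right_mono) auto
    finally have "(1 + y)^3 \<le> 81 * exp y" by (simp add: power_divide)
    then have "(1 + y)^3 * e \<le> (81 * exp y) * (exp (- y) * exp (- L\<^sup>2 / (4 * N)))"
      using e by (intro mult_mono) (auto simp: e_def)
    also have "\<dots> = 81 * (exp y * exp (- y)) * exp (- L\<^sup>2 / (4 * N))" by simp
    finally have ye: "(1 + y)^3 * e \<le> 81 * exp (- L\<^sup>2 / (4 * N))" by (simp add: exp_add[symmetric])
    have s4: "1 \<le> 1 / \<sigma>\<^sup>2" using \<sigma>' by simp
    have "x + z \<le> 2 * N" using x z by simp
    have c1: "(x + z) / \<sigma> * (1 / x + (x + z) / \<sigma>\<^sup>2) \<le> (2 * N / \<sigma>) * (3 * N / \<sigma>\<^sup>2)"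
    proof (intro mult_mono divide_right_mono)
      have "1 / x \<le> 1" using x by simp
      also have "\<dots> \<le> 1 / \<sigma>\<^sup>2" by (rule s4)
      also have "\<dots> \<le> N / \<sigma>\<^sup>2" using N by (intro divide_right_mono) auto
      finally have "1 / x \<le> N / \<sigma>\<^sup>2" .
      moreover have "(x + z) / \<sigma>\<^sup>2 \<le> 2 * N / \<sigma>\<^sup>2" using x z by (intro divide_right_mono) auto
      ultimately show "1 / x + (x + z) / \<sigma>\<^sup>2 \<le> 3 * N / \<sigma>\<^sup>2" by simp
    qed (use x z \<sigma>' N in auto)
    also have c2: "(2 * N / \<sigma>) * (3 * N / \<sigma>\<^sup>2) = 6 / \<sigma>^3 * N\<^sup>2"
      by (simp add: power2_eq_square power3_eq_cube)
    finally have c1: "(x + z) / \<sigma> * (1 / x + (x + z) / \<sigma>\<^sup>2) \<le> 6 / \<sigma>^3 * N\<^sup>2" .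
    have c3: "(x + z) / \<sigma> \<le> 6 / \<sigma>^3 * N\<^sup>2"
    proof -
      have "(x + z) / \<sigma> * 1 \<le> (2 * N / \<sigma>) * (3 * N / \<sigma>\<^sup>2)"
      proof (intro mult_mono divide_right_mono)
        have "1 * 1 \<le> 3 * N * (1 / \<sigma>\<^sup>2)" using N s4 by (intro mult_mono) auto
        then show "1 \<le> 3 * N / \<sigma>\<^sup>2" by simp
      qed (use x z \<sigma>' N in auto)
      then show ?thesis unfolding c2 by simp
    qed
    have fin: "c * (1 + y)^3 * e \<le> 486 / \<sigma>^3 * N\<^sup>2 * exp (- L\<^sup>2 / (4 * N))" if "c \<le> 6 / \<sigma>^3 * N\<^sup>2" for c
    proof -
      have "c * ((1 + y)^3 * e) \<le> (6 / \<sigma>^3 * N\<^sup>2) * (81 * exp (- L\<^sup>2 / (4 * N)))"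
        by (rule mult_mono[OF that ye]) (use y \<sigma>' in \<open>auto simp: e_def\<close>)
      then show ?thesis by (simp add: mult.assoc)
    qed
    have "\<bar>conga_kernel \<alpha> x z\<bar> \<le> (x + z) / \<sigma> * (1 + y)\<^sup>2 * e"
      using cr(1,2) x by (simp add: y_def e_def)
    also have "\<dots> \<le> (x + z) / \<sigma> * (1 + y)^3 * e"
      using x z y \<sigma>' by (intro mult_right_mono mult_left_mono power_increasing) (auto simp: e_def)
    finally have 1: "\<bar>conga_kernel \<alpha> x z\<bar> \<le> (x + z) / \<sigma> * (1 + y)^3 * e" .
    have 2: "\<bar>conga_kernel_dx \<alpha> x z\<bar> \<le> (x + z) / \<sigma> * (1 / x + (x + z) / \<sigma>\<^sup>2) * (1 + y)^3 * e"
      using cr(3) x by (simp add: y_def e_def)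
    show ?thesis using order_trans[OF 1 fin[OF c3]] order_trans[OF 2 fin[OF c1]] by simp
  qed
  then show "\<bar>conga_kernel \<alpha> x z\<bar> \<le> 486 / \<sigma>^3 * N\<^sup>2 * exp (- L\<^sup>2 / (4 * N))"
    "\<bar>conga_kernel_dx \<alpha> x z\<bar> \<le> 486 / \<sigma>^3 * N\<^sup>2 * exp (- L\<^sup>2 / (4 * N))" by auto
qed

end

section \<open>The error at scale n\<close>

text \<open>The comparison of kernels with the delay \<open>m = n - l\<close> as variable.  The window \<open>\<bar>\<alpha> * m - x\<bar> \<le> L\<close> of delays
becomes a window of times of length \<open>2 * L / \<alpha>\<close>; it lies after time zero exactly if
\<open>x + L < \<alpha> * n\<close>, and only then the masses have to agree.\<close>

lemma comparison_at_scale: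
  fixes w :: "real \<Rightarrow> 'v::euclidean_space" and a :: "nat \<Rightarrow> real" and q :: "real \<Rightarrow> real"
  assumes \<alpha>: "0 < \<alpha>" and n: "n \<ge> 1" and R: "2 * L / \<alpha> + 1 \<le> R" "R \<le> real n" and L: "0 \<le> L"
    and pos: "0 \<le> eps" "0 \<le> tau" "0 \<le> Y"
    and w: "continuous_on {0..} w" "w 0 = 0" "tame_path Y n w"
    and q: "continuous_on {0..real n} q" and zero: "a 0 = 0" "q 0 = 0"
    and inside: "\<And>m z. 1 \<le> m \<Longrightarrow> m \<le> n \<Longrightarrow> \<bar>\<alpha> * real m - x\<bar> \<le> L \<Longrightarrow> z \<in> {real m - 1..real m} \<Longrightarrow> \<bar>a m - q z\<bar> \<le> eps"
    and outside: "\<And>m z. 1 \<le> m \<Longrightarrow> m \<le> n \<Longrightarrow> L < \<bar>\<alpha> * real m - x\<bar> \<Longrightarrow> z \<in> {real m - 1..real m} \<Longrightarrow> \<bar>a m\<bar> \<le> tau \<and> \<bar>q z\<bar> \<le> tau"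
    and mass: "x + L < \<alpha> * real n \<Longrightarrow> \<bar>(\<Sum>m\<le>n. a m) - integral {0..real n} q\<bar> \<le> tau"
  shows "norm ((\<Sum>m\<le>n. a m *\<^sub>R w (real (n - m))) - integral {0..real n} (\<lambda>s. q (real n - s) *\<^sub>R w s))
    \<le> 5 * (R * sqrt R) * eps * Y + 10 * (real n)\<^sup>2 * tau * Y"
proof -
  have rev: "(\<Sum>m\<le>n. f m) = (\<Sum>l<n. f (n - l))" if "f 0 = 0" for f :: "nat \<Rightarrow> 'c::comm_monoid_add"
  proof -
    have "(\<Sum>m\<le>n. f m) = (\<Sum>l\<le>n. f (n - l))"
      by (rule sum.reindex_bij_witness[of _ "\<lambda>l. n - l" "\<lambda>l. n - l"]) auto
    also have "\<dots> = (\<Sum>l<n. f (n - l)) + f (n - n)" by (simp flip: lessThan_Suc_atMost)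
    finally show ?thesis using that by simp
  qed
  define lo where "lo = real n - (x + L) / \<alpha>"
  define hi where "hi = real n - (x - L) / \<alpha>"
  have win: "(lo \<le> real l \<and> real l \<le> hi) \<longleftrightarrow> \<bar>\<alpha> * real (n - l) - x\<bar> \<le> L" if "l < n" for l
  proof -
    have "real (n - l) = real n - real l" using that by (simp add: of_nat_diff)
    moreover have "lo \<le> real l \<longleftrightarrow> \<alpha> * (real n - real l) \<le> x + L"
      using \<alpha> by (simp add: lo_def field_simps)
    moreover have "real l \<le> hi \<longleftrightarrow> x - L \<le> \<alpha> * (real n - real l)"
      using \<alpha> by (simp add: hi_def field_simps)
    ultimately show ?thesis by (auto simp: abs_le_iff)
  qed
  have flip: "1 \<le> n - l \<and> n - l \<le> n \<and> real n - s \<in> {real (n - l) - 1..real (n - l)}"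
    if "l < n" "s \<in> {real l..real l + 1}" for l s
    using that by (auto simp: of_nat_diff)
  have "norm ((\<Sum>l<n. a (n - l) *\<^sub>R w (real l)) - integral {0..real n} (\<lambda>s. q (real n - s) *\<^sub>R w s))
    \<le> 5 * (R * sqrt R) * eps * Y + 10 * (real n)\<^sup>2 * tau * Y"
  proof (rule kernel_comparison[OF n _ R(2) pos w, where lo = lo and hi = hi])
    have "0 \<le> 2 * L / \<alpha>" using L \<alpha> by simp
    then show "1 \<le> R" using R by linarith
    show "continuous_on {0..real n} (\<lambda>s. q (real n - s))"
      by (rule continuous_on_compose2[OF q]) (auto intro!: continuous_intros)
    have "hi - lo + 1 = 2 * L / \<alpha> + 1" using \<alpha> by (simp add: hi_def lo_def field_simps)
    then show "hi - lo + 1 \<le> R" using R by simp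
    show "\<bar>a (n - l) - q (real n - s)\<bar> \<le> eps"
      if "l < n" "lo \<le> real l" "real l \<le> hi" "s \<in> {real l..real l + 1}" for l s
      using inside[of "n - l" "real n - s"] win[of l] flip[of l s] that by blast
    show "\<bar>a (n - l)\<bar> \<le> tau \<and> \<bar>q (real n - s)\<bar> \<le> tau"
      if "l < n" "\<not> (lo \<le> real l \<and> real l \<le> hi)" "s \<in> {real l..real l + 1}" for l s
      using outside[of "n - l" "real n - s"] win[of l] flip[of l s] that by (meson not_le)
    show "\<bar>q (real n - real n)\<bar> \<le> tau" using zero pos by simp
    assume "0 < lo"
    then have "x + L < \<alpha> * real n" using \<alpha> by (simp add: lo_def field_simps)
    from mass[OF this]
    show "\<bar>(\<Sum>l<n. a (n - l)) - integral {0..real n} (\<lambda>s. q (real n - s))\<bar> \<le> tau"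
      using rev[of a] zero integral_reflect_interval[OF _ q] by simp
  qed
  moreover have "(\<Sum>m\<le>n. a m *\<^sub>R w (real (n - m))) = (\<Sum>l<n. a (n - l) *\<^sub>R w (real l))"
    by (subst rev) (auto simp: zero intro!: sum.cong)
  ultimately show ?thesis by simp
qed

lemma abs_diff_le_of_ln_close:
  fixes a p d :: real
  assumes "0 < a" "0 < p" "\<bar>ln a - ln p\<bar> \<le> d" "d \<le> 1"
  shows "\<bar>a - p\<bar> \<le> 2 * d * p"
proof -
  define t where "t = ln a - ln p"
  have t: "\<bar>t\<bar> \<le> d" "\<bar>t\<bar> \<le> 1" using assms by (auto simp: t_def)
  have "a = p * exp t" using assms by (simp add: t_def exp_diff)
  then have "a - p = p * (exp t - 1)" by (simp add: algebra_simps)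
  moreover have "\<bar>exp t - 1\<bar> \<le> 2 * \<bar>t\<bar>"
  proof (cases "t \<ge> 0")
    case True
    then have "exp t \<le> 1 + t + t\<^sup>2" using t by (intro exp_bound) auto
    moreover have "t\<^sup>2 \<le> t" using True t by (simp add: power2_eq_square mult_left_le)
    moreover have "1 \<le> exp t" using True by simp
    ultimately show ?thesis using True by simp
  next
    case False
    then have "exp t \<le> 1" by simp
    moreover have "1 + t \<le> exp t" by (rule exp_ge_add_one_self)
    ultimately show ?thesis using False by linarith
  qed
  ultimately have "\<bar>a - p\<bar> \<le> p * (2 * \<bar>t\<bar>)" using assms by (simp add: abs_mult mult_left_mono)
  also have "\<dots> \<le> p * (2 * d)" using assms t by (intro mult_left_mono) auto
  finally show ?thesis by (simp add: mult_ac)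
qed

text \<open>The standing assumptions at one scale \<open>n\<close>: the half-width \<open>L\<close> of the window is at least the Gaussian
width \<open>sqrt n\<close>, it is small compared with \<open>n\<close>, and \<open>L^3\<close> is small compared with \<open>n^2\<close>, so that the relative error in the local limit theorem is at most one.  The numerical constants only have
to be large enough for the elementary estimates.\<close>

context
  fixes \<alpha> \<delta> \<sigma> c L x :: real and n k :: nat
  assumes \<alpha>: "0 < \<alpha>" "\<alpha> < 1" and c: "0 < c" "c \<le> \<alpha>" "c \<le> 1 - \<alpha>" and \<delta>: "0 < \<delta>" "\<delta> < 1"
    and L: "8 \<le> L" "real n \<le> L\<^sup>2" "16 * L \<le> c * \<delta> * real n" "1600 * L ^ 3 \<le> c\<^sup>2 * \<delta>\<^sup>2 * (real n)\<^sup>2"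
    and x: "\<delta> * real n \<le> x" "x \<le> \<alpha> * real n" and k: "\<bar>x - real k\<bar> \<le> 2"
  defines "\<sigma> \<equiv> conga_sigma \<alpha>"
begin

lemmas \<sigma>'' = conga_sigma_le(1,3,4)[OF \<alpha>, folded \<sigma>_def]

lemma scale_facts:
  shows "16 * L \<le> \<delta> * real n" "1 \<le> n" "1 \<le> x" "2 \<le> k" "\<delta> * real n / 2 \<le> real k" "c < 1" "0 < \<delta> * real n"
proof -
  show c1: "c < 1" using c \<alpha> by simp
  have "c * (\<delta> * real n) \<le> 1 * (\<delta> * real n)" using c1 \<delta> by (intro mult_right_mono) auto
  then show *: "16 * L \<le> \<delta> * real n" using L(3) by (simp add: mult.assoc)
  show "0 < \<delta> * real n" using * L(1) by linarith
  show "1 \<le> n" using * L(1) by (cases n) auto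
  show "1 \<le> x" using * L(1) x by linarith
  have "14 * L \<le> real k" using * L(1) x k by linarith
  then show "2 \<le> k" using L(1) by linarith
  show "\<delta> * real n / 2 \<le> real k" using * L(1) x k by linarith
qed

text \<open>The local limit theorem in absolute form, with every size expressed through \<open>n\<close>.  The factor
\<open>6 / (\<sigma> * sqrt (\<delta> * n))\<close> bounds the kernel in the window.  For the derivatives, the relative error of the
kernels is multiplied by a logarithmic derivative of order \<open>L / n\<close>, and the logarithmic derivatives
themselves differ by order \<open>L^2 / n^2\<close>; both contribute at most order \<open>L^4 / n^3\<close> because \<open>n \<le> L^2\<close>.\<close>

lemma conga_local_limit:
  assumes m: "1 \<le> m" "m \<le> n" "\<bar>\<alpha> * real m - x\<bar> \<le> L" and z: "z \<in> {real m - 1..real m}"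
  shows "\<bar>neg_binomial \<alpha> k m - conga_kernel \<alpha> x z\<bar> \<le> 3200 * L ^ 3 / (c\<^sup>2 * \<delta>\<^sup>2 * (real n)\<^sup>2) * (6 / (\<sigma> * sqrt (\<delta> * real n)))"
    "\<bar>(neg_binomial \<alpha> (Suc k) m - neg_binomial \<alpha> k m) - conga_kernel_dx \<alpha> x z\<bar>
      \<le> 13000 * L ^ 4 / (c ^ 4 * \<delta> ^ 3 * (real n) ^ 3) * (6 / (\<sigma> * sqrt (\<delta> * real n)))"
proof -
  note sf = scale_facts
  define N where "N = real n"
  define M where "M = real m"
  define D where "D = \<delta> * N"
  define P where "P = 6 / (\<sigma> * sqrt D)"
  define p where "p = conga_kernel \<alpha> x z"
  define a where "a = neg_binomial \<alpha> k m"
  have D: "16 * L \<le> D" "D > 0" "D \<le> x" using sf x by (simp_all add: D_def N_def)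
  have cD: "16 * L \<le> c * D" using L by (simp add: D_def N_def mult.assoc)
  have aM: "\<alpha> * M \<le> M" using \<alpha> mult_right_mono[of \<alpha> 1 M] by (simp add: M_def)
  have M: "D / 2 \<le> M" using D m(3) aM L(1) unfolding M_def by linarith
  have zM: "M - 1 \<le> z" "z \<le> M" using z by (auto simp: M_def)
  have z4: "M / 2 \<le> z" "D / 4 \<le> z" "0 < z" using M zM D L(1) by linarith+
  have az: "\<alpha> * z \<le> z" "0 < \<alpha> * z" using \<alpha> z4 by auto
  have xp: "0 < x + \<alpha> * z" using D az by linarith
  have km: "k < m"
  proof -
    have "c * M \<le> (1 - \<alpha>) * M" using c by (intro mult_right_mono) (auto simp: M_def)
    moreover have "c * (D / 2) \<le> c * M" using M c by (intro mult_left_mono) auto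
    moreover have "real k \<le> \<alpha> * M + L + 2" using m(3) k unfolding M_def by linarith
    ultimately have "real k < M" using cD L(1) by (simp add: algebra_simps)
    then show ?thesis by (simp add: M_def)
  qed
  have kM: "\<bar>real k - \<alpha> * M\<bar> \<le> 2 * L" using m(3) k L(1) unfolding M_def by linarith
  have lnb: "\<bar>ln a - ln p\<bar> \<le> 50 / c\<^sup>2 * ((2 * L) ^ 3 / M\<^sup>2)"
    unfolding a_def p_def M_def
  proof (rule ln_neg_binomial_conga_kernel[OF \<alpha> c _ km k])
    show "1 \<le> k" using sf by simp
    show "\<bar>z - real m\<bar> \<le> 1" using z by auto
    show "1 \<le> 2 * L" using L by simp
    have "real m \<le> real n" using m by simp
    also have "\<dots> \<le> L\<^sup>2" by (rule L)
    also have "\<dots> \<le> (2 * L)\<^sup>2" using L by (intro power_mono) auto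
    finally show "real m \<le> (2 * L)\<^sup>2" .
    show "\<bar>real k - \<alpha> * real m\<bar> \<le> 2 * L" using kM by (simp add: M_def)
    have "c * (D / 2) \<le> c * M" using M c by (intro mult_left_mono) auto
    then show "4 * (2 * L) \<le> c * real m" using cD by (simp add: M_def)
  qed
  define e where "e = 1600 * L ^ 3 / (c\<^sup>2 * D\<^sup>2)"
  have e: "50 / c\<^sup>2 * ((2 * L) ^ 3 / M\<^sup>2) \<le> e"
  proof -
    have "(2 * L) ^ 3 / M\<^sup>2 \<le> (2 * L) ^ 3 / (D / 2)\<^sup>2"
      using M D L by (intro divide_left_mono power_mono) auto
    then have "50 / c\<^sup>2 * ((2 * L) ^ 3 / M\<^sup>2) \<le> 50 / c\<^sup>2 * ((2 * L) ^ 3 / (D / 2)\<^sup>2)"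
      using c by (intro mult_left_mono) auto
    also have "\<dots> = e" by (simp add: e_def power_divide power_mult_distrib)
    finally show ?thesis .
  qed
  have cD2: "c\<^sup>2 * D\<^sup>2 = c\<^sup>2 * \<delta>\<^sup>2 * (real n)\<^sup>2" by (simp add: D_def N_def power_mult_distrib)
  have e1: "e \<le> 1" using L(4) D c unfolding e_def cD2[symmetric] by (simp add: divide_le_eq_1)
  have p0: "0 < p" unfolding p_def by (rule ln_conga_kernel(2)[OF \<alpha> z4(3) xp])
  have a0: "0 < a"
  proof -
    have "real (m choose k) > 0" using km by simp
    then show ?thesis using sf km \<alpha> m unfolding a_def by (subst neg_binomial_eq_choose) auto
  qed
  have pP: "p \<le> P"
  proof -
    have "x + \<alpha> * z \<le> 2 * M + L" using m(3) aM az zM unfolding M_def by linarith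
    then have x6: "x + \<alpha> * z \<le> 6 * z" using z4 M D by linarith
    have "std_normal_density (conga_score \<alpha> x z) \<le> 1 * 1"
      unfolding std_normal_density_def using pi_gt3 by (intro mult_mono) auto
    then have "p \<le> 1 * ((6 * z) / (2 * \<sigma> * (z * sqrt z)))"
      unfolding p_def conga_kernel_eq[OF \<alpha> z4(3)] \<sigma>_def[symmetric] using x6 xp z4 \<sigma>''
      by (intro mult_mono divide_right_mono) auto
    also have "\<dots> = 3 / (\<sigma> * sqrt z)" using z4 by simp
    also have "\<dots> \<le> 3 / (\<sigma> * sqrt (D / 4))" using z4 D \<sigma>'' by (intro divide_left_mono mult_left_mono) auto
    also have "\<dots> = P" by (simp add: P_def real_sqrt_divide)
    finally show ?thesis .
  qed
  have P0: "0 \<le> P" using p0 pP by linarith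
  have e0: "0 \<le> e" using L by (simp add: e_def)
  have ap: "\<bar>a - p\<bar> \<le> 2 * e * P"
  proof -
    have "\<bar>a - p\<bar> \<le> 2 * e * p" using lnb e e1 by (intro abs_diff_le_of_ln_close a0 p0) auto
    also have "\<dots> \<le> 2 * e * P" using pP e0 by (intro mult_left_mono) auto
    finally show ?thesis .
  qed
  then show "\<bar>neg_binomial \<alpha> k m - conga_kernel \<alpha> x z\<bar> \<le> 3200 * L ^ 3 / (c\<^sup>2 * \<delta>\<^sup>2 * (real n)\<^sup>2) * (6 / (\<sigma> * sqrt (\<delta> * real n)))"
    unfolding a_def p_def e_def P_def cD2 by (simp add: D_def N_def)
  \<comment> \<open>The logarithmic derivatives \<open>A\<close> of the discrete and \<open>B\<close> of the continuous kernel are both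
    \<open>(\<alpha> * M - k) / (\<alpha> * (1 - \<alpha>) * M)\<close> to leading order.\<close>
  define A where "A = (\<alpha> * M - real k) / (real k * (1 - \<alpha>))"
  define B where "B = 1 / (x + \<alpha> * z) - (x - \<alpha> * z) / (\<sigma>\<^sup>2 * z)"
  have kD: "D / 2 \<le> real k" "0 < real k" using sf by (simp_all add: D_def N_def)
  have A: "\<bar>A\<bar> \<le> 4 * L / (c * D)"
  proof -
    have "\<bar>A\<bar> = \<bar>real k - \<alpha> * M\<bar> / (real k * (1 - \<alpha>))"
      using \<alpha> by (simp add: A_def abs_divide abs_mult abs_minus_commute)
    also have "\<dots> \<le> 2 * L / (D / 2 * c)"
      using kM kD c D \<alpha> by (intro frac_le mult_mono) auto
    finally show ?thesis by (simp add: mult.commute)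
  qed
  have \<sigma>2: "\<sigma>\<^sup>2 = \<alpha> * (1 - \<alpha>)" using conga_sigma(2)[OF \<alpha>] by (simp add: \<sigma>_def)
  have c2: "c\<^sup>2 \<le> \<alpha> * (1 - \<alpha>)" using c by (simp add: power2_eq_square mult_mono)
  have AB: "\<bar>A - B\<bar> \<le> 61 * L\<^sup>2 / (c\<^sup>2 * D\<^sup>2)"
  proof -
    define u where "u = \<alpha> * M - real k"
    define v where "v = \<alpha> * z - x"
    have uv: "\<bar>u - v\<bar> \<le> 3"
    proof -
      have "\<alpha> * (M - z) \<le> 1" "0 \<le> \<alpha> * (M - z)" using \<alpha> zM mult_mono[of \<alpha> 1 "M - z" 1] by auto
      moreover have "u - v = \<alpha> * (M - z) + (x - real k)" by (simp add: u_def v_def algebra_simps)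
      ultimately show ?thesis using k by linarith
    qed
    have zk: "\<bar>\<alpha> * z - real k\<bar> \<le> 3 * L"
    proof -
      have "\<alpha> * (M - z) \<le> 1" "0 \<le> \<alpha> * (M - z)" using \<alpha> zM mult_mono[of \<alpha> 1 "M - z" 1] by auto
      moreover have "\<alpha> * z - real k = (\<alpha> * M - real k) - \<alpha> * (M - z)" by (simp add: algebra_simps)
      ultimately show ?thesis using kM L(1) by linarith
    qed
    have eq: "A - B = (u - v) / (\<sigma>\<^sup>2 * z) + u * ((\<alpha> * z - real k) / (\<sigma>\<^sup>2 * (real k * z))) - 1 / (x + \<alpha> * z)"
    proof -
      have "u / (real k * (1 - \<alpha>)) = u / (\<sigma>\<^sup>2 * z) + u * ((\<alpha> * z - real k) / (\<sigma>\<^sup>2 * (real k * z)))"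
      proof -
        have "u / (real k * b) = u / (\<alpha> * b * z) + u * ((\<alpha> * z - real k) / (\<alpha> * b * (real k * z)))" if "b > 0" for b
          using z4 kD \<alpha> that by (simp add: field_simps)
        then show ?thesis unfolding \<sigma>2 using \<alpha> by simp
      qed
      moreover have "(x - \<alpha> * z) / (\<sigma>\<^sup>2 * z) = - (v / (\<sigma>\<^sup>2 * z))" unfolding minus_divide_left v_def by simp
      ultimately show ?thesis unfolding A_def B_def u_def[symmetric] by (simp add: diff_divide_distrib)
    qed
    have s2: "c\<^sup>2 \<le> \<sigma>\<^sup>2" "0 < \<sigma>\<^sup>2" using c2 \<sigma>'' by (simp_all add: \<sigma>2[symmetric])
    have t1: "\<bar>(u - v) / (\<sigma>\<^sup>2 * z)\<bar> \<le> 12 * (1 / (c\<^sup>2 * D))"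
    proof -
      have "\<bar>u - v\<bar> / (\<sigma>\<^sup>2 * z) \<le> 3 / (c\<^sup>2 * (D / 4))"
        using uv s2 z4 c D by (intro frac_le mult_mono mult_pos_pos) auto
      then show ?thesis using s2 z4 by (simp add: abs_divide abs_mult)
    qed
    have t2: "\<bar>u * ((\<alpha> * z - real k) / (\<sigma>\<^sup>2 * (real k * z)))\<bar> \<le> 48 * (L\<^sup>2 / (c\<^sup>2 * D\<^sup>2))"
    proof -
      have "\<bar>u\<bar> \<le> 2 * L" using kM by (simp add: u_def abs_minus_commute)
      moreover have "\<bar>\<alpha> * z - real k\<bar> / (\<sigma>\<^sup>2 * (real k * z)) \<le> 3 * L / (c\<^sup>2 * (D / 2 * (D / 4)))"
        using zk s2 z4 kD c D L by (intro frac_le mult_mono mult_pos_pos) auto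
      ultimately have "\<bar>u\<bar> * (\<bar>\<alpha> * z - real k\<bar> / (\<sigma>\<^sup>2 * (real k * z))) \<le> 2 * L * (3 * L / (c\<^sup>2 * (D / 2 * (D / 4))))"
        using s2 z4 kD L by (intro mult_mono) auto
      also have "\<dots> = 48 * (L\<^sup>2 / (c\<^sup>2 * D\<^sup>2))" by (simp add: power2_eq_square)
      finally show ?thesis using s2 z4 kD by (simp add: abs_divide abs_mult)
    qed
    have c21: "c\<^sup>2 \<le> 1" using c sf by (simp add: power_le_one)
    have t3: "\<bar>1 / (x + \<alpha> * z)\<bar> \<le> 1 / (c\<^sup>2 * D)"
    proof -
      have "c\<^sup>2 * D \<le> 1 * D" using c21 D by (intro mult_right_mono) auto
      then have "c\<^sup>2 * D \<le> x + \<alpha> * z" using D az by linarith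
      then show ?thesis using xp c D by (auto intro!: frac_le)
    qed
    have DL: "1 / (c\<^sup>2 * D) \<le> L\<^sup>2 / (c\<^sup>2 * D\<^sup>2)"
    proof -
      have "D \<le> 1 * N" unfolding D_def using \<delta> by (intro mult_right_mono) (auto simp: N_def)
      then have "D \<le> L\<^sup>2" using L(2) by (simp add: N_def)
      then have "D / (c\<^sup>2 * D\<^sup>2) \<le> L\<^sup>2 / (c\<^sup>2 * D\<^sup>2)" by (intro divide_right_mono) auto
      then show ?thesis using D by (simp add: power2_eq_square)
    qed
    have tri: "\<bar>X + Y - Z\<bar> \<le> X' + Y' + Z'" if "\<bar>X\<bar> \<le> X'" "\<bar>Y\<bar> \<le> Y'" "\<bar>Z\<bar> \<le> Z'" for X Y Z X' Y' Z' :: real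
      using that by linarith
    have "\<bar>A - B\<bar> \<le> 12 * (1 / (c\<^sup>2 * D)) + 48 * (L\<^sup>2 / (c\<^sup>2 * D\<^sup>2)) + 1 / (c\<^sup>2 * D)"
      unfolding eq by (rule tri[OF t1 t2 t3])
    also have "\<dots> \<le> 61 * (L\<^sup>2 / (c\<^sup>2 * D\<^sup>2))"
    proof -
      have "12 * X + 48 * Y + X \<le> 61 * Y" if "X \<le> Y" for X Y :: real using that by linarith
      then show ?thesis using DL by blast
    qed
    finally show ?thesis by simp
  qed
  have step: "neg_binomial \<alpha> (Suc k) m - neg_binomial \<alpha> k m = a * A"
    unfolding a_def A_def M_def using sf km by (intro neg_binomial_step \<alpha>) auto
  have dx: "conga_kernel_dx \<alpha> x z = p * B" by (simp add: conga_kernel_dx_def p_def B_def \<sigma>_def)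
  define V where "V = L ^ 4 / (c ^ 4 * \<delta> ^ 3 * N ^ 3)"
  have N: "0 < N" "N \<le> L\<^sup>2" using L sf by (auto simp: N_def)
  have "a * A - p * B = (a - p) * A + p * (A - B)" by (simp add: algebra_simps)
  then have "\<bar>a * A - p * B\<bar> \<le> \<bar>a - p\<bar> * \<bar>A\<bar> + \<bar>p\<bar> * \<bar>A - B\<bar>"
    by (metis abs_mult abs_triangle_ineq)
  also have "\<dots> \<le> (2 * e * P) * (4 * L / (c * D)) + P * (61 * L\<^sup>2 / (c\<^sup>2 * D\<^sup>2))"
    using ap A AB pP p0 P0 e0 by (intro add_mono mult_mono) auto
  also have "(2 * e * P) * (4 * L / (c * D)) = 12800 * (c * V) * P"
    using c by (simp add: e_def V_def D_def field_simps power_numeral_reduce)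
  also have "12800 * (c * V) * P \<le> 12800 * V * P"
  proof -
    have "0 \<le> V" using c \<delta> N by (simp add: V_def)
    then have "c * V \<le> V" using sf c by (simp add: mult_left_le_one_le)
    then show ?thesis using P0 by (simp add: mult_right_mono)
  qed
  also have "61 * L\<^sup>2 / (c\<^sup>2 * D\<^sup>2) \<le> 61 * V"
  proof -
    have "L\<^sup>2 / (c\<^sup>2 * D\<^sup>2) = (L\<^sup>2 * N) * (c\<^sup>2 * \<delta>) / (c ^ 4 * \<delta> ^ 3 * N ^ 3)"
      using c \<delta> N by (simp add: D_def field_simps power_numeral_reduce)
    also have "\<dots> \<le> (L\<^sup>2 * L\<^sup>2) * 1 / (c ^ 4 * \<delta> ^ 3 * N ^ 3)"
    proof (intro divide_right_mono mult_mono)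
      have "c\<^sup>2 * \<delta> \<le> 1 * 1" using c sf \<delta> by (intro mult_mono power_le_one) auto
      then show "c\<^sup>2 * \<delta> \<le> 1" by simp
    qed (use N c \<delta> in auto)
    also have "\<dots> = V" by (simp add: V_def power_numeral_reduce)
    finally show ?thesis by simp
  qed
  then have "P * (61 * L\<^sup>2 / (c\<^sup>2 * D\<^sup>2)) \<le> P * (61 * V)" using P0 by (intro mult_left_mono) auto
  finally have "\<bar>a * A - p * B\<bar> \<le> 12800 * V * P + P * (61 * V)" by simp
  also have "\<dots> \<le> 13000 * V * P"
  proof -
    have "0 \<le> V * P" using P0 c \<delta> N by (simp add: V_def)
    then show ?thesis by (simp add: mult_ac)
  qed
  finally show "\<bar>(neg_binomial \<alpha> (Suc k) m - neg_binomial \<alpha> k m) - conga_kernel_dx \<alpha> x z\<bar>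
      \<le> 13000 * L ^ 4 / (c ^ 4 * \<delta> ^ 3 * (real n) ^ 3) * (6 / (\<sigma> * sqrt (\<delta> * real n)))"
    unfolding step dx by (simp add: V_def P_def D_def N_def)
qed

lemma conga_tails:
  assumes m: "1 \<le> m" "m \<le> n" "L < \<bar>\<alpha> * real m - x\<bar>" and z: "z \<in> {real m - 1..real m}"
  defines "\<tau> \<equiv> 500 / \<sigma> ^ 3 * (real n)\<^sup>2 * exp (- L\<^sup>2 / (4 * real n))"
  shows "\<bar>neg_binomial \<alpha> k m\<bar> \<le> \<tau>" "\<bar>neg_binomial \<alpha> (Suc k) m - neg_binomial \<alpha> k m\<bar> \<le> \<tau>"
    "\<bar>conga_kernel \<alpha> x z\<bar> \<le> \<tau>" "\<bar>conga_kernel_dx \<alpha> x z\<bar> \<le> \<tau>"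
proof -
  note sf = scale_facts
  define t where "t = exp (- L\<^sup>2 / (4 * real n))"
  have t: "exp (- 2 * (L / 2)\<^sup>2 / real n) \<le> t"
  proof -
    have "L\<^sup>2 / (4 * real n) \<le> L\<^sup>2 / (2 * real n)" using sf by (intro divide_left_mono) auto
    then show ?thesis by (simp add: t_def power_divide)
  qed
  have big: "4 \<le> 486 / \<sigma> ^ 3 * (real n)\<^sup>2"
  proof -
    have "1 \<le> 1 / \<sigma> ^ 3" using \<sigma>'' by (simp add: power_le_one)
    moreover have "1 \<le> (real n)\<^sup>2" using sf by simp
    ultimately have "1 * 1 \<le> 1 / \<sigma> ^ 3 * (real n)\<^sup>2" using \<sigma>'' by (intro mult_mono) auto
    then show ?thesis by simp
  qed
  have t0: "0 \<le> t" by (simp add: t_def)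
  have up: "486 / \<sigma> ^ 3 * (real n)\<^sup>2 * t \<le> \<tau>"
    unfolding \<tau>_def t_def using \<sigma>'' by (intro mult_right_mono divide_right_mono) auto
  have 4: "4 * t \<le> \<tau>" using mult_right_mono[OF big t0] up by linarith
  have nb: "\<bar>neg_binomial \<alpha> j m\<bar> \<le> 2 * t" if "j = k \<or> j = Suc k" for j
  proof -
    have "\<bar>neg_binomial \<alpha> j m\<bar> \<le> 2 * exp (- 2 * (L / 2)\<^sup>2 / real n)"
    proof (rule neg_binomial_tail[OF \<alpha> _ _ _ m(1,2)])
      show "2 \<le> j" "0 \<le> L / 2" using that sf L(1) by auto
      have "real j = real k \<or> real j = real k + 1" using that by auto
      then show "L / 2 \<le> \<bar>\<alpha> * real m - real j\<bar> - 1" using m(3) k L(1) by linarith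
    qed
    then show ?thesis using t by linarith
  qed
  show "\<bar>neg_binomial \<alpha> k m\<bar> \<le> \<tau>" using nb[of k] 4 t0 by linarith
  show "\<bar>neg_binomial \<alpha> (Suc k) m - neg_binomial \<alpha> k m\<bar> \<le> \<tau>" using nb[of k] nb[of "Suc k"] 4 by linarith
  have zz: "0 \<le> z" "z \<le> real n" using z m by auto
  have xn: "x \<le> real n" using x \<alpha> mult_right_mono[of \<alpha> 1 "real n"] by simp
  have "\<alpha> * (real m - z) \<le> 1" "0 \<le> \<alpha> * (real m - z)" using \<alpha> z mult_mono[of \<alpha> 1 "real m - z" 1] by auto
  then have Lz: "L / 2 \<le> \<bar>x - \<alpha> * z\<bar>" using m(3) L(1) unfolding right_diff_distrib by linarith
  have "2 \<le> L" using L(1) by simp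
  from conga_kernel_tail[OF \<alpha> sf(3) xn zz this Lz, folded \<sigma>_def t_def] up
  show "\<bar>conga_kernel \<alpha> x z\<bar> \<le> \<tau>" "\<bar>conga_kernel_dx \<alpha> x z\<bar> \<le> \<tau>" by linarith+
qed

lemma conga_mass_match:
  assumes far: "x + L < \<alpha> * real n"
  defines "\<tau> \<equiv> 500 / \<sigma> ^ 3 * (real n)\<^sup>2 * exp (- L\<^sup>2 / (4 * real n))"
  shows "\<bar>(\<Sum>m\<le>n. neg_binomial \<alpha> k m) - integral {0..real n} (conga_kernel \<alpha> x)\<bar> \<le> \<tau>"
    "\<bar>(\<Sum>m\<le>n. neg_binomial \<alpha> (Suc k) m - neg_binomial \<alpha> k m) - integral {0..real n} (conga_kernel_dx \<alpha> x)\<bar> \<le> \<tau>"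
proof -
  note sf = scale_facts
  define t where "t = exp (- L\<^sup>2 / (4 * real n))"
  have n0: "0 < real n" using sf by simp
  have t: "exp (- 2 * (L / 2)\<^sup>2 / real n) \<le> t"
  proof -
    have "L\<^sup>2 / (4 * real n) \<le> L\<^sup>2 / (2 * real n)" using sf by (intro divide_left_mono) auto
    then show ?thesis by (simp add: t_def power_divide)
  qed
  have t': "exp (- ((\<alpha> * real n - x)\<^sup>2 / (2 * \<sigma>\<^sup>2 * real n))) \<le> t"
  proof -
    have "L\<^sup>2 \<le> (\<alpha> * real n - x)\<^sup>2" using far L(1) by (intro power_mono) auto
    then have "L\<^sup>2 / (4 * real n) \<le> (\<alpha> * real n - x)\<^sup>2 / (2 * \<sigma>\<^sup>2 * real n)"
      using n0 \<sigma>'' by (intro frac_le mult_right_mono) auto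
    then show ?thesis by (simp add: t_def)
  qed
  have s3: "1 \<le> 1 / \<sigma>" "1 / \<sigma> \<le> 1 / \<sigma> ^ 3" "1 \<le> 1 / \<sigma> ^ 3"
  proof -
    show s: "1 \<le> 1 / \<sigma>" using \<sigma>'' by simp
    have "1 / \<sigma> * 1 \<le> 1 / \<sigma> * ((1 / \<sigma>) * (1 / \<sigma>))"
      using mult_mono[OF s s] \<sigma>'' by (intro mult_left_mono) auto
    then show "1 / \<sigma> \<le> 1 / \<sigma> ^ 3" by (simp add: power3_eq_cube)
    with s show "1 \<le> 1 / \<sigma> ^ 3" by linarith
  qed
  have n2: "1 \<le> (real n)\<^sup>2" using sf by simp
  have t0: "0 \<le> t" by (simp add: t_def)
  have up: "3 / \<sigma> ^ 3 * t \<le> \<tau>"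
  proof -
    have "3 / \<sigma> ^ 3 * 1 \<le> 500 / \<sigma> ^ 3 * (real n)\<^sup>2" using n2 \<sigma>'' by (intro mult_mono divide_right_mono) auto
    then show ?thesis unfolding \<tau>_def t_def[symmetric] using t0 by (intro mult_right_mono) auto
  qed
  have up2: "2 * t + t * (1 / \<sigma>) \<le> \<tau>"
  proof -
    have "t * (1 / \<sigma>) \<le> t * (1 / \<sigma> ^ 3)" "t * 1 \<le> t * (1 / \<sigma> ^ 3)" using s3 t0 by (intro mult_left_mono; simp)+
    moreover have "3 / \<sigma> ^ 3 * t = 3 * (t * (1 / \<sigma> ^ 3))" by simp
    ultimately show ?thesis using up by linarith
  qed
  have nb: "\<bar>(\<Sum>m\<le>n. neg_binomial \<alpha> j m) - 1\<bar> \<le> t" if "j = k \<or> j = Suc k" for j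
  proof -
    have "\<bar>(\<Sum>m\<le>n. neg_binomial \<alpha> j m) - 1\<bar> \<le> exp (- 2 * (L / 2)\<^sup>2 / real n)"
    proof (rule neg_binomial_mass_defect[OF \<alpha> _ _ sf(2)])
      show "0 \<le> L / 2" using L(1) by simp
      have "real j = real k \<or> real j = real k + 1" using that by auto
      then show "L / 2 \<le> \<alpha> * real n - real j" using far k L(1) by linarith
    qed
    then show ?thesis using t by linarith
  qed
  have x0: "0 < x" "x \<le> \<alpha> * real n" using sf x by auto
  note km = conga_kernel_masses[OF \<alpha> x0(1) n0 x0(2), folded \<sigma>_def]
  have "t * 1 \<le> t * (1 / \<sigma>)" using s3 t0 by (intro mult_left_mono) auto
  then show "\<bar>(\<Sum>m\<le>n. neg_binomial \<alpha> k m) - integral {0..real n} (conga_kernel \<alpha> x)\<bar> \<le> \<tau>"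
    using nb[of k] km(1) t' up2 t0 by linarith
  have "\<bar>integral {0..real n} (conga_kernel_dx \<alpha> x)\<bar> \<le> t * (1 / \<sigma>)"
  proof -
    have "exp (- ((\<alpha> * real n - x)\<^sup>2 / (2 * \<sigma>\<^sup>2 * real n))) / (\<sigma> * sqrt (real n)) \<le> t / (\<sigma> * 1)"
      using t' t0 sf \<sigma>'' by (intro frac_le mult_left_mono) auto
    then show ?thesis using km(2) by simp
  qed
  then show "\<bar>(\<Sum>m\<le>n. neg_binomial \<alpha> (Suc k) m - neg_binomial \<alpha> k m) - integral {0..real n} (conga_kernel_dx \<alpha> x)\<bar> \<le> \<tau>"
    unfolding sum_subtractf using nb[of k] nb[of "Suc k"] up2 by linarith
qed

text \<open>The deterministic half of the proof: for every tame path the comparison applies to the kernels and to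
their derivatives, uniformly in \<open>x\<close>.\<close>

lemma conga_error_bounds:
  fixes w :: "real \<Rightarrow> 'v::euclidean_space"
  assumes w: "continuous_on {0..} w" "w 0 = 0" "tame_path Y n w" and Y: "0 \<le> Y" and R: "2 * L / \<alpha> + 1 \<le> R" "R \<le> real n"
  defines "\<tau> \<equiv> 500 / \<sigma> ^ 3 * (real n)\<^sup>2 * exp (- L\<^sup>2 / (4 * real n))"
  shows "norm (conga \<alpha> w (Suc k) n - conga_cont \<alpha> w x (real n))
      \<le> 5 * (R * sqrt R) * (3200 * L ^ 3 / (c\<^sup>2 * \<delta>\<^sup>2 * (real n)\<^sup>2) * (6 / (\<sigma> * sqrt (\<delta> * real n)))) * Y
        + 10 * (real n)\<^sup>2 * \<tau> * Y"
    "norm (conga \<alpha> w (Suc (Suc k)) n - conga \<alpha> w (Suc k) n - conga_cont_dx \<alpha> w x (real n))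
      \<le> 5 * (R * sqrt R) * (13000 * L ^ 4 / (c ^ 4 * \<delta> ^ 3 * (real n) ^ 3) * (6 / (\<sigma> * sqrt (\<delta> * real n)))) * Y
        + 10 * (real n)\<^sup>2 * \<tau> * Y"
proof -
  note sf = scale_facts
  have x0: "0 < x" "0 \<le> real n" using sf by auto
  obtain j where j: "k = Suc j" using sf by (cases k) auto
  have \<tau>0: "0 \<le> \<tau>" unfolding \<tau>_def using \<sigma>'' by simp
  show "norm (conga \<alpha> w (Suc k) n - conga_cont \<alpha> w x (real n))
      \<le> 5 * (R * sqrt R) * (3200 * L ^ 3 / (c\<^sup>2 * \<delta>\<^sup>2 * (real n)\<^sup>2) * (6 / (\<sigma> * sqrt (\<delta> * real n)))) * Y
        + 10 * (real n)\<^sup>2 * \<tau> * Y"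
    unfolding conga_eq_neg_binomial_average conga_cont_eq(1)[OF \<alpha> w(1) x0]
    by (rule comparison_at_scale[OF \<alpha>(1) sf(2) R _ _ \<tau>0 Y w continuous_on_conga_kernel_section(1)[OF \<alpha> x0(1)]])
      (use L \<sigma>'' j \<delta> conga_local_limit(1) conga_tails(1,3)[folded \<tau>_def] conga_mass_match(1)[folded \<tau>_def] in auto)
  have "conga \<alpha> w (Suc (Suc k)) n - conga \<alpha> w (Suc k) n
     = (\<Sum>m\<le>n. (neg_binomial \<alpha> (Suc k) m - neg_binomial \<alpha> k m) *\<^sub>R w (real (n - m)))"
    unfolding conga_eq_neg_binomial_average by (simp add: sum_subtractf scaleR_diff_left)
  then show "norm (conga \<alpha> w (Suc (Suc k)) n - conga \<alpha> w (Suc k) n - conga_cont_dx \<alpha> w x (real n))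
      \<le> 5 * (R * sqrt R) * (13000 * L ^ 4 / (c ^ 4 * \<delta> ^ 3 * (real n) ^ 3) * (6 / (\<sigma> * sqrt (\<delta> * real n)))) * Y
        + 10 * (real n)\<^sup>2 * \<tau> * Y"
    unfolding conga_cont_eq(2)[OF \<alpha> w(1) x0]
    by (simp only:) (rule comparison_at_scale[OF \<alpha>(1) sf(2) R _ _ \<tau>0 Y w continuous_on_conga_kernel_section(2)[OF \<alpha> x0(1)]],
      (use L \<sigma>'' j \<delta> c conga_local_limit(2) conga_tails(2,4)[folded \<tau>_def] conga_mass_match(2)[folded \<tau>_def] in auto))
qed

end

section \<open>Interpolation, asymptotics and the theorem\<close>

text \<open>Since \<open>x\<close> is comparable to \<open>N\<close>, powers of \<open>x\<close> of either sign are comparable to those of \<open>N\<close>.\<close>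

lemma powr_le_at_scale:
  fixes d e x N :: real
  assumes "0 < d" "1 \<le> N" "d * N \<le> x" "x \<le> N"
  shows "x powr e \<le> (1 + d powr e) * N powr e"
proof (cases "0 \<le> e")
  case True
  have "0 \<le> x" using assms by (meson mult_nonneg_nonneg order_trans less_imp_le zero_le_one)
  then have "x powr e \<le> N powr e" using True assms by (intro powr_mono2) auto
  also have "\<dots> \<le> (1 + d powr e) * N powr e" by (simp add: distrib_right)
  finally show ?thesis .
next
  case False
  have "0 < d * N" using assms by simp
  then have "x powr e \<le> (d * N) powr e" using False assms by (intro powr_mono2') auto
  also have "\<dots> = d powr e * N powr e" using assms by (simp add: powr_mult)
  also have "\<dots> \<le> (1 + d powr e) * N powr e" by (simp add: distrib_right)
  finally show ?thesis .
qed

lemma conga_interp_dx_eq: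
  fixes w :: "real \<Rightarrow> 'v::real_normed_vector"
  assumes "0 \<le> x"
  shows "conga_interp_dx \<alpha> w x n = conga \<alpha> w (Suc (nat \<lfloor>x\<rfloor>)) n - conga \<alpha> w (nat \<lfloor>x\<rfloor>) n"
proof (cases "x \<in> \<int>")
  case True then show ?thesis by (simp add: conga_interp_dx_def)
next
  case False
  define k where "k = nat \<lfloor>x\<rfloor>"
  define D where "D = conga \<alpha> w (Suc k) n - conga \<alpha> w k n"
  have kx: "real k = of_int \<lfloor>x\<rfloor>" using assms by (simp add: k_def)
  have "real k \<noteq> x" using False kx by (metis Ints_of_int)
  then have x: "x \<in> {real k<..<real k + 1}" using kx by (auto simp: less_le) linarith+
  have "((\<lambda>y. conga \<alpha> w k n + (y - real k) *\<^sub>R D) has_vector_derivative D) (at x)"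
    by (auto intro!: derivative_eq_intros)
  then have "((\<lambda>y. conga_interp \<alpha> w y n) has_vector_derivative D) (at x)"
  proof (rule has_vector_derivative_transform_within_open[OF _ _ x])
    fix y assume y: "y \<in> {real k<..<real k + 1}"
    then have "\<lfloor>y\<rfloor> = int k" by (intro floor_unique) auto
    then show "conga \<alpha> w k n + (y - real k) *\<^sub>R D = conga_interp \<alpha> w y n"
      by (simp add: conga_interp_def D_def)
  qed simp
  then have "vector_derivative (\<lambda>y. conga_interp \<alpha> w y n) (at x) = D" by (rule vector_derivative_at)
  then show ?thesis using False by (simp add: conga_interp_dx_def D_def k_def)
qed

text \<open>The interpolation is a convex combination of its two neighbours.\<close>

lemma conga_interp_error:
  fixes w :: "real \<Rightarrow> 'v::real_normed_vector"
  assumes "0 \<le> x" "norm (conga \<alpha> w (nat \<lfloor>x\<rfloor>) n - u) \<le> B" "norm (conga \<alpha> w (Suc (nat \<lfloor>x\<rfloor>)) n - u) \<le> B"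
  shows "norm (conga_interp \<alpha> w x n - u) \<le> B"
proof -
  define k where "k = nat \<lfloor>x\<rfloor>"
  define \<theta> where "\<theta> = x - real k"
  have \<theta>: "0 \<le> \<theta>" "\<theta> \<le> 1" using assms(1) by (auto simp: \<theta>_def k_def) linarith+
  have "conga_interp \<alpha> w x n - u = (1 - \<theta>) *\<^sub>R (conga \<alpha> w k n - u) + \<theta> *\<^sub>R (conga \<alpha> w (Suc k) n - u)"
    by (simp add: conga_interp_def Let_def k_def \<theta>_def algebra_simps)
  also have "norm \<dots> \<le> (1 - \<theta>) * B + \<theta> * B"
    using \<theta> assms(2,3) unfolding k_def[symmetric]
    by (intro order_trans[OF norm_triangle_ineq] add_mono) (auto intro!: mult_left_mono)
  also have "\<dots> = B" by (simp add: algebra_simps)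
  finally show ?thesis .
qed

lemma powr_scale_identity:
  fixes N k \<epsilon> a :: real and i j :: nat
  assumes N: "0 < N" and k: "0 < k" and \<delta>: "0 < \<delta>"
  defines "L \<equiv> N powr (1/2 + \<epsilon>)"
  shows "N powr a * (k * L * sqrt (k * L) * (L ^ i / N ^ j * (1 / sqrt (\<delta> * N))) * N powr \<epsilon>)
    = k * sqrt k / sqrt \<delta> * N powr (a + (real i / 2 - real j + 1/4) + (real i + 5/2) * \<epsilon>)"
proof -
  have "sqrt L = N powr (1/4 + \<epsilon>/2)"
    using N by (simp add: L_def powr_half_sqrt[symmetric] powr_powr algebra_simps)
  moreover have "L ^ i = N powr ((1/2 + \<epsilon>) * real i)" "N ^ j = N powr real j" "sqrt N = N powr (1/2)"
    using N by (simp_all add: L_def powr_power powr_realpow powr_half_sqrt mult.commute)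
  ultimately have "N powr a * (k * L * sqrt (k * L) * (L ^ i / N ^ j * (1 / sqrt (\<delta> * N))) * N powr \<epsilon>)
     = k * sqrt k / sqrt \<delta> * (N powr a * N powr (1/2 + \<epsilon>) * N powr (1/4 + \<epsilon>/2) * N powr ((1/2 + \<epsilon>) * real i) * N powr (- real j)
         * N powr (- (1/2)) * N powr \<epsilon>)"
    using k N \<delta> unfolding L_def[symmetric] by (simp add: real_sqrt_mult powr_minus_divide mult_ac)
  also have "N powr a * N powr (1/2 + \<epsilon>) * N powr (1/4 + \<epsilon>/2) * N powr ((1/2 + \<epsilon>) * real i) * N powr (- real j)
         * N powr (- (1/2)) * N powr \<epsilon>
     = N powr (a + (1/2 + \<epsilon>) + (1/4 + \<epsilon>/2) + (1/2 + \<epsilon>) * real i + (- real j) + (- (1/2)) + \<epsilon>)"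
    by (simp only: powr_add)
  also have "a + (1/2 + \<epsilon>) + (1/4 + \<epsilon>/2) + (1/2 + \<epsilon>) * real i + (- real j) + (- (1/2)) + \<epsilon>
     = a + (real i / 2 - real j + 1/4) + (real i + 5/2) * \<epsilon>"
    by (simp add: algebra_simps add_divide_distrib)
  finally show ?thesis .
qed

text \<open>Exponent bookkeeping.  With \<open>L = n powr (1/2 + \<epsilon>)\<close> and \<open>R\<close> of order \<open>L\<close> the main term has order
\<open>n powr (- a + (i + 5/2) * \<epsilon>)\<close>, by the relation between \<open>a\<close>, \<open>i\<close> and \<open>j\<close>; it is used with
\<open>(a, i, j) = (1/4, 3, 2)\<close> for the positions and \<open>(3/4, 4, 3)\<close> for the derivatives.  The other term is
smaller than any power of \<open>n\<close>.\<close>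

lemma eventually_scaled_error_le:
  fixes \<alpha> \<delta> \<epsilon> \<mu> \<sigma> a C Ct K :: real and i j :: nat
  assumes \<alpha>: "0 < \<alpha>" and \<delta>: "0 < \<delta>" and \<epsilon>: "0 < \<epsilon>" and \<mu>: "0 < \<mu>"
    and expo: "a + real i / 2 - real j + 1/4 = 0" and i: "real i + 5/2 < 14"
  defines "L \<equiv> \<lambda>n::nat. real n powr (1/2 + \<epsilon>)"
  defines "R \<equiv> \<lambda>n. (2 / \<alpha> + 1) * L n"
  shows "eventually (\<lambda>n. K * real n powr (a - 14 * \<epsilon>) *
      (5 * (R n * sqrt (R n)) * (C * L n ^ i / (D * (real n) ^ j) * (6 / (\<sigma> * sqrt (\<delta> * real n)))) * (2 * real n powr \<epsilon>)
        + 10 * (real n)\<^sup>2 * (Ct * (real n)\<^sup>2 * exp (- (L n)\<^sup>2 / (4 * real n))) * (2 * real n powr \<epsilon>)) \<le> \<mu>) sequentially"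
proof -
  define k where "k = 2 / \<alpha> + 1"
  have k: "0 < k" using \<alpha> by (simp add: k_def add_pos_pos)
  define r where "r = 14 - (real i + 5/2)"
  have r: "0 < r * \<epsilon>" using i \<epsilon> by (simp add: r_def)
  have main: "real n powr (a - 14 * \<epsilon>) * (R n * sqrt (R n) * (L n ^ i / real n ^ j * (1 / sqrt (\<delta> * real n))) * real n powr \<epsilon>)
     = k * sqrt k / sqrt \<delta> * real n powr (- (r * \<epsilon>))" if "0 < n" for n
  proof -
    have "(a - 14 * \<epsilon>) + (real i / 2 - real j + 1/4) + (real i + 5/2) * \<epsilon> = (a + real i / 2 - real j + 1/4) - r * \<epsilon>"
      by (simp add: r_def algebra_simps)
    then have e: "(a - 14 * \<epsilon>) + (real i / 2 - real j + 1/4) + (real i + 5/2) * \<epsilon> = - (r * \<epsilon>)" using expo by simp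
    show ?thesis
      using powr_scale_identity[of "real n" k \<delta> "a - 14 * \<epsilon>" \<epsilon> i j] that k \<delta>
      unfolding e R_def k_def[symmetric] L_def by simp
  qed
  have lim1: "(\<lambda>n. real n powr (- (r * \<epsilon>))) \<longlonglongrightarrow> 0"
    using r by (intro tendsto_neg_powr filterlim_real_sequentially) auto
  have lim2: "(\<lambda>n::nat. real n powr (a - 14 * \<epsilon>) * ((real n)\<^sup>2 * ((real n)\<^sup>2 * exp (- (L n)\<^sup>2 / (4 * real n))) * real n powr \<epsilon>)) \<longlonglongrightarrow> 0"
    unfolding L_def using \<epsilon> by real_asymp
  have "(\<lambda>n. K * 60 * C / (D * \<sigma>) * (k * sqrt k / sqrt \<delta> * real n powr (- (r * \<epsilon>)))
      + K * 20 * Ct * (real n powr (a - 14 * \<epsilon>) * ((real n)\<^sup>2 * ((real n)\<^sup>2 * exp (- (L n)\<^sup>2 / (4 * real n))) * real n powr \<epsilon>))) \<longlonglongrightarrow> 0"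
    using tendsto_add[OF tendsto_mult_left[OF tendsto_mult_left[OF lim1, of "k * sqrt k / sqrt \<delta>"], of "K * 60 * C / (D * \<sigma>)"]
      tendsto_mult_left[OF lim2, of "K * 20 * Ct"]] by (simp only: mult_zero_right add_0_left)
  then have "eventually (\<lambda>n. K * 60 * C / (D * \<sigma>) * (k * sqrt k / sqrt \<delta> * real n powr (- (r * \<epsilon>)))
      + K * 20 * Ct * (real n powr (a - 14 * \<epsilon>) * ((real n)\<^sup>2 * ((real n)\<^sup>2 * exp (- (L n)\<^sup>2 / (4 * real n))) * real n powr \<epsilon>)) < \<mu>) sequentially"
    using \<mu> by (rule order_tendstoD(2))
  then show ?thesis
    using eventually_gt_at_top[of 0]
  proof eventually_elim
    case (elim n)
    have "K * real n powr (a - 14 * \<epsilon>) *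
      (5 * (R n * sqrt (R n)) * (C * L n ^ i / (D * (real n) ^ j) * (6 / (\<sigma> * sqrt (\<delta> * real n)))) * (2 * real n powr \<epsilon>)
        + 10 * (real n)\<^sup>2 * (Ct * (real n)\<^sup>2 * exp (- (L n)\<^sup>2 / (4 * real n))) * (2 * real n powr \<epsilon>))
      = K * 60 * C / (D * \<sigma>) * (real n powr (a - 14 * \<epsilon>) * (R n * sqrt (R n) * (L n ^ i / real n ^ j * (1 / sqrt (\<delta> * real n))) * real n powr \<epsilon>))
      + K * 20 * Ct * (real n powr (a - 14 * \<epsilon>) * ((real n)\<^sup>2 * ((real n)\<^sup>2 * exp (- (L n)\<^sup>2 / (4 * real n))) * real n powr \<epsilon>))"
    proof -
      have "K * P * (5 * (R * S) * (C * Li / (D * Nj) * (6 / (\<sigma> * q))) * (2 * E) + 10 * n2 * (Ct * n2 * ex) * (2 * E))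
        = K * 60 * C / (D * \<sigma>) * (P * (R * S * (Li / Nj * (1 / q)) * E)) + K * 20 * Ct * (P * (n2 * (n2 * ex) * E))"
        for P R S Li Nj q E n2 ex :: real
        by (simp add: distrib_left mult_ac)
      then show ?thesis .
    qed
    from this[unfolded main[OF elim(2)]] elim(1) show ?case by (simp only: less_imp_le)
  qed
qed

theorem theorem4:
  fixes M :: "'a measure" and W :: "real \<Rightarrow> 'a \<Rightarrow> real ^ 2" and \<alpha> \<delta> \<eta> \<mu> :: real
  assumes "0 < \<alpha>" and "\<alpha> < 1"
    and "standard_brownian_motion M W"
    and "0 < \<delta>" and "\<delta> < \<alpha>"
    and "\<eta> > 0" and "\<mu> > 0"
  shows "AE \<omega> in M. \<exists>N::nat. N > 0 \<and> (\<forall>n\<ge>N.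
      (SUP x\<in>{\<delta> * real n..\<alpha> * real n}.
         ereal (x powr (1/4 - \<eta>) *
           norm (conga_interp \<alpha> (\<lambda>t. W t \<omega>) x n - conga_cont \<alpha> (\<lambda>t. W t \<omega>) x (real n))))
        \<le> ereal \<mu> \<and>
      (SUP x\<in>{\<delta> * real n..\<alpha> * real n}.
         ereal (x powr (3/4 - \<eta>) *
           norm (conga_interp_dx \<alpha> (\<lambda>t. W t \<omega>) x n - conga_cont_dx \<alpha> (\<lambda>t. W t \<omega>) x (real n))))
        \<le> ereal \<mu>)"
proof -
  note \<alpha> = \<open>0 < \<alpha>\<close> \<open>\<alpha> < 1\<close>
  \<comment> \<open>The errors have orders \<open>n powr (-1/4 + 11/2 * \<epsilon>)\<close> and \<open>n powr (-3/4 + 13/2 * \<epsilon>)\<close>, so a loss of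
    \<open>n powr (14 * \<epsilon>)\<close> covers both.  The cap on \<open>\<epsilon>\<close> keeps \<open>L n ^ 3\<close> small against \<open>n^2\<close>.\<close>
  define \<epsilon> where "\<epsilon> = min \<eta> 1 / 14"
  have \<epsilon>: "0 < \<epsilon>" "\<epsilon> \<le> 1/14" "14 * \<epsilon> \<le> \<eta>" using \<open>\<eta> > 0\<close> by (auto simp: \<epsilon>_def)
  define c where "c = min \<alpha> (1 - \<alpha>)"
  have c: "0 < c" "c \<le> \<alpha>" "c \<le> 1 - \<alpha>" using \<alpha> by (auto simp: c_def)
  define \<sigma> where "\<sigma> = conga_sigma \<alpha>"
  have \<sigma>: "0 < \<sigma>" using conga_sigma(1)[OF \<alpha>] by (simp add: \<sigma>_def)
  have \<delta>: "0 < \<delta>" "\<delta> < 1" using assms by auto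
  define L where "L n = real n powr (1/2 + \<epsilon>)" for n :: nat
  define R where "R n = (2 / \<alpha> + 1) * L n" for n
  define Y where "Y n = 2 * real n powr \<epsilon>" for n :: nat
  define \<tau> where "\<tau> n = 500 / \<sigma> ^ 3 * (real n)\<^sup>2 * exp (- (L n)\<^sup>2 / (4 * real n))" for n
  define B1 where "B1 n = 5 * (R n * sqrt (R n)) * (3200 * L n ^ 3 / (c\<^sup>2 * \<delta>\<^sup>2 * (real n)\<^sup>2) * (6 / (\<sigma> * sqrt (\<delta> * real n)))) * Y n
        + 10 * (real n)\<^sup>2 * \<tau> n * Y n" for n
  define B2 where "B2 n = 5 * (R n * sqrt (R n)) * (13000 * L n ^ 4 / (c ^ 4 * \<delta> ^ 3 * (real n) ^ 3) * (6 / (\<sigma> * sqrt (\<delta> * real n)))) * Y n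
        + 10 * (real n)\<^sup>2 * \<tau> n * Y n" for n
  define K where "K e = 1 + \<delta> powr e" for e
  have K: "0 < K e" for e by (simp add: K_def add_pos_nonneg)
  have ev: "eventually (\<lambda>n. K (1/4 - 14 * \<epsilon>) * real n powr (1/4 - 14 * \<epsilon>) * B1 n \<le> \<mu>) sequentially"
    "eventually (\<lambda>n. K (3/4 - 14 * \<epsilon>) * real n powr (3/4 - 14 * \<epsilon>) * B2 n \<le> \<mu>) sequentially"
    unfolding B1_def B2_def R_def Y_def \<tau>_def L_def
    by (rule eventually_scaled_error_le[OF \<alpha>(1) \<delta>(1) \<epsilon>(1) \<open>\<mu> > 0\<close>]; simp)+
  have "0 < c * \<delta>" "0 < 2 / \<alpha> + 1" "0 < c\<^sup>2 * \<delta>\<^sup>2" using c \<delta> \<alpha> by (auto simp: add_pos_pos)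
  then have sizes: "eventually (\<lambda>n. 8 \<le> L n) sequentially" "eventually (\<lambda>n. real n \<le> (L n)\<^sup>2) sequentially"
    "eventually (\<lambda>n. 16 * L n \<le> c * \<delta> * real n) sequentially"
    "eventually (\<lambda>n. 1600 * L n ^ 3 \<le> c\<^sup>2 * \<delta>\<^sup>2 * (real n)\<^sup>2) sequentially"
    "eventually (\<lambda>n. R n \<le> real n) sequentially"
    unfolding R_def L_def using \<epsilon>(1,2) by real_asymp+
  from AE_tame_path[OF \<open>standard_brownian_motion M W\<close> \<epsilon>(1)]
  show ?thesis
  proof eventually_elim
    case (elim \<omega>)
    define w where "w = (\<lambda>t. W t \<omega>)"
    have w: "continuous_on {0..} w" "w 0 = 0" and tame: "eventually (\<lambda>n. tame_path (Y n) n w) sequentially"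
      using elim by (simp_all add: w_def Y_def)
    have main: "eventually (\<lambda>n. n > 0 \<and> (\<forall>x\<in>{\<delta> * real n..\<alpha> * real n}.
        x powr (1/4 - \<eta>) * norm (conga_interp \<alpha> w x n - conga_cont \<alpha> w x (real n)) \<le> \<mu> \<and>
        x powr (3/4 - \<eta>) * norm (conga_interp_dx \<alpha> w x n - conga_cont_dx \<alpha> w x (real n)) \<le> \<mu>)) sequentially"
      using tame ev sizes eventually_gt_at_top[of 0]
    proof eventually_elim
      case (elim n)
      note tame = elim(1) and ev = elim(2,3) and L = elim(4-7) and R = elim(8) and n = elim(9)
      have "\<forall>x\<in>{\<delta> * real n..\<alpha> * real n}.
        x powr (1/4 - \<eta>) * norm (conga_interp \<alpha> w x n - conga_cont \<alpha> w x (real n)) \<le> \<mu> \<and>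
        x powr (3/4 - \<eta>) * norm (conga_interp_dx \<alpha> w x n - conga_cont_dx \<alpha> w x (real n)) \<le> \<mu>"
      proof
        fix x assume x: "x \<in> {\<delta> * real n..\<alpha> * real n}"
        then have x': "\<delta> * real n \<le> x" "x \<le> \<alpha> * real n" by auto
        define k where "k = nat \<lfloor>x\<rfloor>"
        have "c * (\<delta> * real n) \<le> 1 * (\<delta> * real n)" using c \<alpha> \<delta> by (intro mult_right_mono) auto
        then have x1: "16 * 8 \<le> x" using L(1,3) x' by (simp add: mult.assoc)
        then have kx: "real k \<le> x" "x < real k + 1" unfolding k_def by linarith+
        \<comment> \<open>The member with index \<open>k\<close> has \<open>j = k - 1\<close> delays, so the bounds are used for \<open>j\<close> and \<open>k\<close>.\<close>
        then obtain j where j: "k = Suc j" using x1 by (cases k) auto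
        have R1: "2 * L n / \<alpha> + 1 \<le> R n" using L(1) by (simp add: R_def algebra_simps)
        have Y: "0 \<le> Y n" by (simp add: Y_def)
        have kj: "\<bar>x - real k\<bar> \<le> 2" "\<bar>x - real j\<bar> \<le> 2" using kx by (auto simp: j)
        note err = conga_error_bounds[OF \<alpha> c \<delta> L x' _ w tame Y R1 R, folded \<sigma>_def, folded \<tau>_def]
        have e1: "norm (conga_interp \<alpha> w x n - conga_cont \<alpha> w x (real n)) \<le> B1 n"
        proof (rule conga_interp_error)
          show "0 \<le> x" using x1 by simp
          show "norm (conga \<alpha> w (nat \<lfloor>x\<rfloor>) n - conga_cont \<alpha> w x (real n)) \<le> B1 n"
            using err(1)[OF kj(2)] by (simp only: k_def[symmetric] j B1_def)
          show "norm (conga \<alpha> w (Suc (nat \<lfloor>x\<rfloor>)) n - conga_cont \<alpha> w x (real n)) \<le> B1 n"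
            using err(1)[OF kj(1)] by (simp only: k_def[symmetric] B1_def)
        qed
        have e2: "norm (conga_interp_dx \<alpha> w x n - conga_cont_dx \<alpha> w x (real n)) \<le> B2 n"
        proof -
          have "conga_interp_dx \<alpha> w x n = conga \<alpha> w (Suc (Suc j)) n - conga \<alpha> w (Suc j) n"
            using x1 by (subst conga_interp_dx_eq) (simp_all add: k_def[symmetric] j)
          then show ?thesis using err(2)[OF kj(2)] by (simp only: B2_def)
        qed
        have xn: "x \<le> real n" using x' \<alpha> mult_right_mono[of \<alpha> 1 "real n"] by simp
        have weight: "x powr (a - \<eta>) * r \<le> \<mu>" if "0 \<le> r" "r \<le> b" "K (a - 14 * \<epsilon>) * real n powr (a - 14 * \<epsilon>) * b \<le> \<mu>" for a b r
        proof -
          have "x powr (a - \<eta>) \<le> x powr (a - 14 * \<epsilon>)" using \<epsilon> x1 by (intro powr_mono) auto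
          also have "\<dots> \<le> K (a - 14 * \<epsilon>) * real n powr (a - 14 * \<epsilon>)"
            unfolding K_def using \<delta> n x' xn by (intro powr_le_at_scale) auto
          finally have "x powr (a - \<eta>) * r \<le> K (a - 14 * \<epsilon>) * real n powr (a - 14 * \<epsilon>) * b"
            using that K[of "a - 14 * \<epsilon>"] by (intro mult_mono) auto
          with that show ?thesis by linarith
        qed
        show "x powr (1/4 - \<eta>) * norm (conga_interp \<alpha> w x n - conga_cont \<alpha> w x (real n)) \<le> \<mu> \<and>
          x powr (3/4 - \<eta>) * norm (conga_interp_dx \<alpha> w x n - conga_cont_dx \<alpha> w x (real n)) \<le> \<mu>"
          using weight[OF _ e1 ev(1)] weight[OF _ e2 ev(2)] by simp
      qed
      with n show ?case by simp
    qed
    then obtain N where N: "\<And>n. n \<ge> N \<Longrightarrow> n > 0 \<and> (\<forall>x\<in>{\<delta> * real n..\<alpha> * real n}.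
        x powr (1/4 - \<eta>) * norm (conga_interp \<alpha> w x n - conga_cont \<alpha> w x (real n)) \<le> \<mu> \<and>
        x powr (3/4 - \<eta>) * norm (conga_interp_dx \<alpha> w x n - conga_cont_dx \<alpha> w x (real n)) \<le> \<mu>)"
      unfolding eventually_sequentially by blast
    have "N > 0" using N[of N] by blast
    moreover have "\<forall>n\<ge>N.
      (SUP x\<in>{\<delta> * real n..\<alpha> * real n}. ereal (x powr (1/4 - \<eta>) * norm (conga_interp \<alpha> w x n - conga_cont \<alpha> w x (real n)))) \<le> ereal \<mu> \<and>
      (SUP x\<in>{\<delta> * real n..\<alpha> * real n}. ereal (x powr (3/4 - \<eta>) * norm (conga_interp_dx \<alpha> w x n - conga_cont_dx \<alpha> w x (real n)))) \<le> ereal \<mu>"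
      using N by (intro allI impI conjI SUP_least) auto
    ultimately show ?case unfolding w_def by blast
  qed
qed

end
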